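(* Let $V$ be any 8-dimensional real vector space equipped with a hyper-Hermitian structure, and let $\mathcal C\subset\mathfrak R^{Sp(2)}$ be the associated $Sp(2)$-orbit of cubic discriminants. Then $\mathcal C$ is a 7-dimensional manifold, diffeomorphic to the homogeneous space $Sp(2)/Sp(1)_{\mathrm{ir}}$.
   Context: A hyper-Hermitian structure on the real 8-dimensional space $V$ is a positive definite inner product $g$ and endomorphisms $J_1,J_2,J_3$ with $J_1J_2=-J_2J_1=J_3$, $J_s^2=-\mathrm{Id}$, $g(J_sx,J_sy)=g(x,y)$. All tensors are extended complex-linearly to $V^{\mathbb C}=V\otimes\mathbb C$. Let $W\subset V^{\mathbb C}$ be the $i$-eigenspace of $J_1$, so $V^{\mathbb C}=W\oplus\overline W$. The complex 2-form $\pi$ is determined by $g(x,y)=\pi(x,J_2y)$. A basis $e_1,\dots,e_4$ of $W$ is called $Sp(2)$-adapted if $e_3=J_2\overline{e_1}$, $e_4=J_2\overline{e_2}$ and $\pi|_W=e^1\wedge e^3+e^2\wedge e^4$ (equivalently, also $g(e_\alpha,\overline{e_\beta})=\delta_{\alpha\beta}$). $Sp(2)$ is the group of linear transformations of $V$ preserving $g,J_1,J_2,J_3$; it acts naturally on tensors on $V$ and complex-linearly on $W$. $\mathfrak R^{Sp(2)}$ is the space of all $K\in\Lambda^2V^*\otimes\Lambda^2V^*$ with $K(x,y,z,w)+K(y,z,x,w)+K(z,x,y,w)=0$ and $K(x,y,J_sz,J_sw)=K(x,y,z,w)$ for $s=1,2,3$. For $K\in\mathfrak R^{Sp(2)}$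 put $S(x,y,z,w)=\frac12\big(K(x,J_2y,z,J_2w)-K(x,J_3y,z,J_3w)\big)$. $\mathcal C$ is the set of all $K\in\mathfrak R^{Sp(2)}$ for which there is an $Sp(2)$-adapted basis $\{e_\alpha\}$ of $W$ such that for all $x=\sum_\alpha x^\alpha e_\alpha\in W$ $$S(x,x,x,x)=-18x^1x^2x^3x^4+4\sqrt3\,x^1(x^4)^3-4\sqrt3\,(x^2)^3x^3+3(x^2)^2(x^4)^2-9(x^1)^2(x^3)^2 .$$ It is an orbit of $Sp(2)$. $Sp(1)_{\mathrm{ir}}\subset Sp(2)$: let $Sp(1)\cong SU(2)$ act in the standard way on $\Delta=\mathbb C^2$, with its invariant complex 2-form and invariant antilinear quaternionic structure; these induce on $S^3\Delta\cong\mathbb C^4$ an invariant 2-form and quaternionic structure, i.e. an invariant hyper-Hermitian structure. Identifying $S^3\Delta$ with $W$ compatibly with these structures, $Sp(1)_{\mathrm{ir}}$ is the image of $Sp(1)$ in $Sp(2)\subset GL_{\mathbb C}(W)$ (well defined up to conjugation in $Sp(2)$). *)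

theory Defs
  imports "HOL-Analysis.Analysis"
begin

section \<open>Smooth maps and smooth manifolds\<close>

fun k_times_differentiable_on ::
  "nat \<Rightarrow> 'a::real_normed_vector set \<Rightarrow> ('a \<Rightarrow> 'b::real_normed_vector) \<Rightarrow> bool" where
  "k_times_differentiable_on 0 U f \<longleftrightarrow> continuous_on U f"
| "k_times_differentiable_on (Suc k) U f \<longleftrightarrow>
     (\<forall>x\<in>U. f differentiable (at x)) \<and>
     (\<forall>v. k_times_differentiable_on k U (\<lambda>x. frechet_derivative f (at x) v))"

text \<open>Meant for open \<open>U\<close> in a finite-dimensional space, where it says that \<open>f\<close> is of
  class \<open>C\<^sup>\<infinity>\<close> on \<open>U\<close>.\<close>

definition smooth_on :: "'a::real_normed_vector set \<Rightarrow> ('a \<Rightarrow> 'b::real_normed_vector) \<Rightarrow> bool" where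
  "smooth_on U f \<longleftrightarrow> (\<forall>k. k_times_differentiable_on k U f)"

text \<open>Smoothness on an arbitrary subset: local extendability to smooth functions on open sets.\<close>

definition smooth_on_subset ::
  "'a::real_normed_vector set \<Rightarrow> ('a \<Rightarrow> 'b::real_normed_vector) \<Rightarrow> bool" where
  "smooth_on_subset S f \<longleftrightarrow>
     (\<forall>x\<in>S. \<exists>U F. open U \<and> x \<in> U \<and> smooth_on U F \<and> (\<forall>y\<in>S \<inter> U. F y = f y))"

text \<open>A chart is a domain together with a map into the model space \<open>'n\<close>; the values of the map
  outside the domain are irrelevant.\<close>

type_synonym ('m, 'n) chart = "'m set \<times> ('m \<Rightarrow> 'n)"

definition smooth_manifold :: "'m topology \<Rightarrow> ('m, 'n::euclidean_space) chart set \<Rightarrow> bool" where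
  "smooth_manifold X A \<longleftrightarrow>
     Hausdorff_space X \<and> second_countable X \<and>
     (\<forall>(U, \<phi>)\<in>A. openin X U \<and> open (\<phi> ` U) \<and>
        homeomorphic_map (subtopology X U) (top_of_set (\<phi> ` U)) \<phi>) \<and>
     topspace X = (\<Union>(U, \<phi>)\<in>A. U) \<and>
     (\<forall>(U, \<phi>)\<in>A. \<forall>(V, \<psi>)\<in>A. smooth_on (\<phi> ` (U \<inter> V)) (\<psi> \<circ> inv_into U \<phi>))"

definition smooth_map ::
  "'m topology \<Rightarrow> ('m, 'n::euclidean_space) chart set \<Rightarrow>
   'p topology \<Rightarrow> ('p, 'q::euclidean_space) chart set \<Rightarrow> ('m \<Rightarrow> 'p) \<Rightarrow> bool" where
  "smooth_map X A Y B f \<longleftrightarrow>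
     continuous_map X Y f \<and>
     (\<forall>(U, \<phi>)\<in>A. \<forall>(V, \<psi>)\<in>B. smooth_on (\<phi> ` {x\<in>U. f x \<in> V}) (\<psi> \<circ> f \<circ> inv_into U \<phi>))"

definition diffeomorphism ::
  "'m topology \<Rightarrow> ('m, 'n::euclidean_space) chart set \<Rightarrow>
   'p topology \<Rightarrow> ('p, 'q::euclidean_space) chart set \<Rightarrow> ('m \<Rightarrow> 'p) \<Rightarrow> bool" where
  "diffeomorphism X A Y B f \<longleftrightarrow>
     bij_betw f (topspace X) (topspace Y) \<and>
     smooth_map X A Y B f \<and> smooth_map Y B X A (inv_into (topspace X) f)"

text \<open>The charts of a subset of a normed space (with the subspace topology) which are smooth and have
  smooth inverses. They cover the subset iff it is an embedded submanifold of dimension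
  \<open>DIM('n)\<close>, and then they form its maximal atlas.\<close>

definition submanifold_atlas ::
  "'e::real_normed_vector set \<Rightarrow> ('e, 'n::euclidean_space) chart set" where
  "submanifold_atlas M = {(U, \<phi>). openin (top_of_set M) U \<and> inj_on \<phi> U \<and> open (\<phi> ` U) \<and>
     smooth_on_subset U \<phi> \<and> smooth_on (\<phi> ` U) (inv_into U \<phi>)}"


section \<open>Homogeneous spaces of linear groups\<close>

definition left_coset ::
  "('v::real_normed_vector \<Rightarrow>\<^sub>L 'v) set \<Rightarrow> ('v \<Rightarrow>\<^sub>L 'v) \<Rightarrow> ('v \<Rightarrow>\<^sub>L 'v) set" where
  "left_coset H a = (\<lambda>h. a o\<^sub>L h) ` H"

definition coset_topology ::
  "('v::real_normed_vector \<Rightarrow>\<^sub>L 'v) set \<Rightarrow> ('v \<Rightarrow>\<^sub>L 'v) set \<Rightarrow> ('v \<Rightarrow>\<^sub>L 'v) set topology" where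
  "coset_topology G H = topology (\<lambda>T. T \<subseteq> left_coset H ` G \<and>
     openin (top_of_set G) {a\<in>G. left_coset H a \<in> T})"

lemma openin_coset_topology:
  "openin (coset_topology G H) T \<longleftrightarrow>
     T \<subseteq> left_coset H ` G \<and> openin (top_of_set G) {a\<in>G. left_coset H a \<in> T}"
proof -
  let ?L = "\<lambda>T. T \<subseteq> left_coset H ` G \<and> openin (top_of_set G) {a\<in>G. left_coset H a \<in> T}"
  have int: "?L (S \<inter> T)" if "?L S" "?L T" for S T
  proof -
    have "{a\<in>G. left_coset H a \<in> S \<inter> T} =
        {a\<in>G. left_coset H a \<in> S} \<inter> {a\<in>G. left_coset H a \<in> T}"
      by blast
    with that show ?thesis by auto
  qed
  have un: "?L (\<Union>K)" if "\<forall>S\<in>K. ?L S" for K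
  proof -
    have "{a\<in>G. left_coset H a \<in> \<Union>K} = (\<Union>S\<in>K. {a\<in>G. left_coset H a \<in> S})"
      by blast
    moreover have "openin (top_of_set G) (\<Union>S\<in>K. {a\<in>G. left_coset H a \<in> S})"
      using that by (intro openin_Union) auto
    ultimately show ?thesis
      using that by (auto simp only: Union_least)
  qed
  have "istopology ?L"
    using int un unfolding istopology_def by blast
  then show ?thesis
    unfolding coset_topology_def by (simp add: topology_inverse')
qed

lemma quotient_map_left_coset:
  "quotient_map (top_of_set G) (coset_topology G H) (left_coset H)"
proof -
  have "topspace (coset_topology G H) = left_coset H ` G"
  proof (rule subset_antisym)
    show "topspace (coset_topology G H) \<subseteq> left_coset H ` G"
      using openin_topspace openin_coset_topology by metis
    have "{a\<in>G. left_coset H a \<in> left_coset H ` G} = G"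
      by blast
    then have "openin (coset_topology G H) (left_coset H ` G)"
      unfolding openin_coset_topology by (simp only: openin_subtopology_self subset_refl simp_thms)
    then show "left_coset H ` G \<subseteq> topspace (coset_topology G H)"
      by (rule openin_subset)
  qed
  then show ?thesis
    unfolding quotient_map_def openin_coset_topology by auto
qed

text \<open>The manifold structure of \<open>G/H\<close> is the unique one for which the projection \<open>G \<rightarrow> G/H\<close> is
  smooth and has smooth local sections (equivalently, is a smooth submersion); the following are
  its charts.\<close>

definition coset_atlas ::
  "('v::real_normed_vector \<Rightarrow>\<^sub>L 'v) set \<Rightarrow> ('v \<Rightarrow>\<^sub>L 'v) set \<Rightarrow>
   (('v \<Rightarrow>\<^sub>L 'v) set, 'n::euclidean_space) chart set" where
  "coset_atlas G H = {(U, \<phi>). openin (coset_topology G H) U \<and> inj_on \<phi> U \<and> open (\<phi> ` U) \<and>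
     smooth_on_subset {a\<in>G. left_coset H a \<in> U} (\<phi> \<circ> left_coset H) \<and>
     (\<forall>y\<in>\<phi> ` U. \<exists>N s. open N \<and> y \<in> N \<and> N \<subseteq> \<phi> ` U \<and> smooth_on N s \<and>
        (\<forall>z\<in>N. s z \<in> G \<and> left_coset H (s z) = inv_into U \<phi> z))}"


section \<open>Hyper-Hermitian structures\<close>

definition hyper_hermitian ::
  "('v::real_vector \<Rightarrow> 'v \<Rightarrow> real) \<Rightarrow> ('v \<Rightarrow> 'v) \<Rightarrow> ('v \<Rightarrow> 'v) \<Rightarrow> ('v \<Rightarrow> 'v) \<Rightarrow> bool" where
  "hyper_hermitian g J1 J2 J3 \<longleftrightarrow>
     bilinear g \<and> (\<forall>x y. g x y = g y x) \<and> (\<forall>x. x \<noteq> 0 \<longrightarrow> g x x > 0) \<and>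
     linear J1 \<and> linear J2 \<and> linear J3 \<and>
     (\<forall>x. J1 (J2 x) = J3 x) \<and> (\<forall>x. J2 (J1 x) = - J3 x) \<and>
     (\<forall>J\<in>{J1, J2, J3}. (\<forall>x. J (J x) = - x) \<and> (\<forall>x y. g (J x) (J y) = g x y))"

definition Sp2 ::
  "('v::real_normed_vector \<Rightarrow> 'v \<Rightarrow> real) \<Rightarrow> ('v \<Rightarrow> 'v) \<Rightarrow> ('v \<Rightarrow> 'v) \<Rightarrow> ('v \<Rightarrow> 'v) \<Rightarrow>
   ('v \<Rightarrow>\<^sub>L 'v) set" where
  "Sp2 g J1 J2 J3 = {a. bij (blinfun_apply a) \<and> (\<forall>x y. g (a x) (a y) = g x y) \<and>
     (\<forall>J\<in>{J1, J2, J3}. \<forall>x. a (J x) = J (a x))}"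

text \<open>The complexification of \<open>V\<close>: the pair \<open>(x, y)\<close> stands for \<open>x + i y\<close>.\<close>

type_synonym 'v cplx = "'v \<times> 'v"

definition cscale :: "complex \<Rightarrow> 'v::real_vector cplx \<Rightarrow> 'v cplx" where
  "cscale c z = (Re c *\<^sub>R fst z - Im c *\<^sub>R snd z, Re c *\<^sub>R snd z + Im c *\<^sub>R fst z)"

definition cconj :: "'v::real_vector cplx \<Rightarrow> 'v cplx" where
  "cconj z = (fst z, - snd z)"

definition cmap :: "('v \<Rightarrow> 'v) \<Rightarrow> 'v cplx \<Rightarrow> 'v cplx" where
  "cmap f z = (f (fst z), f (snd z))"

definition cform :: "('v \<Rightarrow> complex) \<Rightarrow> 'v cplx \<Rightarrow> complex" where
  "cform f z = f (fst z) + \<i> * f (snd z)"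

definition cform2 :: "('v \<Rightarrow> 'v \<Rightarrow> real) \<Rightarrow> 'v cplx \<Rightarrow> 'v cplx \<Rightarrow> complex" where
  "cform2 b x y = cform (\<lambda>x'. cform (\<lambda>y'. complex_of_real (b x' y')) y) x"

definition cform4 ::
  "('v \<Rightarrow> 'v \<Rightarrow> 'v \<Rightarrow> 'v \<Rightarrow> real) \<Rightarrow>
   'v cplx \<Rightarrow> 'v cplx \<Rightarrow> 'v cplx \<Rightarrow> 'v cplx \<Rightarrow> complex" where
  "cform4 T x y z w =
     cform (\<lambda>x'. cform (\<lambda>y'. cform (\<lambda>z'. cform (\<lambda>w'. complex_of_real (T x' y' z' w')) w) z) y) x"

definition W_space :: "('v::real_vector \<Rightarrow> 'v) \<Rightarrow> 'v cplx set" where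
  "W_space J1 = {z. cmap J1 z = cscale \<i> z}"

text \<open>Since \<open>J2\<close> squares to \<open>-1\<close>, this is the form with \<open>g x y = \<pi> x (J2 y)\<close>.\<close>

definition pi_form ::
  "('v::real_vector \<Rightarrow> 'v \<Rightarrow> real) \<Rightarrow> ('v \<Rightarrow> 'v) \<Rightarrow> 'v cplx \<Rightarrow> 'v cplx \<Rightarrow> complex" where
  "pi_form g J2 x y = - cform2 g x (cmap J2 y)"

lemma pi_form_J2:
  assumes "hyper_hermitian g J1 J2 J3"
  shows "pi_form g J2 x (cmap J2 y) = cform2 g x y"
  using assms
  by (auto simp: hyper_hermitian_def pi_form_def cform2_def cform_def cmap_def bilinear_rneg
      algebra_simps)

text \<open>Convention for two-forms:
  \<open>(\<alpha> \<and> \<beta>)(x, y) = \<alpha>(x) \<beta>(y) - \<alpha>(y) \<beta>(x)\<close>.\<close>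

definition adapted_basis ::
  "('v::real_vector \<Rightarrow> 'v \<Rightarrow> real) \<Rightarrow> ('v \<Rightarrow> 'v) \<Rightarrow> ('v \<Rightarrow> 'v) \<Rightarrow> (4 \<Rightarrow> 'v cplx) \<Rightarrow> bool" where
  "adapted_basis g J1 J2 e \<longleftrightarrow>
     (\<forall>\<alpha>. e \<alpha> \<in> W_space J1) \<and>
     (\<forall>w\<in>W_space J1. \<exists>!x::complex^4. w = (\<Sum>\<alpha>\<in>UNIV. cscale (x $ \<alpha>) (e \<alpha>))) \<and>
     e 3 = cmap J2 (cconj (e 1)) \<and> e 4 = cmap J2 (cconj (e 2)) \<and>
     (\<forall>x y :: complex^4.
        pi_form g J2 (\<Sum>\<alpha>\<in>UNIV. cscale (x $ \<alpha>) (e \<alpha>)) (\<Sum>\<alpha>\<in>UNIV. cscale (y $ \<alpha>) (e \<alpha>)) =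
          (x $ 1 * y $ 3 - y $ 1 * x $ 3) + (x $ 2 * y $ 4 - y $ 2 * x $ 4))"


section \<open>Curvature tensors and cubic discriminants\<close>

text \<open>Covariant 4-tensors; in finite dimension every multilinear form is bounded.\<close>

type_synonym 'v tensor4 = "'v \<Rightarrow>\<^sub>L 'v \<Rightarrow>\<^sub>L 'v \<Rightarrow>\<^sub>L 'v \<Rightarrow>\<^sub>L real"

abbreviation tensor4_apply ::
  "'v::real_normed_vector tensor4 \<Rightarrow> 'v \<Rightarrow> 'v \<Rightarrow> 'v \<Rightarrow> 'v \<Rightarrow> real" where
  "tensor4_apply K x y z w \<equiv>
     blinfun_apply (blinfun_apply (blinfun_apply (blinfun_apply K x) y) z) w"

definition curvature_Sp2 ::
  "('v::real_normed_vector \<Rightarrow> 'v) \<Rightarrow> ('v \<Rightarrow> 'v) \<Rightarrow> ('v \<Rightarrow> 'v) \<Rightarrow> 'v tensor4 set" where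
  "curvature_Sp2 J1 J2 J3 = {R. let K = tensor4_apply R in
     (\<forall>x y z w. K x y z w = - K y x z w) \<and>
     (\<forall>x y z w. K x y z w = - K x y w z) \<and>
     (\<forall>x y z w. K x y z w + K y z x w + K z x y w = 0) \<and>
     (\<forall>J\<in>{J1, J2, J3}. \<forall>x y z w. K x y (J z) (J w) = K x y z w)}"

definition S_tensor ::
  "('v::real_normed_vector \<Rightarrow> 'v) \<Rightarrow> ('v \<Rightarrow> 'v) \<Rightarrow> 'v tensor4 \<Rightarrow> 'v \<Rightarrow> 'v \<Rightarrow> 'v \<Rightarrow> 'v \<Rightarrow> real" where
  "S_tensor J2 J3 K x y z w =
     (tensor4_apply K x (J2 y) z (J2 w) - tensor4_apply K x (J3 y) z (J3 w)) / 2"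

definition cubic_discriminants ::
  "('v::real_normed_vector \<Rightarrow> 'v \<Rightarrow> real) \<Rightarrow> ('v \<Rightarrow> 'v) \<Rightarrow> ('v \<Rightarrow> 'v) \<Rightarrow> ('v \<Rightarrow> 'v) \<Rightarrow>
   'v tensor4 set" where
  "cubic_discriminants g J1 J2 J3 = {K \<in> curvature_Sp2 J1 J2 J3.
     \<exists>e. adapted_basis g J1 J2 e \<and>
       (\<forall>x::complex^4. let v = (\<Sum>\<alpha>\<in>UNIV. cscale (x $ \<alpha>) (e \<alpha>)) in
          cform4 (S_tensor J2 J3 K) v v v v =
            - 18 * x $ 1 * x $ 2 * x $ 3 * x $ 4
            + 4 * complex_of_real (sqrt 3) * x $ 1 * (x $ 4) ^ 3
            - 4 * complex_of_real (sqrt 3) * (x $ 2) ^ 3 * x $ 3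
            + 3 * (x $ 2)\<^sup>2 * (x $ 4)\<^sup>2 - 9 * (x $ 1)\<^sup>2 * (x $ 3)\<^sup>2)}"


section \<open>The irreducible \<open>Sp(1)\<close>\<close>

definition SU2 :: "(complex^2^2) set" where
  "SU2 = {u. (\<chi> i j. cnj (u $ j $ i)) ** u = mat 1 \<and> det u = 1}"

text \<open>Elements of the third symmetric power of \<open>\<Delta> = \<complex>\<^sup>2\<close> are symmetric tensors, given by
  their components.\<close>

type_synonym tens3 = "2 \<Rightarrow> 2 \<Rightarrow> 2 \<Rightarrow> complex"

definition S3 :: "tens3 set" where
  "S3 = {t. \<forall>i j k. t i j k = t j i k \<and> t i j k = t i k j}"

definition S3_act :: "complex^2^2 \<Rightarrow> tens3 \<Rightarrow> tens3" where
  "S3_act u t i j k = (\<Sum>a\<in>UNIV. \<Sum>b\<in>UNIV. \<Sum>c\<in>UNIV. u $ i $ a * u $ j $ b * u $ k $ c * t a b c)"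

text \<open>The matrix of the \<open>SU(2)\<close>-invariant form \<open>(x, y) \<mapsto> x\<^sub>1 y\<^sub>2 - x\<^sub>2 y\<^sub>1\<close> on \<open>\<Delta>\<close>. The invariant
  quaternionic structure \<open>x \<mapsto> (- cnj x\<^sub>2, cnj x\<^sub>1)\<close> has components \<open>j(x)\<^sub>i = \<Sum>\<^sub>a vol2 a i * cnj x\<^sub>a\<close>.
  Below both are extended to the third tensor power factor by factor.\<close>

definition vol2 :: "2 \<Rightarrow> 2 \<Rightarrow> complex" where
  "vol2 i j = (if i = 1 \<and> j = 2 then 1 else if i = 2 \<and> j = 1 then - 1 else 0)"

definition S3_form :: "tens3 \<Rightarrow> tens3 \<Rightarrow> complex" where
  "S3_form s t = (\<Sum>i\<in>UNIV. \<Sum>j\<in>UNIV. \<Sum>k\<in>UNIV. \<Sum>a\<in>UNIV. \<Sum>b\<in>UNIV. \<Sum>c\<in>UNIV.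
     vol2 i a * vol2 j b * vol2 k c * s i j k * t a b c)"

definition S3_quat :: "tens3 \<Rightarrow> tens3" where
  "S3_quat t i j k = (\<Sum>a\<in>UNIV. \<Sum>b\<in>UNIV. \<Sum>c\<in>UNIV.
     vol2 a i * vol2 b j * vol2 c k * cnj (t a b c))"

text \<open>Identifications of the third symmetric power with \<open>W\<close>, where the quaternionic structure of \<open>W\<close>
  is \<open>w \<mapsto> J2 (cconj w)\<close>.\<close>

definition S3_identification ::
  "('v::real_vector \<Rightarrow> 'v \<Rightarrow> real) \<Rightarrow> ('v \<Rightarrow> 'v) \<Rightarrow> ('v \<Rightarrow> 'v) \<Rightarrow> (tens3 \<Rightarrow> 'v cplx) \<Rightarrow> bool" where
  "S3_identification g J1 J2 \<Phi> \<longleftrightarrow>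
     bij_betw \<Phi> S3 (W_space J1) \<and>
     (\<forall>s\<in>S3. \<forall>t\<in>S3. \<Phi> (\<lambda>i j k. s i j k + t i j k) = \<Phi> s + \<Phi> t) \<and>
     (\<forall>c. \<forall>t\<in>S3. \<Phi> (\<lambda>i j k. c * t i j k) = cscale c (\<Phi> t)) \<and>
     (\<forall>s\<in>S3. \<forall>t\<in>S3. pi_form g J2 (\<Phi> s) (\<Phi> t) = S3_form s t) \<and>
     (\<forall>t\<in>S3. cmap J2 (cconj (\<Phi> t)) = \<Phi> (S3_quat t))"

text \<open>The members of the conjugacy class of subgroups denoted by \<open>Sp(1)\<close> with index \<open>ir\<close>.\<close>

definition Sp1_ir ::
  "('v::real_normed_vector \<Rightarrow> 'v \<Rightarrow> real) \<Rightarrow> ('v \<Rightarrow> 'v) \<Rightarrow> ('v \<Rightarrow> 'v) \<Rightarrow> ('v \<Rightarrow> 'v) \<Rightarrow>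
   ('v \<Rightarrow>\<^sub>L 'v) set \<Rightarrow> bool" where
  "Sp1_ir g J1 J2 J3 H \<longleftrightarrow>
     (\<exists>\<Phi>. S3_identification g J1 J2 \<Phi> \<and>
       H = {a \<in> Sp2 g J1 J2 J3. \<exists>u\<in>SU2. \<forall>t\<in>S3. cmap a (\<Phi> t) = \<Phi> (S3_act u t)})"

end

(*
Let K be a cubic discriminant in a frame p. Every frame of the hyper-Hermitian space is the image
of p under a unique element of Sp(2), and a tensor in R^{Sp(2)} is determined by its quartic, so C is
the orbit of K under Sp(2). The quartic is one third of the discriminant of binary cubics, which is
SL(2)-invariant and whose critical points are exactly the cubes; hence the stabiliser of K is the
irreducible SU(2).

For the manifold structure, seven suitable coefficients of the quartic serve as coordinates of C
near K. A tensor of C near K has the form K o c with c in Sp(2) close to 1; replacing c by the element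
of its coset that maximises Re tr, c satisfies three further linear equations. Together with the
equations for Sp(2) and the seven coefficients these are 16 functions on the 16-dimensional space of
quaternion-linear maps, and the inverse function theorem makes c a smooth function of the
coefficients. This gives smooth local sections of Sp(2) -> C, and then the charts of the coset space
are exactly those of C pulled back along the bijection.
*)

theory Submission
  imports Defs "HOL-Computational_Algebra.Fundamental_Theorem_Algebra"
begin

text \<open>The inverse function theorem speaks only of \<open>c\<close> close to 1, while an
  element of a coset picked by maximality may lie anywhere in Sp(2). Compactness closes the gap: the
  maximal elements form a compact set, and over \<open>K\<close> itself only the identity is
  maximal, because it alone attains the largest possible trace. So the maximal elements away from 1
  have a compact image that misses \<open>K\<close>, and over a neighbourhood of \<open>K\<close>
  all of them are close to 1. The three linear equations are the critical-point equations of the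
  trace along SU(2); at 1 they cut out the orthogonal complement of its Lie algebra, so no
  exponential map is needed. All computations take place in \<open>V\<close>: the map
  \<open>v \<mapsto> v - i J1 v\<close> identifies \<open>V\<close> with \<open>W\<close>, an
  adapted basis becomes a pair of vectors, and a quaternion-linear map is the pair of images of such
  vectors. The factors sqrt 3 stem from the basis of binary cubics in which the invariant 2-form and
  the quaternionic structure take their standard form.\<close>

section \<open>Smooth maps between finite-dimensional normed spaces\<close>

text \<open>The chain rule for the directional-derivative definition of smoothness needs the middle
  space to be finite-dimensional. The spaces of linear maps and of tensors are not instances of
  \<^class>\<open>euclidean_space\<close>.\<close>

class fin_normed = real_normed_vector +
  assumes ex_finite_frame: "\<exists>(n::nat) (c :: nat \<Rightarrow> 'a \<Rightarrow> real) b.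
    (\<forall>i. (\<forall>x y. c i (x + y) = c i x + c i y) \<and> (\<forall>r x. c i (r *\<^sub>R x) = r * c i x) \<and>
      (\<exists>K. \<forall>x. \<bar>c i x\<bar> \<le> norm x * K)) \<and>
    (\<forall>x. x = (\<Sum>i<n. c i x *\<^sub>R b i))"

lemma bounded_linear_real_iff:
  fixes f :: "'a::real_normed_vector \<Rightarrow> real"
  shows "bounded_linear f \<longleftrightarrow> (\<forall>x y. f (x + y) = f x + f y) \<and> (\<forall>r x. f (r *\<^sub>R x) = r * f x) \<and>
    (\<exists>K. \<forall>x. \<bar>f x\<bar> \<le> norm x * K)"
  by (auto simp: bounded_linear_def bounded_linear_axioms_def linear_iff)

lemma finite_frame: "\<exists>(n::nat) (c :: nat \<Rightarrow> 'a::fin_normed \<Rightarrow> real) b.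
    (\<forall>i. bounded_linear (c i)) \<and> (\<forall>x. x = (\<Sum>i<n. c i x *\<^sub>R b i))"
  using ex_finite_frame unfolding bounded_linear_real_iff .

lemma finite_frameI:
  fixes c :: "'i \<Rightarrow> 'a::real_normed_vector \<Rightarrow> real"
  assumes "finite I" "\<And>i. i \<in> I \<Longrightarrow> bounded_linear (c i)" "\<And>x. x = (\<Sum>i\<in>I. c i x *\<^sub>R b i)"
  shows "\<exists>(n::nat) (c :: nat \<Rightarrow> 'a \<Rightarrow> real) b.
    (\<forall>i. (\<forall>x y. c i (x + y) = c i x + c i y) \<and> (\<forall>r x. c i (r *\<^sub>R x) = r * c i x) \<and>
      (\<exists>K. \<forall>x. \<bar>c i x\<bar> \<le> norm x * K)) \<and>
    (\<forall>x. x = (\<Sum>i<n. c i x *\<^sub>R b i))"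
proof -
  obtain h where h: "bij_betw h {..<card I} I"
    using ex_bij_betw_nat_finite[OF assms(1)] by (auto simp: atLeast0LessThan)
  \<comment> \<open>The frame condition asks for bounded functionals at every index, also beyond the
    number of vectors; zero fills these.\<close>
  define c' where "c' k = (if k < card I then c (h k) else (\<lambda>x. 0))" for k
  have "bounded_linear (c' k)" for k
    unfolding c'_def using h assms(2) by (auto simp: bij_betw_def)
  moreover have "x = (\<Sum>k<card I. c' k x *\<^sub>R b (h k))" for x
  proof -
    have "x = (\<Sum>i\<in>I. c i x *\<^sub>R b i)" by (rule assms(3))
    also have "\<dots> = (\<Sum>k<card I. c (h k) x *\<^sub>R b (h k))"
      using sum.reindex_bij_betw[OF h, of "\<lambda>i. c i x *\<^sub>R b i"] by simp
    also have "\<dots> = (\<Sum>k<card I. c' k x *\<^sub>R b (h k))"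
      by (rule sum.cong) (auto simp: c'_def)
    finally show ?thesis .
  qed
  ultimately have "(\<forall>i. bounded_linear (c' i)) \<and> (\<forall>x. x = (\<Sum>k<card I. c' k x *\<^sub>R b (h k)))"
    by blast
  then show ?thesis
    unfolding bounded_linear_real_iff
    by (intro exI[of _ "card I"] exI[of _ c'] exI[of _ "\<lambda>k. b (h k)"])
qed

instance euclidean_space \<subseteq> fin_normed
proof
  show "\<exists>(n::nat) (c :: nat \<Rightarrow> 'a \<Rightarrow> real) b.
    (\<forall>i. (\<forall>x y. c i (x + y) = c i x + c i y) \<and> (\<forall>r x. c i (r *\<^sub>R x) = r * c i x) \<and>
      (\<exists>K. \<forall>x. \<bar>c i x\<bar> \<le> norm x * K)) \<and>
    (\<forall>x. x = (\<Sum>i<n. c i x *\<^sub>R b i))"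
    by (rule finite_frameI[of Basis "\<lambda>i x. x \<bullet> i" "\<lambda>i. i"])
      (auto intro: bounded_linear_inner_left simp: euclidean_representation)
qed

definition blinfun_rank1 :: "'a::real_inner \<Rightarrow> 'b::real_normed_vector \<Rightarrow> 'a \<Rightarrow>\<^sub>L 'b" where
  "blinfun_rank1 i y = blinfun_scaleR_left y o\<^sub>L blinfun_inner_left i"

lemma blinfun_apply_rank1: "blinfun_rank1 i y x = (i \<bullet> x) *\<^sub>R y"
  by (simp add: blinfun_rank1_def inner_commute)

lemma bounded_linear_rank1: "bounded_linear (blinfun_rank1 i)"
  unfolding blinfun_rank1_def
  by (rule bounded_linear_compose[OF bounded_bilinear.bounded_linear_left[OF bounded_bilinear_blinfun_compose]
      bounded_linear_blinfun_scaleR_left])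

lemma blinfun_expand:
  fixes f :: "'a::euclidean_space \<Rightarrow>\<^sub>L 'b::real_normed_vector"
  shows "f = (\<Sum>i\<in>Basis. blinfun_rank1 i (f i))"
proof (rule blinfun_eqI)
  fix x
  have "f x = f (\<Sum>i\<in>Basis. (x \<bullet> i) *\<^sub>R i)" by (simp add: euclidean_representation)
  also have "\<dots> = (\<Sum>i\<in>Basis. (x \<bullet> i) *\<^sub>R f i)"
    by (simp add: blinfun.sum_right blinfun.scaleR_right)
  finally show "f x = (\<Sum>i\<in>Basis. blinfun_rank1 i (f i)) x"
    by (simp add: blinfun.sum_left inner_commute blinfun_apply_rank1)
qed

text \<open>Only the domain has to be Euclidean, the codomain just needs a frame. So the instance
  iterates and reaches \<open>tensor4\<close>.\<close>

instance blinfun :: (euclidean_space, fin_normed) fin_normed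
proof
  obtain n and c :: "nat \<Rightarrow> 'b \<Rightarrow> real" and b where
    c: "\<And>i. bounded_linear (c i)" "\<And>x. x = (\<Sum>i<n. c i x *\<^sub>R b i)"
    using finite_frame[where 'a='b] by blast
  show "\<exists>(n::nat) (c :: nat \<Rightarrow> ('a \<Rightarrow>\<^sub>L 'b) \<Rightarrow> real) b.
    (\<forall>i. (\<forall>x y. c i (x + y) = c i x + c i y) \<and> (\<forall>r x. c i (r *\<^sub>R x) = r * c i x) \<and>
      (\<exists>K. \<forall>x. \<bar>c i x\<bar> \<le> norm x * K)) \<and>
    (\<forall>x. x = (\<Sum>i<n. c i x *\<^sub>R b i))"
  proof (rule finite_frameI[of "(Basis::'a set) \<times> {..<n}" "\<lambda>p f. c (snd p) (blinfun_apply f (fst p))"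
        "\<lambda>p. blinfun_rank1 (fst p) (b (snd p))"])
    show "bounded_linear (\<lambda>f. c (snd p) (blinfun_apply f (fst p)))" for p :: "'a \<times> nat"
      by (rule bounded_linear_compose[OF c(1) blinfun.bounded_linear_left])
    fix f :: "'a \<Rightarrow>\<^sub>L 'b"
    have "f = (\<Sum>i\<in>Basis. blinfun_rank1 i (f i))"
      by (rule blinfun_expand)
    also have "\<dots> = (\<Sum>i\<in>Basis. \<Sum>k<n. c k (f i) *\<^sub>R blinfun_rank1 i (b k))"
    proof (rule sum.cong[OF refl])
      fix i :: 'a
      have "blinfun_rank1 i (f i) =
          blinfun_rank1 i (\<Sum>k<n. c k (f i) *\<^sub>R b k)"
        using c(2)[of "f i"] by simp
      also have "\<dots> = (\<Sum>k<n. c k (f i) *\<^sub>R blinfun_rank1 i (b k))"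
        by (rule blinfun_eqI) (simp add: blinfun.sum_left blinfun.scaleR_left scaleR_sum_right mult.commute blinfun_apply_rank1 blinfun.sum_right blinfun.scaleR_right)
      finally show "blinfun_rank1 i (f i) = \<dots>" .
    qed
    finally show "f = (\<Sum>p\<in>(Basis::'a set) \<times> {..<n}. c (snd p) (blinfun_apply f (fst p)) *\<^sub>R
        blinfun_rank1 (fst p) (b (snd p)))"
      by (simp add: sum.cartesian_product split_beta)
  qed auto
qed

text \<open>Rational combinations of the frame vectors are dense, so balls around them of radius
  \<open>1 / (k + 1)\<close> form a countable base.\<close>

lemma second_countable_fin_normed:
  "second_countable (top_of_set (S :: 'a::fin_normed set))"
proof -
  obtain n and c :: "nat \<Rightarrow> 'a \<Rightarrow> real" and b where
    c: "\<And>i. bounded_linear (c i)" "\<And>x. x = (\<Sum>i<n. c i x *\<^sub>R b i)"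
    using finite_frame[where 'a='a] by blast
  define D where "D = (\<lambda>r. \<Sum>i<n. r i *\<^sub>R b i) ` ({..<n} \<rightarrow>\<^sub>E (\<rat>::real set))"
  have cD: "countable D"
    unfolding D_def by (intro countable_image countable_PiE) (auto simp: countable_rat)
  define M where "M = Max (insert 1 ((\<lambda>i. norm (b i)) ` {..<n})) * (real n + 1)"
  have M0: "M > 0" unfolding M_def by (intro mult_pos_pos) (auto simp: Max_gr_iff)
  have bM: "(\<Sum>i<n. norm (b i)) < M"
  proof -
    have "(\<Sum>i<n. norm (b i)) \<le> (\<Sum>i<n. Max (insert 1 ((\<lambda>i. norm (b i)) ` {..<n})))"
      by (intro sum_mono) auto
    also have "\<dots> = n * Max (insert 1 ((\<lambda>i. norm (b i)) ` {..<n}))" by simp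
    also have "\<dots> < M"
    proof -
      have "Max (insert 1 ((\<lambda>i. norm (b i)) ` {..<n})) > 0" by (auto simp: Max_gr_iff)
      then show ?thesis unfolding M_def by (simp add: algebra_simps)
    qed
    finally show ?thesis .
  qed
  have dense: "\<exists>d\<in>D. dist d x < e" if e: "e > 0" for x e
  proof -
    have "\<exists>q\<in>\<rat>. \<bar>c i x - q\<bar> < e / M" for i
    proof -
      have "c i x - e/M < c i x" using e M0 by simp
      then obtain q where "q \<in> \<rat>" "c i x - e/M < q" "q < c i x"
        using Rats_dense_in_real by blast
      then show ?thesis by (intro bexI[of _ q]) auto
    qed
    then obtain q where q: "\<And>i. q i \<in> \<rat>" "\<And>i. \<bar>c i x - q i\<bar> < e / M" by metis
    let ?d = "\<Sum>i<n. (restrict q {..<n}) i *\<^sub>R b i"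
    have "?d \<in> D" unfolding D_def using q(1) by (intro imageI) (auto simp: PiE_iff extensional_def)
    moreover have "dist ?d x < e"
    proof -
      have "x - ?d = (\<Sum>i<n. (c i x - q i) *\<^sub>R b i)"
        by (subst c(2)[of x]) (simp add: sum_subtractf scaleR_diff_left)
      then have "norm (x - ?d) \<le> (\<Sum>i<n. \<bar>c i x - q i\<bar> * norm (b i))"
        by (auto intro!: order.trans[OF norm_sum])
      also have "\<dots> \<le> (\<Sum>i<n. (e / M) * norm (b i))"
        by (intro sum_mono mult_right_mono) (auto intro: less_imp_le q(2))
      also have "\<dots> = (e / M) * (\<Sum>i<n. norm (b i))" by (simp add: sum_distrib_left)
      also have "\<dots> < (e / M) * M"
        using e M0 bM by (intro mult_strict_left_mono) auto
      also have "\<dots> = e" using M0 by simp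
      finally show ?thesis by (simp add: dist_norm norm_minus_commute)
    qed
    ultimately show ?thesis by blast
  qed
  have "second_countable (euclidean :: 'a topology)"
    unfolding second_countable_def
  proof (intro exI[of _ "(\<lambda>(d, k::nat). ball d (1 / (real k + 1))) ` (D \<times> UNIV)"] conjI ballI allI impI)
    show "countable ((\<lambda>(d, k::nat). ball d (1 / (real k + 1))) ` (D \<times> UNIV))"
      using cD by auto
    fix U :: "'a set" and x assume "openin euclidean U \<and> x \<in> U"
    then obtain e where e: "e > 0" "ball x e \<subseteq> U"
      by (metis open_contains_ball open_openin)
    obtain k where k: "1 / (real k + 1) < e / 2"
      using e(1) by (metis half_gt_zero nat_approx_posE of_nat_Suc add.commute)
    obtain d where d: "d \<in> D" "dist d x < 1 / (real k + 1)"
      using dense[of "1 / (real k + 1)" x] by auto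
    have "ball d (1 / (real k + 1)) \<subseteq> ball x e"
    proof
      fix y assume "y \<in> ball d (1 / (real k + 1))"
      then have "dist d y < e / 2" using k by simp
      moreover have "dist x d < e / 2" using d(2) k by (simp add: dist_commute)
      ultimately show "y \<in> ball x e" using dist_triangle[of x y d] by simp
    qed
    then show "\<exists>V\<in>(\<lambda>(d, k::nat). ball d (1 / (real k + 1))) ` (D \<times> UNIV). x \<in> V \<and> V \<subseteq> U"
      using d e(2) by (intro bexI[of _ "ball d (1 / (real k + 1))"]) auto
  qed auto
  then show ?thesis by (rule second_countable_subtopology)
qed

section \<open>Calculus of functions differentiable to finite or infinite order\<close>

lemma ktd_cong:
  assumes "open U" "\<And>x. x \<in> U \<Longrightarrow> f x = g x" "k_times_differentiable_on k U f"
  shows "k_times_differentiable_on k U g"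
  using assms(2,3)
proof (induction k arbitrary: f g)
  case 0
  then show ?case by (metis continuous_on_cong k_times_differentiable_on.simps(1))
next
  case (Suc k)
  \<comment> \<open>\<open>frechet_derivative\<close> is a choice from
    \<open>has_derivative\<close>, so the two predicates are compared for every candidate
    \<open>D\<close>.\<close>
  have der: "(f has_derivative D) (at x) \<longleftrightarrow> (g has_derivative D) (at x)" if "x \<in> U" for x D
    using has_derivative_transform_within_open[OF _ assms(1) that, of f D UNIV g]
      has_derivative_transform_within_open[OF _ assms(1) that, of g D UNIV f] Suc.prems(1) by auto
  then have "frechet_derivative f (at x) = frechet_derivative g (at x)" if "x \<in> U" for x
    using that by (simp add: frechet_derivative_def)
  moreover have "g differentiable (at x)" if "x \<in> U" for x
    using that der Suc.prems(2) by (auto simp: differentiable_def)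
  moreover have "k_times_differentiable_on k U (\<lambda>x. frechet_derivative f (at x) v)" for v
    using Suc.prems(2) by simp
  ultimately show ?case
    using Suc.IH[of "\<lambda>x. frechet_derivative f (at x) _" "\<lambda>x. frechet_derivative g (at x) _"] by simp
qed

lemma smooth_on_cong:
  assumes "open U" "\<And>x. x \<in> U \<Longrightarrow> f x = g x" "smooth_on U f"
  shows "smooth_on U g"
  using ktd_cong[OF assms(1), of f g] assms(2,3) unfolding smooth_on_def by blast

lemma ktd_subset:
  "k_times_differentiable_on k U f \<Longrightarrow> V \<subseteq> U \<Longrightarrow> k_times_differentiable_on k V f"
  by (induction k arbitrary: f) (auto intro: continuous_on_subset)

lemma smooth_on_mono: "smooth_on U f \<Longrightarrow> V \<subseteq> U \<Longrightarrow> smooth_on V f"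
  unfolding smooth_on_def using ktd_subset by blast

text \<open>Lets the derivative be given by any formula: it is unique and so agrees with
  \<open>frechet_derivative\<close>. The differentiation rules below rest on this.\<close>

lemma ktd_SucI:
  assumes "open U" "\<And>x. x \<in> U \<Longrightarrow> (f has_derivative f' x) (at x)"
    "\<And>v. k_times_differentiable_on k U (\<lambda>x. f' x v)"
  shows "k_times_differentiable_on (Suc k) U f"
proof -
  have "frechet_derivative f (at x) = f' x" if "x \<in> U" for x
    using frechet_derivative_at[OF assms(2)[OF that]] by simp
  then show ?thesis
    using assms(2,3) ktd_cong[OF assms(1) _ assms(3)]
    by (auto simp: differentiable_def)
qed

lemma ktd_Suc_has_derivative:
  "k_times_differentiable_on (Suc k) U f \<Longrightarrow> x \<in> U \<Longrightarrow>
    (f has_derivative frechet_derivative f (at x)) (at x)"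
  by (simp add: frechet_derivative_works)

lemma ktd_continuous_on: "k_times_differentiable_on k U f \<Longrightarrow> continuous_on U f"
  by (cases k) (auto intro!: differentiable_imp_continuous_on differentiable_at_imp_differentiable_on)

lemma ktd_Suc_imp: "k_times_differentiable_on (Suc k) U f \<Longrightarrow> k_times_differentiable_on k U f"
proof (induction k arbitrary: f)
  case 0 then show ?case using ktd_continuous_on[of 1 U f] by simp
next
  case (Suc k) then show ?case by (metis k_times_differentiable_on.simps(2))
qed

lemma ktd_local:
  assumes "open U" "\<And>x. x \<in> U \<Longrightarrow> \<exists>N. open N \<and> x \<in> N \<and> k_times_differentiable_on k N f"
  shows "k_times_differentiable_on k U f"
  using assms(2)
proof (induction k arbitrary: f)
  case 0
  then have "continuous (at x) f" if "x \<in> U" for x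
    using that by (metis continuous_on_eq_continuous_at k_times_differentiable_on.simps(1))
  then show ?case by (simp add: continuous_at_imp_continuous_on)
next
  case (Suc k)
  have "f differentiable (at x)" if "x \<in> U" for x
    using Suc.prems[OF that] by auto
  moreover have "k_times_differentiable_on k U (\<lambda>x. frechet_derivative f (at x) v)" for v
    using Suc.prems by (intro Suc.IH) (metis k_times_differentiable_on.simps(2))
  ultimately show ?case by simp
qed

lemma smooth_on_local:
  assumes "open U" "\<And>x. x \<in> U \<Longrightarrow> \<exists>N. open N \<and> x \<in> N \<and> smooth_on N f"
  shows "smooth_on U f"
  unfolding smooth_on_def
  by (intro allI ktd_local[OF assms(1)]) (use assms(2) in \<open>auto simp: smooth_on_def\<close>)

lemma smooth_on_continuous: "smooth_on U f \<Longrightarrow> continuous_on U f"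
  unfolding smooth_on_def by (metis k_times_differentiable_on.simps(1))

lemma ktd_const: "k_times_differentiable_on k U (\<lambda>x. c)"
  by (induction k arbitrary: c) (auto simp: frechet_derivative_const)

lemma ktd_bounded_linear:
  assumes "open U" "bounded_linear f" shows "k_times_differentiable_on k U f"
proof (cases k)
  case 0 then show ?thesis
    using assms(2) by (simp add: linear_continuous_on)
next
  case (Suc k') 
  show ?thesis unfolding Suc
    by (rule ktd_SucI[OF assms(1), of f "\<lambda>x. f"])
      (use bounded_linear_imp_has_derivative[OF assms(2)] ktd_const in auto)
qed

lemma ktd_add:
  assumes "open U" "k_times_differentiable_on k U f" "k_times_differentiable_on k U g"
  shows "k_times_differentiable_on k U (\<lambda>x. f x + g x)"
  using assms(2,3)
proof (induction k arbitrary: f g)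
  case 0 then show ?case by (auto intro: continuous_on_add)
next
  case (Suc k)
  show ?case
    by (rule ktd_SucI[OF assms(1), of _ "\<lambda>x v. frechet_derivative f (at x) v + frechet_derivative g (at x) v"])
      (use Suc in \<open>auto intro!: has_derivative_add simp: frechet_derivative_works[symmetric]\<close>)
qed

lemma ktd_sum:
  assumes "open U" "\<And>i. i \<in> I \<Longrightarrow> k_times_differentiable_on k U (f i)"
  shows "k_times_differentiable_on k U (\<lambda>x. \<Sum>i\<in>I. f i x)"
  using assms(2)
  by (induction I rule: infinite_finite_induct) (auto intro: ktd_const ktd_add[OF assms(1)])

lemma (in bounded_bilinear) ktd_bilinear:
  assumes "open U" "k_times_differentiable_on k U f" "k_times_differentiable_on k U g"
  shows "k_times_differentiable_on k U (\<lambda>x. prod (f x) (g x))"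
  using assms(2,3)
proof (induction k arbitrary: f g)
  case 0 then show ?case by (auto intro: continuous_on)
next
  case (Suc k)
  show ?case
  proof (rule ktd_SucI[OF assms(1), of _ "\<lambda>x v. prod (f x) (frechet_derivative g (at x) v) +
        prod (frechet_derivative f (at x) v) (g x)"])
    show "((\<lambda>x. prod (f x) (g x)) has_derivative (\<lambda>v. prod (f x) (frechet_derivative g (at x) v) +
        prod (frechet_derivative f (at x) v) (g x))) (at x)" if "x \<in> U" for x
      by (rule FDERIV[OF ktd_Suc_has_derivative ktd_Suc_has_derivative]) (use Suc.prems that in auto)
    show "k_times_differentiable_on k U (\<lambda>x. prod (f x) (frechet_derivative g (at x) v) +
        prod (frechet_derivative f (at x) v) (g x))" for v
      by (intro ktd_add[OF assms(1)] Suc.IH ktd_Suc_imp[OF Suc.prems(1)] ktd_Suc_imp[OF Suc.prems(2)])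
        (use Suc.prems in auto)
  qed
qed

lemma ktd_linear_compose:
  assumes "open U" "bounded_linear h" "k_times_differentiable_on k U f"
  shows "k_times_differentiable_on k U (\<lambda>x. h (f x))"
  using assms(3)
proof (induction k arbitrary: f)
  case 0 then show ?case using assms(2) by (auto intro: bounded_linear.continuous_on)
next
  case (Suc k)
  show ?case
    by (rule ktd_SucI[OF assms(1), of _ "\<lambda>x v. h (frechet_derivative f (at x) v)"])
      (use Suc in \<open>auto intro!: bounded_linear.has_derivative[OF assms(2)] simp: frechet_derivative_works[symmetric]\<close>)
qed

text \<open>The definition differentiates along fixed directions, but in the chain rule the
  direction moves with \<open>x\<close>; expanding it in a frame of the middle space leads back to
  the fixed directions \<open>b i\<close>. The outer map is smooth while the inner one is only of
  order \<open>k\<close>: this is the form needed for bootstrapping the inverse function.\<close>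

lemma ktd_compose:
  fixes g :: "'a::real_normed_vector \<Rightarrow> 'b::fin_normed"
  assumes "open U" "open V" "k_times_differentiable_on k U g" "g ` U \<subseteq> V" "smooth_on V f"
  shows "k_times_differentiable_on k U (\<lambda>x. f (g x))"
  using assms(3,5)
proof (induction k arbitrary: f)
  case 0
  then show ?case
    using assms(4) by (auto intro!: continuous_on_compose2[OF smooth_on_continuous[OF 0(2)]])
next
  case (Suc k)
  obtain n and c :: "nat \<Rightarrow> 'b \<Rightarrow> real" and b where
    c: "\<And>i. bounded_linear (c i)" "\<And>x. x = (\<Sum>i<n. c i x *\<^sub>R b i)"
    using finite_frame[where 'a='b] by blast
  have sf: "k_times_differentiable_on (Suc j) V f" for j
    using Suc.prems(2) by (simp only: smooth_on_def)
  have fd: "(f has_derivative frechet_derivative f (at y)) (at y)" if "y \<in> V" for y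
    using ktd_Suc_has_derivative[OF sf that] .
  have sm: "smooth_on V (\<lambda>y. frechet_derivative f (at y) v)" for v
    using sf unfolding smooth_on_def by auto
  let ?D = "\<lambda>x v. \<Sum>i<n. c i (frechet_derivative g (at x) v) *\<^sub>R frechet_derivative f (at (g x)) (b i)"
  show ?case
  proof (rule ktd_SucI[OF assms(1), of _ ?D])
    fix x assume x: "x \<in> U"
    then have gx: "g x \<in> V" using assms(4) by auto
    have lin: "linear (frechet_derivative f (at (g x)))"
      using fd[OF gx] has_derivative_linear by blast
    have "((\<lambda>x. f (g x)) has_derivative (\<lambda>v. frechet_derivative f (at (g x)) (frechet_derivative g (at x) v))) (at x)"
      by (rule has_derivative_compose[OF ktd_Suc_has_derivative[OF Suc.prems(1) x] fd[OF gx]])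
    moreover have "frechet_derivative f (at (g x)) (frechet_derivative g (at x) v) = ?D x v" for v
      by (subst c(2)[of "frechet_derivative g (at x) v"]) (simp add: linear_sum[OF lin] linear_scale[OF lin])
    ultimately show "((\<lambda>x. f (g x)) has_derivative ?D x) (at x)" by simp
  next
    fix v
    show "k_times_differentiable_on k U (\<lambda>x. ?D x v)"
      by (intro ktd_sum[OF assms(1)] bounded_bilinear.ktd_bilinear[OF bounded_bilinear_scaleR assms(1)]
          ktd_linear_compose[OF assms(1) c(1)] Suc.IH sm ktd_Suc_imp[OF Suc.prems(1)])
        (use Suc.prems(1) in auto)
  qed
qed

lemma smooth_on_compose:
  fixes g :: "'a::real_normed_vector \<Rightarrow> 'b::fin_normed"
  assumes "open U" "open V" "smooth_on U g" "g ` U \<subseteq> V" "smooth_on V f"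
  shows "smooth_on U (\<lambda>x. f (g x))"
  using assms ktd_compose unfolding smooth_on_def by blast

lemma smooth_on_const: "smooth_on U (\<lambda>x. c)"
  by (simp add: smooth_on_def ktd_const)

lemma smooth_on_bounded_linear: "open U \<Longrightarrow> bounded_linear f \<Longrightarrow> smooth_on U f"
  by (simp add: smooth_on_def ktd_bounded_linear)

lemma smooth_on_linear_compose:
  "open U \<Longrightarrow> bounded_linear h \<Longrightarrow> smooth_on U f \<Longrightarrow> smooth_on U (\<lambda>x. h (f x))"
  by (simp add: smooth_on_def ktd_linear_compose)

lemma smooth_on_id: "open U \<Longrightarrow> smooth_on U (\<lambda>x. x)"
  by (simp add: smooth_on_bounded_linear)

lemma smooth_on_add:
  "open U \<Longrightarrow> smooth_on U f \<Longrightarrow> smooth_on U g \<Longrightarrow> smooth_on U (\<lambda>x. f x + g x)"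
  by (simp add: smooth_on_def ktd_add)

lemma smooth_on_sum:
  "open U \<Longrightarrow> (\<And>i. i \<in> I \<Longrightarrow> smooth_on U (f i)) \<Longrightarrow> smooth_on U (\<lambda>x. \<Sum>i\<in>I. f i x)"
  by (simp add: smooth_on_def ktd_sum)

lemma (in bounded_bilinear) smooth_on_bilinear:
  "open U \<Longrightarrow> smooth_on U f \<Longrightarrow> smooth_on U g \<Longrightarrow> smooth_on U (\<lambda>x. prod (f x) (g x))"
  by (simp add: smooth_on_def ktd_bilinear)

lemmas smooth_on_mult = bounded_bilinear.smooth_on_bilinear[OF bounded_bilinear_mult]
lemmas smooth_on_scaleR = bounded_bilinear.smooth_on_bilinear[OF bounded_bilinear_scaleR]
lemmas smooth_on_blinfun_apply = bounded_bilinear.smooth_on_bilinear[OF bounded_bilinear_blinfun_apply]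

lemma smooth_on_minus: "open U \<Longrightarrow> smooth_on U f \<Longrightarrow> smooth_on U (\<lambda>x. - f x)"
  by (rule smooth_on_linear_compose[OF _ bounded_linear_minus[OF bounded_linear_ident]])

lemma smooth_on_diff:
  "open U \<Longrightarrow> smooth_on U f \<Longrightarrow> smooth_on U g \<Longrightarrow> smooth_on U (\<lambda>x. f x - g x)"
  using smooth_on_add[of U f "\<lambda>x. - g x"] smooth_on_minus[of U g] by simp

lemma smooth_on_Pair:
  assumes "open U" "smooth_on U f" "smooth_on U g"
  shows "smooth_on U (\<lambda>x. (f x, g x))"
proof -
  have "bounded_linear (\<lambda>y. (y, 0))" "bounded_linear (\<lambda>y. (0, y))"
    by (auto intro: bounded_linear_Pair bounded_linear_ident bounded_linear_zero)
  then have "smooth_on U (\<lambda>x. (f x, 0) + (0, g x))"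
    using assms by (intro smooth_on_add smooth_on_linear_compose[of U "\<lambda>y. (y, 0)" f]
        smooth_on_linear_compose[of U "\<lambda>y. (0, y)" g])
  then show ?thesis by simp
qed

lemma smooth_on_prod:
  fixes f :: "'i \<Rightarrow> 'a::real_normed_vector \<Rightarrow> 'b::{real_normed_algebra_1, comm_monoid_mult}"
  assumes "open U" "\<And>i. i \<in> I \<Longrightarrow> smooth_on U (f i)"
  shows "smooth_on U (\<lambda>x. \<Prod>i\<in>I. f i x)"
  using assms(2)
  by (induction I rule: infinite_finite_induct) (auto intro: smooth_on_const smooth_on_mult[OF assms(1)])

text \<open>Applied repeatedly, it reduces smoothness of a tensor-valued map to that of its values
  on fixed vectors.\<close>

lemma smooth_on_blinfun:
  fixes f :: "'a::real_normed_vector \<Rightarrow> 'b::euclidean_space \<Rightarrow>\<^sub>L 'c::real_normed_vector"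
  assumes "open U" "\<And>v. smooth_on U (\<lambda>x. f x v)"
  shows "smooth_on U f"
proof -
  have "smooth_on U (\<lambda>x. \<Sum>i\<in>Basis. blinfun_rank1 i (f x i))"
    by (intro smooth_on_sum smooth_on_linear_compose[OF _ bounded_linear_rank1] assms)
  then show ?thesis using blinfun_expand by (metis (no_types, lifting) ext)
qed

lemma smooth_on_inverse:
  fixes f :: "'a::real_normed_vector \<Rightarrow> real"
  assumes "open U" "smooth_on U f" "\<And>x. x \<in> U \<Longrightarrow> f x \<noteq> 0"
  shows "smooth_on U (\<lambda>x. inverse (f x))"
proof -
  \<comment> \<open>The derivative is a polynomial in \<open>inverse t\<close>, so each order yields
    the next.\<close>
  have "k_times_differentiable_on k (-{0}) (\<lambda>t::real. inverse t)" for k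
  proof (induction k)
    case 0 then show ?case by (auto intro: continuous_intros)
  next
    case (Suc k)
    have sc: "k_times_differentiable_on k (-{0}) (\<lambda>t::real. - (inverse t * v * inverse t))" for v
      by (intro ktd_linear_compose[OF _ bounded_linear_minus[OF bounded_linear_ident]]
          bounded_bilinear.ktd_bilinear[OF bounded_bilinear_mult] Suc.IH ktd_const) auto
    show ?case
      by (rule ktd_SucI[of _ _ "\<lambda>t v. - (inverse t * v * inverse t)"])
        (use sc in \<open>auto intro!: has_derivative_inverse'\<close>)
  qed
  then have inv: "smooth_on (-{0}) (\<lambda>t::real. inverse t)" by (simp add: smooth_on_def)
  have "f ` U \<subseteq> -{0}" "open (-{0::real})" using assms(3) by auto
  then show ?thesis
    by (intro smooth_on_compose[OF assms(1) _ assms(2) _ inv])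
qed

section \<open>The smooth inverse function theorem\<close>

lemma smooth_on_det:
  fixes A :: "'a::real_normed_vector \<Rightarrow> real^'n^'n"
  assumes "open U" "\<And>i j. smooth_on U (\<lambda>x. A x $ i $ j)"
  shows "smooth_on U (\<lambda>x. det (A x))"
  unfolding det_def
  by (intro smooth_on_sum smooth_on_mult smooth_on_const smooth_on_prod assms)

text \<open>The derivative of the local inverse is again a smooth function of the point by Cramer's
  rule; smoothness of the inverse then follows by bootstrapping.\<close>

lemma smooth_inverse_function_cart:
  fixes f :: "real^'n \<Rightarrow> real^'n"
  assumes "smooth_on UNIV f" "(f has_derivative D) (at x0)" "inj D"
  obtains U V g where "open U" "x0 \<in> U" "open V" "f x0 \<in> V" "smooth_on V g"
    "\<And>x. x \<in> U \<Longrightarrow> f x \<in> V \<and> g (f x) = x" "\<And>y. y \<in> V \<Longrightarrow> g y \<in> U \<and> f (g y) = y"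
proof -
  have ktd: "k_times_differentiable_on (Suc k) UNIV f" for k
    using assms(1) by (simp only: smooth_on_def)
  have fd: "(f has_derivative frechet_derivative f (at x)) (at x)" for x
    using ktd_Suc_has_derivative[OF ktd] by blast
  have sd: "smooth_on UNIV (\<lambda>x. frechet_derivative f (at x) v)" for v
    using ktd unfolding smooth_on_def by auto
  define f' where "f' x = Blinfun (frechet_derivative f (at x))" for x
  have f': "blinfun_apply (f' x) = frechet_derivative f (at x)" for x
    unfolding f'_def by (intro bounded_linear_Blinfun_apply has_derivative_bounded_linear[OF fd])
  have D: "D = blinfun_apply (f' x0)"
    unfolding f' using has_derivative_unique[OF assms(2) fd] .
  obtain E where E: "linear E" "E \<circ> D = id"
    using linear_injective_left_inverse[OF has_derivative_linear[OF assms(2)] assms(3)] by blast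
  define E' where "E' = Blinfun E"
  have "blinfun_apply E' = E"
    unfolding E'_def using E(1) by (simp add: bounded_linear_Blinfun_apply linear_conv_bounded_linear)
  then have E': "E' o\<^sub>L f' x0 = id_blinfun"
    using E(2) unfolding D by (intro blinfun_eqI) (metis blinfun_apply_blinfun_compose blinfun_apply_id_blinfun comp_apply id_apply)
  have contf': "continuous_on UNIV f'"
    by (rule continuous_on_blinfun_componentwise) (simp add: f' smooth_on_continuous[OF sd])
  obtain U V g g' where g: "open U" "U \<subseteq> UNIV" "x0 \<in> U" "open V" "f x0 \<in> V" "homeomorphism U V f g"
    "\<And>y. y \<in> V \<Longrightarrow> (g has_derivative (g' y)) (at y)"
    "\<And>y. y \<in> V \<Longrightarrow> g' y = inv (blinfun_apply (f'(g y)))"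
    "\<And>y. y \<in> V \<Longrightarrow> bij (blinfun_apply (f'(g y)))"
    using inverse_function_theorem[OF open_UNIV _ contf' UNIV_I E'] fd by (metis f')
  have gU: "g ` V = U" and gf: "\<And>x. x \<in> U \<Longrightarrow> f x \<in> V \<and> g (f x) = x"
    and fg: "\<And>y. y \<in> V \<Longrightarrow> g y \<in> U \<and> f (g y) = y"
    using g(6) unfolding homeomorphism_def by blast+
  define M where "M x = matrix (blinfun_apply (f' x))" for x
  have M: "M x *v v = f' x v" for x v
    unfolding M_def by (simp add: blinfun.bounded_linear_right bounded_linear.linear)
  have Mc: "smooth_on UNIV (\<lambda>x. M x $ i $ j)" for i j
    unfolding M_def matrix_def f'
    using smooth_on_linear_compose[OF open_UNIV bounded_linear_vec_nth sd] by simp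
  have dU: "det (M x) \<noteq> 0" if "x \<in> U" for x
  proof -
    have "bij (blinfun_apply (f' x))" using g(9) that gU by auto
    then have "invertible (M x)"
      unfolding M_def by (metis invertible_eq_bij M M_def bij_betw_cong)
    then show ?thesis by (simp add: invertible_det_nz)
  qed
  \<comment> \<open>Cramer's formula for the solution \<open>u\<close> of
    \<open>M x *v u = v\<close>, smooth in \<open>x\<close> where the determinant does not
    vanish.\<close>
  define h where "h v x = (\<chi> k. det (\<chi> i j. if j = k then v $ i else M x $ i $ j) * inverse (det (M x)))" for v x
  have hs: "smooth_on U (h v)" for v
  proof -
    have "smooth_on U (\<lambda>x. det (\<chi> i j. if j = k then v $ i else M x $ i $ j) * inverse (det (M x)))" for k
    proof (intro smooth_on_mult g(1) smooth_on_inverse smooth_on_det smooth_on_mono[OF Mc] dU)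
      show "smooth_on U (\<lambda>x. (\<chi> i j. if j = k then v $ i else M x $ i $ j) $ i $ j)" for i j
        by (cases "j = k") (auto intro: smooth_on_const smooth_on_mono[OF Mc])
    qed auto
    then have "smooth_on U (\<lambda>x. \<Sum>k\<in>UNIV. (det (\<chi> i j. if j = k then v $ i else M x $ i $ j) * inverse (det (M x))) *\<^sub>R axis k 1)"
      by (intro smooth_on_sum smooth_on_scaleR smooth_on_const g(1))
    then show ?thesis
    proof (rule smooth_on_cong[OF g(1), rotated])
      fix x
      show "(\<Sum>k\<in>UNIV. (det (\<chi> i j. if j = k then v $ i else M x $ i $ j) * inverse (det (M x))) *\<^sub>R axis k 1) = h v x"
      unfolding h_def vec_eq_iff by (simp add: axis_def if_distrib cong: if_cong)
    qed
  qed
  have g'h: "g' y v = h v (g y)" if "y \<in> V" for y v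
  proof -
    have x: "g y \<in> U" using fg that by blast
    have "M (g y) *v (g' y v) = v"
      unfolding M g(8)[OF that] using g(9)[OF that] by (simp add: bij_is_surj surj_f_inv_f)
    then have "g' y v = (\<chi> k. det (\<chi> i j. if j = k then v $ i else M (g y) $ i $ j) / det (M (g y)))"
      using cramer[OF dU[OF x]] by blast
    then show ?thesis by (simp add: h_def divide_inverse)
  qed
  have "k_times_differentiable_on k V g" for k
  proof (induction k)
    case 0 show ?case using g(6) by (simp add: homeomorphism_def)
  next
    case (Suc k)
    show ?case
    proof (rule ktd_SucI[OF g(4), of _ g'])
      fix v
      have "k_times_differentiable_on k V (\<lambda>y. h v (g y))"
        by (rule ktd_compose[OF g(4,1) Suc.IH _ hs]) (simp add: gU)
      then show "k_times_differentiable_on k V (\<lambda>y. g' y v)"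
        using ktd_cong[OF g(4), of "\<lambda>y. h v (g y)"] g'h by metis
    qed (use g(7) in auto)
  qed
  then have "smooth_on V g" by (simp add: smooth_on_def)
  then show ?thesis using that g(1,3,4,5) gf fg by blast
qed

lemma ex_iso_cart:
  assumes "DIM('a::euclidean_space) = CARD('n::finite)"
  obtains h :: "'a::euclidean_space \<Rightarrow> real^'n::finite" and k where "bounded_linear h" "bounded_linear k"
    "\<And>x. k (h x) = x" "\<And>y. h (k y) = y"
proof -
  have "dim (UNIV :: 'a set) = dim (UNIV :: (real^'n) set)" using assms by simp
  then obtain h :: "'a \<Rightarrow> real^'n" and k where "linear h" "linear k" "\<And>x. k (h x) = x" "\<And>y. h (k y) = y"
    using isometries_subspaces[OF subspace_UNIV subspace_UNIV] by (metis UNIV_I)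
  then show ?thesis using that by (simp add: linear_conv_bounded_linear)
qed

text \<open>Cramer's rule needs matrices, so the map is conjugated by linear isomorphisms with
  \<open>real^'n\<close>; the type \<open>'n\<close> records the common dimension.\<close>

lemma smooth_inverse_function:
  fixes f :: "'a::euclidean_space \<Rightarrow> 'b::euclidean_space"
  assumes "smooth_on UNIV f" "(f has_derivative D) (at x0)" "inj D"
    and "DIM('a) = CARD('n::finite)" "DIM('b) = CARD('n)"
  obtains U V g where "open U" "x0 \<in> U" "open V" "f x0 \<in> V" "smooth_on V g"
    "\<And>x. x \<in> U \<Longrightarrow> f x \<in> V \<and> g (f x) = x" "\<And>y. y \<in> V \<Longrightarrow> g y \<in> U \<and> f (g y) = y"
proof -
  obtain ha :: "'a \<Rightarrow> real^'n" and ka where a: "bounded_linear ha" "bounded_linear ka"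
    "\<And>x. ka (ha x) = x" "\<And>y. ha (ka y) = y" using ex_iso_cart[OF assms(4)] by blast
  obtain hb :: "'b \<Rightarrow> real^'n" and kb where b: "bounded_linear hb" "bounded_linear kb"
    "\<And>x. kb (hb x) = x" "\<And>y. hb (kb y) = y" using ex_iso_cart[OF assms(5)] by blast
  have 1: "smooth_on UNIV (\<lambda>x. hb (f (ka x)))"
    by (rule smooth_on_linear_compose[OF open_UNIV b(1)], rule smooth_on_compose[OF open_UNIV open_UNIV _ _ assms(1)])
      (auto intro: smooth_on_bounded_linear a)
  have 2: "((\<lambda>x. hb (f (ka x))) has_derivative (\<lambda>v. hb (D (ka v)))) (at (ha x0))"
    by (intro bounded_linear.has_derivative[OF b(1)] has_derivative_compose[OF bounded_linear_imp_has_derivative[OF a(2)], of f D])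
      (use assms(2) a(3) in simp)
  have 3: "inj (\<lambda>v. hb (D (ka v)))"
    by (rule injI) (metis a(4) b(3) assms(3) injD)
  obtain U V g where g: "open U" "ha x0 \<in> U" "open V" "hb (f (ka (ha x0))) \<in> V" "smooth_on V g"
    "\<And>x. x \<in> U \<Longrightarrow> hb (f (ka x)) \<in> V \<and> g (hb (f (ka x))) = x"
    "\<And>y. y \<in> V \<Longrightarrow> g y \<in> U \<and> hb (f (ka (g y))) = y"
    using smooth_inverse_function_cart[OF 1 2 3] by blast
  have o: "open (ha -` U)" "open (hb -` V)"
    using g(1,3) a(1) b(1) by (auto intro!: open_vimage simp: linear_continuous_on)
  show ?thesis
  proof (rule that[of "ha -` U" "hb -` V" "\<lambda>y. ka (g (hb y))"])
    show "smooth_on (hb -` V) (\<lambda>y. ka (g (hb y)))"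
      by (rule smooth_on_linear_compose[OF o(2) a(2)], rule smooth_on_compose[OF o(2) g(3) _ _ g(5)])
        (auto intro: smooth_on_bounded_linear b o)
    show "x \<in> ha -` U \<Longrightarrow> f x \<in> hb -` V \<and> ka (g (hb (f x))) = x" for x
      using g(6)[of "ha x"] a(3)[of x] by auto
    show "y \<in> hb -` V \<Longrightarrow> ka (g (hb y)) \<in> ha -` U \<and> f (ka (g (hb y))) = y" for y
      using g(7)[of "hb y"] a(4) b(3) by (metis vimage_eq)
  qed (use o g a in auto)
qed

section \<open>Orbits with smooth slices are homogeneous spaces\<close>

lemma smooth_on_subsetE:
  assumes "smooth_on_subset S f" "x \<in> S"
  obtains U F where "open U" "x \<in> U" "smooth_on U F" "\<And>y. y \<in> S \<inter> U \<Longrightarrow> F y = f y"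
proof -
  from bspec[OF assms(1)[unfolded smooth_on_subset_def] assms(2)] obtain U F where
    "open U \<and> x \<in> U \<and> smooth_on U F \<and> (\<forall>y\<in>S \<inter> U. F y = f y)"
    by (elim exE)
  then show ?thesis by (intro that[of U F]) blast+
qed

lemma smooth_on_subset_continuous:
  assumes "smooth_on_subset S f" shows "continuous_on S f"
  unfolding continuous_on_topological
proof (intro ballI allI impI)
  fix x B assume x: "x \<in> S" and B: "open B" "f x \<in> B"
  obtain U F where U: "open U" "x \<in> U" "smooth_on U F" "\<And>y. y \<in> S \<inter> U \<Longrightarrow> F y = f y"
    by (rule smooth_on_subsetE[OF assms x]) (rule that; assumption)
  have "open (U \<inter> F -` B)"
    by (rule continuous_open_preimage[OF smooth_on_continuous[OF U(3)] U(1) B(1)])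
  moreover have "x \<in> U \<inter> F -` B" using U x B by auto
  moreover have "\<forall>y\<in>S. y \<in> U \<inter> F -` B \<longrightarrow> f y \<in> B" using U(4) by force
  ultimately show "\<exists>A. open A \<and> x \<in> A \<and> (\<forall>y\<in>S. y \<in> A \<longrightarrow> f y \<in> B)" by blast
qed

section \<open>Charts of embedded submanifolds\<close>

lemma submanifold_atlasD:
  assumes "(U, \<phi>) \<in> submanifold_atlas M"
  shows "openin (top_of_set M) U" "inj_on \<phi> U" "open (\<phi> ` U)" "smooth_on_subset U \<phi>"
    "smooth_on (\<phi> ` U) (inv_into U \<phi>)" "U \<subseteq> M"
    "continuous_on U \<phi>" "continuous_on (\<phi> ` U) (inv_into U \<phi>)"
  using assms smooth_on_subset_continuous smooth_on_continuous openin_imp_subset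
  unfolding submanifold_atlas_def by blast+

lemma submanifold_atlas_homeomorphic_map:
  assumes "(U, \<phi>) \<in> submanifold_atlas M"
  shows "homeomorphic_map (subtopology (top_of_set M) U) (top_of_set (\<phi> ` U)) \<phi>"
proof -
  note U = submanifold_atlasD[OF assms]
  have "homeomorphic_maps (top_of_set U) (top_of_set (\<phi> ` U)) \<phi> (inv_into U \<phi>)"
    unfolding homeomorphic_maps_def using U(2,7,8) by (auto simp: inv_into_into)
  moreover have "subtopology (top_of_set M) U = top_of_set U"
    using U(6) by (simp add: subtopology_subtopology inf.absorb2)
  ultimately show ?thesis using homeomorphic_map_maps by metis
qed

lemma submanifold_atlas_open_image:
  assumes "(U, \<phi>) \<in> submanifold_atlas M" "openin (top_of_set M) W"
  shows "open (\<phi> ` (U \<inter> W))"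
proof -
  note U = submanifold_atlasD[OF assms(1)]
  obtain T where T: "open T" "W = M \<inter> T" using assms(2) by (auto simp: openin_open)
  have "{y \<in> \<phi> ` U. inv_into U \<phi> y \<in> T} = \<phi> ` (U \<inter> W)"
    using U(2,6) T(2) by auto
  moreover have "open (\<phi> ` U \<inter> inv_into U \<phi> -` T)"
    by (rule continuous_open_preimage[OF U(8,3) T(1)])
  moreover have "{y \<in> \<phi> ` U. inv_into U \<phi> y \<in> T} = \<phi> ` U \<inter> inv_into U \<phi> -` T" by blast
  ultimately show ?thesis by simp
qed

lemma smooth_on_subset_compose:
  fixes i :: "'n::real_normed_vector \<Rightarrow> 'e::fin_normed"
  assumes "smooth_on_subset V \<psi>" "open O'" "smooth_on O' i" "i ` O' \<subseteq> V"
  shows "smooth_on O' (\<lambda>y. \<psi> (i y))"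
proof (rule smooth_on_local[OF assms(2)])
  fix y assume y: "y \<in> O'"
  then have "i y \<in> V" using assms(4) by blast
  then obtain W F where W: "open W" "i y \<in> W" "smooth_on W F" "\<And>z. z \<in> V \<inter> W \<Longrightarrow> F z = \<psi> z"
    using smooth_on_subsetE[OF assms(1)] by metis
  let ?N = "O' \<inter> i -` W"
  have N: "open ?N" by (rule continuous_open_preimage[OF smooth_on_continuous[OF assms(3)] assms(2) W(1)])
  have "smooth_on ?N (\<lambda>y. F (i y))"
    by (rule smooth_on_compose[OF N W(1) smooth_on_mono[OF assms(3)] _ W(3)]) auto
  then have "smooth_on ?N (\<lambda>y. \<psi> (i y))"
    by (rule smooth_on_cong[OF N, rotated]) (use W(4) assms(4) in auto)
  then show "\<exists>N. open N \<and> y \<in> N \<and> smooth_on N (\<lambda>y. \<psi> (i y))"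
    using N y W(2) by blast
qed

lemma submanifold_atlas_transition:
  fixes M :: "'e::fin_normed set"
  assumes "(U, \<phi>) \<in> submanifold_atlas M" "(V, \<psi>) \<in> submanifold_atlas M"
  shows "smooth_on (\<phi> ` (U \<inter> V)) (\<psi> \<circ> inv_into U \<phi>)"
proof -
  note U = submanifold_atlasD[OF assms(1)] and V = submanifold_atlasD[OF assms(2)]
  have "smooth_on (\<phi> ` (U \<inter> V)) (\<lambda>y. \<psi> (inv_into U \<phi> y))"
  proof (rule smooth_on_subset_compose[OF V(4)])
    show "open (\<phi> ` (U \<inter> V))" by (rule submanifold_atlas_open_image[OF assms(1) V(1)])
    show "smooth_on (\<phi> ` (U \<inter> V)) (inv_into U \<phi>)" by (rule smooth_on_mono[OF U(5)]) auto
    show "inv_into U \<phi> ` \<phi> ` (U \<inter> V) \<subseteq> V" using U(2) by auto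
  qed
  then show ?thesis by (simp add: o_def)
qed

text \<open>Separation and countability come from the ambient space. Transition maps are smooth
  because the inverse of a chart is smooth into the ambient space, where the other chart extends
  locally. What remains to be supplied is the covering.\<close>

lemma smooth_manifold_submanifold_atlas:
  fixes M :: "'e::fin_normed set"
  assumes "\<And>x. x \<in> M \<Longrightarrow> \<exists>(U, \<phi>) \<in> (submanifold_atlas M :: ('e, 'n::euclidean_space) chart set). x \<in> U"
  shows "smooth_manifold (top_of_set M) (submanifold_atlas M :: ('e, 'n) chart set)"
  unfolding smooth_manifold_def
proof (intro conjI)
  show "Hausdorff_space (top_of_set M)"
    by (simp add: Hausdorff_space_subtopology)
  show "second_countable (top_of_set M)" by (rule second_countable_fin_normed)
  show "\<forall>(U, \<phi>)\<in>(submanifold_atlas M :: ('e, 'n) chart set). openin (top_of_set M) U \<and> open (\<phi> ` U) \<and>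
      homeomorphic_map (subtopology (top_of_set M) U) (top_of_set (\<phi> ` U)) \<phi>"
    using submanifold_atlasD(1,3) submanifold_atlas_homeomorphic_map by fast
  show "topspace (top_of_set M) = (\<Union>(U, \<phi>)\<in>(submanifold_atlas M :: ('e, 'n) chart set). U)"
    using assms submanifold_atlasD(6) by fastforce
  show "\<forall>(U, \<phi>)\<in>submanifold_atlas M. \<forall>(V, \<psi>)\<in>(submanifold_atlas M :: ('e, 'n) chart set).
      smooth_on (\<phi> ` (U \<inter> V)) (\<psi> \<circ> inv_into U \<phi>)"
    using submanifold_atlas_transition by fast
qed

text \<open>A slice \<open>(U, L, N, s)\<close> at \<open>K\<close> is a local section \<open>s \<circ> L\<close> of the orbit map over \<open>U\<close>, read in
  the coordinates \<open>L\<close>.\<close>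

definition is_slice ::
  "'g::real_normed_vector set \<Rightarrow> ('g \<Rightarrow> 'e::real_normed_vector) \<Rightarrow>
   'e set \<Rightarrow> ('e \<Rightarrow> 'n::euclidean_space) \<Rightarrow> 'n set \<Rightarrow> ('n \<Rightarrow> 'g) \<Rightarrow> bool" where
  "is_slice G \<rho> U L N s \<longleftrightarrow> open U \<and> smooth_on U L \<and> open N \<and> smooth_on N s \<and>
     (\<forall>z\<in>N. s z \<in> G \<and> \<rho> (s z) \<in> U \<and> L (\<rho> (s z)) = z) \<and>
     (\<forall>K\<in>\<rho> ` G \<inter> U. L K \<in> N \<and> \<rho> (s (L K)) = K)"

lemma is_sliceD:
  assumes "is_slice G \<rho> U L N s"
  shows "open U" "smooth_on U L" "open N" "smooth_on N s"
    "\<And>z. z \<in> N \<Longrightarrow> s z \<in> G" "\<And>z. z \<in> N \<Longrightarrow> \<rho> (s z) \<in> U" "\<And>z. z \<in> N \<Longrightarrow> L (\<rho> (s z)) = z"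
    "\<And>K. K \<in> \<rho> ` G \<inter> U \<Longrightarrow> L K \<in> N \<and> \<rho> (s (L K)) = K \<and> s (L K) \<in> G"
  using assms unfolding is_slice_def by auto

text \<open>What is kept of a group action with orbit map \<open>\<rho>\<close>: its fibres are the
  cosets, and there are local slices. \<open>dim_witness\<close> fixes the coordinate type
  \<open>'n\<close>, which otherwise occurs under a quantifier only.\<close>

locale sliced_orbit =
  fixes G H :: "('v::euclidean_space \<Rightarrow>\<^sub>L 'v) set" and \<rho> :: "('v \<Rightarrow>\<^sub>L 'v) \<Rightarrow> 'e::fin_normed"
    and dim_witness :: "'n::euclidean_space itself"
  assumes smooth_\<rho>: "smooth_on UNIV \<rho>"
    and fibres: "\<And>a b. a \<in> G \<Longrightarrow> b \<in> G \<Longrightarrow> left_coset H a = left_coset H b \<longleftrightarrow> \<rho> a = \<rho> b"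
    and slices: "\<And>K. K \<in> \<rho> ` G \<Longrightarrow> \<exists>U (L :: 'e \<Rightarrow> 'n) N s. K \<in> U \<and> is_slice G \<rho> U L N s"
begin

abbreviation "C \<equiv> \<rho> ` G"
abbreviation "GH \<equiv> coset_topology G H"
abbreviation "atlas_C \<equiv> (submanifold_atlas C :: ('e, 'n) chart set)"
abbreviation "atlas_GH \<equiv> (coset_atlas G H :: (('v \<Rightarrow>\<^sub>L 'v) set, 'n) chart set)"

lemma sliceE:
  assumes "K \<in> C"
  obtains U and L :: "'e \<Rightarrow> 'n" and N s where "K \<in> U" "is_slice G \<rho> U L N s"
  using slices[OF assms] by (elim exE conjE) (rule that)

text \<open>The inverse of the bijection from cosets to points that \<open>\<rho>\<close> induces;
  by \<open>fibres\<close> the chosen \<open>a\<close> does not matter.\<close>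

definition F :: "'e \<Rightarrow> ('v \<Rightarrow>\<^sub>L 'v) set" where
  "F K = left_coset H (SOME a. a \<in> G \<and> \<rho> a = K)"

lemma F_\<rho>: "a \<in> G \<Longrightarrow> F (\<rho> a) = left_coset H a"
proof -
  assume a: "a \<in> G"
  then have "(SOME b. b \<in> G \<and> \<rho> b = \<rho> a) \<in> G \<and> \<rho> (SOME b. b \<in> G \<and> \<rho> b = \<rho> a) = \<rho> a"
    by (intro someI[of "\<lambda>b. b \<in> G \<and> \<rho> b = \<rho> a"]) simp
  then show ?thesis unfolding F_def using fibres a by blast
qed

lemma topspace_GH: "topspace GH = left_coset H ` G"
  using quotient_imp_surjective_map[OF quotient_map_left_coset[of G H]] by simp

lemma bij_F: "bij_betw F C (left_coset H ` G)"
  unfolding bij_betw_def inj_on_def using F_\<rho> fibres by force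

lemma F_C: "F ` C = left_coset H ` G"
  using bij_F by (simp add: bij_betw_def)

lemma F_image_vimage:
  assumes "U \<subseteq> left_coset H ` G" shows "F ` (C \<inter> F -` U) = U"
proof -
  have "F ` (A \<inter> F -` U) = F ` A \<inter> U" for A by blast
  then show ?thesis using F_C assms by (simp add: inf.absorb2)
qed

lemma inv_F: "a \<in> G \<Longrightarrow> inv_into C F (left_coset H a) = \<rho> a"
  using bij_F F_\<rho> by (metis bij_betw_imp_inj_on imageI inv_into_f_f)

text \<open>Over a slice, \<open>F\<close> is \<open>left_coset H \<circ> s \<circ> L\<close>; hence
  its continuity.\<close>

lemma open_F_vimage:
  assumes "openin GH T" shows "openin (top_of_set C) (C \<inter> F -` T)"
proof (subst openin_subopen, intro ballI)
  fix K assume K: "K \<in> C \<inter> F -` T"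
  obtain U and L :: "'e \<Rightarrow> 'n" and N s where U: "K \<in> U" and sl: "is_slice G \<rho> U L N s"
    by (rule sliceE[OF IntD1[OF K]]) (rule that)
  note sl = is_sliceD[OF sl]
  have "openin (top_of_set G) {a\<in>G. left_coset H a \<in> T}" using assms openin_coset_topology by blast
  then obtain O' where O: "open O'" "{a\<in>G. left_coset H a \<in> T} = G \<inter> O'" by (auto simp: openin_open)
  note LK = sl(8)
  have N: "open (N \<inter> s -` O')"
    using sl O(1) by (intro continuous_open_preimage smooth_on_continuous) auto
  have W: "open (U \<inter> L -` (N \<inter> s -` O'))"
    by (rule continuous_open_preimage[OF smooth_on_continuous _ N]) (use sl in auto)
  have iff: "F K' \<in> T \<longleftrightarrow> s (L K') \<in> O'" if "K' \<in> C \<inter> U" for K'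
  proof -
    have "F K' = left_coset H (s (L K'))" using F_\<rho> LK[OF that] by metis
    moreover have "left_coset H a \<in> T \<longleftrightarrow> a \<in> O'" if "a \<in> G" for a
      using O(2) that by blast
    ultimately show ?thesis using LK[OF that] by metis
  qed
  have "C \<inter> (U \<inter> L -` (N \<inter> s -` O')) \<subseteq> C \<inter> F -` T"
    using iff by auto
  moreover have "K \<in> C \<inter> (U \<inter> L -` (N \<inter> s -` O'))"
    using K U iff[of K] LK[of K] by auto
  moreover have "openin (top_of_set C) (C \<inter> (U \<inter> L -` (N \<inter> s -` O')))"
    using W by blast
  ultimately show "\<exists>T'. openin (top_of_set C) T' \<and> K \<in> T' \<and> T' \<subseteq> C \<inter> F -` T"
    by blast
qed

text \<open>Openness of a set of cosets is tested in \<open>G\<close>, where it becomes the preimage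
  of an open set under the continuous \<open>\<rho>\<close>.\<close>

lemma open_F_image:
  assumes "openin (top_of_set C) W" shows "openin GH (F ` W)"
proof -
  obtain O' where O: "open O'" "W = C \<inter> O'" using assms by (auto simp: openin_open)
  have "{a\<in>G. left_coset H a \<in> F ` W} = G \<inter> \<rho> -` O'"
  proof (intro set_eqI iffI)
    fix a assume "a \<in> {a\<in>G. left_coset H a \<in> F ` W}"
    then obtain K where a: "a \<in> G" "K \<in> W" "left_coset H a = F K" by blast
    then obtain b where "b \<in> G" "K = \<rho> b" using O(2) by blast
    then have "\<rho> a = K" using a F_\<rho> fibres by metis
    then show "a \<in> G \<inter> \<rho> -` O'" using a O(2) by auto
  next
    fix a assume "a \<in> G \<inter> \<rho> -` O'"
    then show "a \<in> {a\<in>G. left_coset H a \<in> F ` W}"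
      using O(2) F_\<rho>[of a] by (auto intro: image_eqI[of _ F "\<rho> a"])
  qed
  moreover have "open (\<rho> -` O')"
    using smooth_on_continuous[OF smooth_\<rho>] O(1) by (rule open_vimage[rotated])
  ultimately have "openin (top_of_set G) {a\<in>G. left_coset H a \<in> F ` W}" by (simp add: openin_open_Int)
  moreover have "F ` W \<subseteq> left_coset H ` G" using O(2) F_\<rho> by auto
  ultimately show ?thesis by (simp add: openin_coset_topology)
qed

lemma homeomorphic_map_F: "homeomorphic_map (top_of_set C) GH F"
  unfolding homeomorphic_map_def
proof (intro bijective_open_imp_homeomorphic_map[unfolded homeomorphic_map_def])
  show "continuous_map (top_of_set C) GH F"
    unfolding continuous_map_def
  proof (intro conjI allI impI)
    show "F \<in> topspace (top_of_set C) \<rightarrow> topspace GH"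
      using F_C topspace_GH by auto
    fix T assume "openin GH T"
    from open_F_vimage[OF this] show "openin (top_of_set C) {x \<in> topspace (top_of_set C). F x \<in> T}"
      by (simp add: vimage_def Int_def)
  qed
  show "open_map (top_of_set C) GH F" unfolding open_map_def using open_F_image by blast
  show "F ` topspace (top_of_set C) = topspace GH" using bij_F topspace_GH by (simp add: bij_betw_def)
  show "inj_on F (topspace (top_of_set C))" using bij_F by (simp add: bij_betw_def)
qed

lemma inv_into_chart:
  assumes "U \<subseteq> left_coset H ` G" "inj_on \<phi> U" "z \<in> \<phi> ` U"
  shows "inv_into (C \<inter> F -` U) (\<phi> \<circ> F) z = inv_into C F (inv_into U \<phi> z)"
    and "F (inv_into (C \<inter> F -` U) (\<phi> \<circ> F) z) = inv_into U \<phi> z"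
    and "inv_into (C \<inter> F -` U) (\<phi> \<circ> F) z \<in> C \<inter> F -` U"
proof -
  let ?x = "inv_into U \<phi> z"
  have x: "?x \<in> U" "\<phi> ?x = z" using assms(3) by (auto simp: inv_into_into f_inv_into_f)
  have xF: "?x \<in> F ` C" using x(1) assms(1) bij_F by (auto simp: bij_betw_def)
  have inj: "inj_on (\<phi> \<circ> F) (C \<inter> F -` U)"
    using assms(2) bij_F unfolding bij_betw_def inj_on_def by auto
  have y: "inv_into C F ?x \<in> C" "F (inv_into C F ?x) = ?x"
    using xF by (auto simp: inv_into_into f_inv_into_f)
  show eq: "inv_into (C \<inter> F -` U) (\<phi> \<circ> F) z = inv_into C F ?x"
    by (rule inv_into_f_eq[OF inj]) (use y x in auto)
  show "F (inv_into (C \<inter> F -` U) (\<phi> \<circ> F) z) = ?x" "inv_into (C \<inter> F -` U) (\<phi> \<circ> F) z \<in> C \<inter> F -` U"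
    using eq y x by auto
qed

lemma chart_image:
  assumes "U \<subseteq> left_coset H ` G" shows "(\<phi> \<circ> F) ` (C \<inter> F -` U) = \<phi> ` U"
  by (simp add: F_image_vimage[OF assms] flip: image_image)

text \<open>The slice of the orbit makes \<open>\<phi> \<circ> F\<close> smooth, as it is
  \<open>\<phi> \<circ> left_coset H\<close> after \<open>s \<circ> L\<close>. The section built
  into \<open>coset_atlas\<close>, followed by \<open>\<rho>\<close>, makes its inverse
  smooth.\<close>

lemma coset_chart_pullback:
  assumes "(U, \<phi>) \<in> atlas_GH"
  shows "(C \<inter> F -` U, \<phi> \<circ> F) \<in> atlas_C"
proof -
  have U: "openin GH U" "inj_on \<phi> U" "open (\<phi> ` U)"
    "smooth_on_subset {a\<in>G. left_coset H a \<in> U} (\<phi> \<circ> left_coset H)"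
    and sec: "\<And>y. y\<in>\<phi> ` U \<Longrightarrow> \<exists>N s. open N \<and> y \<in> N \<and> N \<subseteq> \<phi> ` U \<and> smooth_on N s \<and>
        (\<forall>z\<in>N. s z \<in> G \<and> left_coset H (s z) = inv_into U \<phi> z)"
    using assms unfolding coset_atlas_def by auto
  have sub: "U \<subseteq> left_coset H ` G" using U(1) openin_coset_topology by blast
  have "inj_on (\<phi> \<circ> F) (C \<inter> F -` U)"
    using U(2) bij_F unfolding bij_betw_def inj_on_def by auto
  moreover have "smooth_on_subset (C \<inter> F -` U) (\<phi> \<circ> F)"
    unfolding smooth_on_subset_def
  proof
    fix K assume K: "K \<in> C \<inter> F -` U"
    obtain W and L :: "'e \<Rightarrow> 'n" and N s where W: "K \<in> W" and sl: "is_slice G \<rho> W L N s"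
      by (rule sliceE[OF IntD1[OF K]]) (rule that)
    note sl = is_sliceD[OF sl]
    note LK = sl(8)
    have FK: "F K' = left_coset H (s (L K'))" if "K' \<in> C \<inter> W" for K'
      using F_\<rho>[of "s (L K')"] LK[OF that] by simp
    have "s (L K) \<in> {a\<in>G. left_coset H a \<in> U}" using FK[of K] LK[of K] K W by auto
    then obtain O' E where O: "open O'" "s (L K) \<in> O'" "smooth_on O' E"
      "\<And>a. a \<in> {a\<in>G. left_coset H a \<in> U} \<inter> O' \<Longrightarrow> E a = (\<phi> \<circ> left_coset H) a"
      by (rule smooth_on_subsetE[OF U(4)]) (rule that; assumption)
    let ?N = "N \<inter> s -` O'"
    let ?W = "W \<inter> L -` ?N"
    have N: "open ?N"
      using sl O(1) by (intro continuous_open_preimage smooth_on_continuous) auto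
    have Wo: "open ?W"
      by (rule continuous_open_preimage[OF smooth_on_continuous _ N]) (use sl in auto)
    have sN: "smooth_on ?N (\<lambda>z. E (s z))"
      by (rule smooth_on_compose[OF N O(1) _ _ O(3)]) (use sl in \<open>auto intro: smooth_on_mono\<close>)
    have "smooth_on ?W (\<lambda>K. E (s (L K)))"
      by (rule smooth_on_compose[OF Wo N _ _ sN]) (use sl in \<open>auto intro: smooth_on_mono\<close>)
    moreover have "K \<in> ?W" using W LK[of K] K O(2) by auto
    moreover have "E (s (L K')) = (\<phi> \<circ> F) K'" if "K' \<in> (C \<inter> F -` U) \<inter> ?W" for K'
      using that FK[of K'] LK[of K'] O(4)[of "s (L K')"] by auto
    ultimately show "\<exists>W E. open W \<and> K \<in> W \<and> smooth_on W E \<and> (\<forall>K'\<in>(C \<inter> F -` U) \<inter> W. E K' = (\<phi> \<circ> F) K')"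
      using Wo by (intro exI[of _ ?W] exI[of _ "\<lambda>K. E (s (L K))"]) blast
  qed
  moreover have "smooth_on (\<phi> ` U) (inv_into (C \<inter> F -` U) (\<phi> \<circ> F))"
  proof (rule smooth_on_local[OF U(3)])
    fix y assume y: "y \<in> \<phi> ` U"
    obtain N s where N: "open N" "y \<in> N" "N \<subseteq> \<phi> ` U" "smooth_on N s"
        "\<And>z. z\<in>N \<Longrightarrow> s z \<in> G \<and> left_coset H (s z) = inv_into U \<phi> z"
      using sec[OF y] by blast
    have "smooth_on N (\<lambda>z. \<rho> (s z))"
      by (rule smooth_on_compose[OF N(1) open_UNIV N(4) _ smooth_\<rho>]) simp
    then have "smooth_on N (inv_into (C \<inter> F -` U) (\<phi> \<circ> F))"
    proof (rule smooth_on_cong[OF N(1), rotated])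
      fix z assume z: "z \<in> N"
      then show "\<rho> (s z) = inv_into (C \<inter> F -` U) (\<phi> \<circ> F) z"
        using inv_into_chart(1)[OF sub U(2), of z] N(3) N(5)[OF z] inv_F by (metis subsetD)
    qed
    then show "\<exists>N. open N \<and> y \<in> N \<and> smooth_on N (inv_into (C \<inter> F -` U) (\<phi> \<circ> F))"
      using N by blast
  qed
  ultimately show ?thesis
    unfolding submanifold_atlas_def using open_F_vimage[OF U(1)] U(3) chart_image[OF sub, of \<phi>]
    by (simp only: mem_Collect_eq prod.case simp_thms)
qed

text \<open>On \<open>G\<close> the new chart is \<open>\<psi> \<circ> \<rho>\<close>, hence smooth.
  The sections that \<open>coset_atlas\<close> demands come from the slices:
  \<open>s \<circ> L\<close> after the inverse of \<open>\<psi>\<close>.\<close>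

lemma coset_chart_pushforward:
  assumes "(W, \<psi>) \<in> atlas_C"
  shows "(F ` W, \<psi> \<circ> inv_into C F) \<in> atlas_GH"
proof -
  note W = submanifold_atlasD[OF assms]
  have iF: "inv_into C F (F K) = K" if "K \<in> C" for K
    using bij_F that by (simp add: bij_betw_def)
  have im: "(\<psi> \<circ> inv_into C F) ` (F ` W) = \<psi> ` W"
    using W(6) iF by (force simp: image_iff)
  have inj: "inj_on (\<psi> \<circ> inv_into C F) (F ` W)"
    using W(2,6) iF by (auto simp: inj_on_def subset_iff)
  have "smooth_on_subset {a\<in>G. left_coset H a \<in> F ` W} (\<psi> \<circ> inv_into C F \<circ> left_coset H)"
    unfolding smooth_on_subset_def
  proof
    fix a assume a: "a \<in> {a\<in>G. left_coset H a \<in> F ` W}"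
    have \<rho>W: "\<rho> b \<in> W" if "b \<in> {a\<in>G. left_coset H a \<in> F ` W}" for b
      using that W(6) iF inv_F by (smt (verit) image_iff mem_Collect_eq subsetD)
    obtain O' E where O: "open O'" "\<rho> a \<in> O'" "smooth_on O' E" "\<And>K. K \<in> W \<inter> O' \<Longrightarrow> E K = \<psi> K"
      by (rule smooth_on_subsetE[OF W(4) \<rho>W[OF a]]) (rule that; assumption)
    have op: "open (\<rho> -` O')"
      using smooth_on_continuous[OF smooth_\<rho>] O(1) by (rule open_vimage[rotated])
    have "smooth_on (\<rho> -` O') (\<lambda>b. E (\<rho> b))"
      by (rule smooth_on_compose[OF op O(1) smooth_on_mono[OF smooth_\<rho>] _ O(3)]) auto
    moreover have "E (\<rho> b) = (\<psi> \<circ> inv_into C F \<circ> left_coset H) b"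
      if "b \<in> {a\<in>G. left_coset H a \<in> F ` W} \<inter> \<rho> -` O'" for b
      using that O(4) \<rho>W[of b] inv_F[of b] by auto
    ultimately show "\<exists>U E. open U \<and> a \<in> U \<and> smooth_on U E \<and>
        (\<forall>b\<in>{a\<in>G. left_coset H a \<in> F ` W} \<inter> U. E b = (\<psi> \<circ> inv_into C F \<circ> left_coset H) b)"
      using op O(2) by (intro exI[of _ "\<rho> -` O'"] exI[of _ "\<lambda>b. E (\<rho> b)"]) blast
  qed
  moreover have "\<exists>N s. open N \<and> y \<in> N \<and> N \<subseteq> \<psi> ` W \<and> smooth_on N s \<and>
      (\<forall>z\<in>N. s z \<in> G \<and> left_coset H (s z) = inv_into (F ` W) (\<psi> \<circ> inv_into C F) z)"
    if y: "y \<in> \<psi> ` W" for y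
  proof -
    let ?i = "inv_into W \<psi>"
    have iW: "?i z \<in> W" "\<psi> (?i z) = z" if "z \<in> \<psi> ` W" for z
      using that by (auto simp: inv_into_into f_inv_into_f)
    obtain U and L :: "'e \<Rightarrow> 'n" and N s where U: "?i y \<in> U" and sl: "is_slice G \<rho> U L N s"
      by (rule sliceE[OF subsetD[OF W(6) iW(1)[OF y]]]) (rule that)
    note sl = is_sliceD[OF sl]
    note LK = sl(8)
    let ?N = "\<psi> ` W \<inter> ?i -` U"
    have N: "open ?N" by (rule continuous_open_preimage[OF W(8,3)]) (use sl in auto)
    have iCU: "?i z \<in> C \<inter> U" if "z \<in> ?N" for z using that iW W(6) by auto
    have "smooth_on ?N (\<lambda>z. L (?i z))"
      by (rule smooth_on_compose[OF N _ smooth_on_mono[OF W(5)]]) (use sl in auto)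
    then have "smooth_on ?N (\<lambda>z. s (L (?i z)))"
      by (rule smooth_on_compose[OF N sl(3) _ _ sl(4)]) (use LK iCU in auto)
    moreover have "left_coset H (s (L (?i z))) = inv_into (F ` W) (\<psi> \<circ> inv_into C F) z" if "z \<in> ?N" for z
    proof -
      have "left_coset H (s (L (?i z))) = F (?i z)"
        using F_\<rho> LK[OF iCU[OF that]] by metis
      moreover have "inv_into (F ` W) (\<psi> \<circ> inv_into C F) z = F (?i z)"
        by (rule inv_into_f_eq[OF inj]) (use iW that iF iCU[OF that] in auto)
      ultimately show ?thesis by simp
    qed
    ultimately show ?thesis
      using N y U LK iCU by (intro exI[of _ ?N] exI[of _ "\<lambda>z. s (L (?i z))"]) auto
  qed
  ultimately show ?thesis
    unfolding coset_atlas_def mem_Collect_eq prod.case im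
    using open_F_image[OF W(1)] inj W(3) by (intro conjI ballI) assumption+
qed

text \<open>The slice itself provides the chart: \<open>L\<close> restricted to the orbit, with
  inverse \<open>\<rho> \<circ> s\<close>.\<close>

lemma atlas_C_covers:
  assumes "K \<in> C" shows "\<exists>(U, \<phi>)\<in>atlas_C. K \<in> U"
proof -
  obtain U and L :: "'e \<Rightarrow> 'n" and N s where U: "K \<in> U" and sl: "is_slice G \<rho> U L N s"
    by (rule sliceE[OF assms]) (rule that)
  note sl = is_sliceD[OF sl]
  have im: "L ` (C \<inter> U) = N"
  proof (intro set_eqI iffI)
    fix z assume z: "z \<in> N"
    then have "\<rho> (s z) \<in> C \<inter> U" "z = L (\<rho> (s z))" using sl by auto
    then show "z \<in> L ` (C \<inter> U)" by blast
  qed (use sl in auto)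
  have inj: "inj_on L (C \<inter> U)" using sl by (intro inj_on_inverseI[of _ "\<lambda>z. \<rho> (s z)"]) auto
  have "smooth_on N (\<lambda>z. \<rho> (s z))"
    by (rule smooth_on_compose[OF _ open_UNIV _ _ smooth_\<rho>]) (use sl in auto)
  then have "smooth_on N (inv_into (C \<inter> U) L)"
  proof (rule smooth_on_cong[rotated 2])
    fix z assume "z \<in> N"
    then show "\<rho> (s z) = inv_into (C \<inter> U) L z"
      using sl by (intro inv_into_f_eq[OF inj, symmetric]) auto
  qed (use sl in simp)
  moreover have "smooth_on_subset (C \<inter> U) L"
    unfolding smooth_on_subset_def by (intro ballI exI[of _ U] exI[of _ L]) (simp add: sl(1,2))
  ultimately have "(C \<inter> U, L) \<in> atlas_C"
    unfolding submanifold_atlas_def using sl(1,3) im inj by (simp add: openin_open_Int)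
  then show ?thesis using U assms by (intro bexI[of _ "(C \<inter> U, L)"]) auto
qed

lemma smooth_manifold_C: "smooth_manifold (top_of_set C) atlas_C"
  by (rule smooth_manifold_submanifold_atlas) (rule atlas_C_covers)

text \<open>After the coset chart is pulled back along \<open>F\<close>, both maps are changes of
  charts of the submanifold.\<close>

lemma coset_transition:
  assumes "(U, \<phi>) \<in> atlas_GH" "(V, \<psi>) \<in> atlas_C"
  shows "smooth_on (\<psi> ` {x\<in>V. F x \<in> U}) (\<phi> \<circ> F \<circ> inv_into V \<psi>)"
    and "smooth_on (\<phi> ` {x\<in>U. inv_into C F x \<in> V}) (\<psi> \<circ> inv_into C F \<circ> inv_into U \<phi>)"
proof -
  have U: "openin GH U" "inj_on \<phi> U" using assms(1) unfolding coset_atlas_def by auto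
  have sub: "U \<subseteq> left_coset H ` G" using U(1) openin_coset_topology by blast
  note UF = coset_chart_pullback[OF assms(1)] and V = submanifold_atlasD[OF assms(2)]
  have "{x\<in>V. F x \<in> U} = V \<inter> (C \<inter> F -` U)" using V(6) by auto
  then show "smooth_on (\<psi> ` {x\<in>V. F x \<in> U}) (\<phi> \<circ> F \<circ> inv_into V \<psi>)"
    using submanifold_atlas_transition[OF assms(2) UF] by simp
  let ?W = "C \<inter> F -` U"
  have im: "(\<phi> \<circ> F) ` (?W \<inter> V) = \<phi> ` {x\<in>U. inv_into C F x \<in> V}"
  proof -
    have "F ` (?W \<inter> V) = {x\<in>U. inv_into C F x \<in> V}"
    proof (intro set_eqI iffI)
      fix x assume "x \<in> F ` (?W \<inter> V)"
      then obtain K where K: "K \<in> ?W" "K \<in> V" "x = F K" by blast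
      then show "x \<in> {x\<in>U. inv_into C F x \<in> V}"
        using bij_F by (simp add: bij_betw_def)
    next
      fix x assume x: "x \<in> {x\<in>U. inv_into C F x \<in> V}"
      then have "x \<in> F ` C" using sub F_C by blast
      then have "inv_into C F x \<in> C" "F (inv_into C F x) = x"
        by (rule inv_into_into, rule f_inv_into_f)
      then show "x \<in> F ` (?W \<inter> V)" using x
        by (intro image_eqI[of _ F "inv_into C F x"]) auto
    qed
    then show ?thesis by (metis image_comp)
  qed
  have op: "open ((\<phi> \<circ> F) ` (?W \<inter> V))" by (rule submanifold_atlas_open_image[OF UF V(1)])
  have "smooth_on (\<phi> ` {x\<in>U. inv_into C F x \<in> V}) (\<psi> \<circ> inv_into ?W (\<phi> \<circ> F))"
    using submanifold_atlas_transition[OF UF assms(2)] unfolding im .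
  then show "smooth_on (\<phi> ` {x\<in>U. inv_into C F x \<in> V}) (\<psi> \<circ> inv_into C F \<circ> inv_into U \<phi>)"
  proof (rule smooth_on_cong[rotated 2])
    show "open (\<phi> ` {x\<in>U. inv_into C F x \<in> V})" using op unfolding im .
    fix z assume "z \<in> \<phi> ` {x\<in>U. inv_into C F x \<in> V}"
    then show "(\<psi> \<circ> inv_into ?W (\<phi> \<circ> F)) z = (\<psi> \<circ> inv_into C F \<circ> inv_into U \<phi>) z"
      using inv_into_chart(1)[OF sub U(2), of z] by auto
  qed
qed

lemma smooth_manifold_GH: "smooth_manifold GH atlas_GH"
  unfolding smooth_manifold_def
proof (intro conjI)
  have hs: "top_of_set C homeomorphic_space GH"
    using homeomorphic_map_F homeomorphic_map_imp_homeomorphic_space by blast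
  show "Hausdorff_space GH"
    using homeomorphic_Hausdorff_space[OF hs] by (simp add: Hausdorff_space_subtopology)
  show "second_countable GH"
    using homeomorphic_space_second_countability[OF hs] second_countable_fin_normed by blast
  have U: "openin GH U" "inj_on \<phi> U" "open (\<phi> ` U)" "U \<subseteq> left_coset H ` G" if "(U, \<phi>) \<in> atlas_GH" for U \<phi>
    using that openin_coset_topology[of G H U] unfolding coset_atlas_def by auto
  show "\<forall>(U, \<phi>)\<in>atlas_GH. openin GH U \<and> open (\<phi> ` U) \<and>
      homeomorphic_map (subtopology GH U) (top_of_set (\<phi> ` U)) \<phi>"
  proof (intro ballI, clarify, intro conjI)
    fix U \<phi> assume c: "(U, \<phi>) \<in> atlas_GH"
    note U = U[OF c]
    show "openin GH U" "open (\<phi> ` U)" by fact+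
    let ?W = "C \<inter> F -` U"
    have hF: "homeomorphic_map (subtopology (top_of_set C) ?W) (subtopology GH U) F"
      by (rule homeomorphic_map_subtopologies[OF homeomorphic_map_F])
        (use U(4) F_image_vimage[OF U(4)] topspace_GH F_C in auto)
    then obtain F' where F': "homeomorphic_maps (subtopology (top_of_set C) ?W) (subtopology GH U) F F'"
      using homeomorphic_map_maps by blast
    have "homeomorphic_map (subtopology (top_of_set C) ?W) (top_of_set (\<phi> ` U)) (\<phi> \<circ> F)"
      using submanifold_atlas_homeomorphic_map[OF coset_chart_pullback[OF c]] chart_image[OF U(4), of \<phi>] by simp
    moreover have "homeomorphic_map (subtopology GH U) (subtopology (top_of_set C) ?W) F'"
      using F' homeomorphic_maps_map by blast
    ultimately have "homeomorphic_map (subtopology GH U) (top_of_set (\<phi> ` U)) (\<phi> \<circ> F \<circ> F')"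
      using homeomorphic_map_compose by blast
    then show "homeomorphic_map (subtopology GH U) (top_of_set (\<phi> ` U)) \<phi>"
      by (rule homeomorphic_map_eq) (use F' in \<open>simp add: homeomorphic_maps_def\<close>)
  qed
  show "topspace GH = (\<Union>(U, \<phi>)\<in>atlas_GH. U)"
  proof (intro set_eqI iffI)
    fix x assume "x \<in> topspace GH"
    then obtain a where a: "a \<in> G" "x = left_coset H a" using topspace_GH by auto
    obtain W \<psi> where W: "(W, \<psi>) \<in> atlas_C" "\<rho> a \<in> W" using atlas_C_covers[of "\<rho> a"] a(1) by auto
    then have "x \<in> F ` W" using F_\<rho>[OF a(1)] a(2) by (metis imageI)
    with coset_chart_pushforward[OF W(1)] show "x \<in> (\<Union>(U, \<phi>)\<in>atlas_GH. U)" by blast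
  next
    fix x assume "x \<in> (\<Union>(U, \<phi>)\<in>atlas_GH. U)"
    then show "x \<in> topspace GH" using U(4) topspace_GH by fastforce
  qed
  show "\<forall>(U, \<phi>)\<in>atlas_GH. \<forall>(V, \<psi>)\<in>atlas_GH. smooth_on (\<phi> ` (U \<inter> V)) (\<psi> \<circ> inv_into U \<phi>)"
  proof (intro ballI, clarify)
    fix U \<phi> V \<psi> assume c: "(U, \<phi>) \<in> atlas_GH" "(V, \<psi>) \<in> atlas_GH"
    note U = U[OF c(1)] and V = U[OF c(2)]
    have s: "smooth_on (\<phi> ` {x\<in>U. inv_into C F x \<in> C \<inter> F -` V}) (\<psi> \<circ> F \<circ> inv_into C F \<circ> inv_into U \<phi>)"
      using coset_transition(2)[OF c(1) coset_chart_pullback[OF c(2)]] .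
    have fi: "inv_into C F x \<in> C" "F (inv_into C F x) = x" if "x \<in> U" for x
      using that U(4) bij_F unfolding bij_betw_def by (metis inv_into_into subsetD, metis f_inv_into_f subsetD)
    have "{x\<in>U. inv_into C F x \<in> C \<inter> F -` V} = U \<inter> V"
      by (intro set_eqI) (metis (no_types, lifting) Int_iff fi mem_Collect_eq vimage_eq)
    with s have "smooth_on (\<phi> ` (U \<inter> V)) (\<psi> \<circ> F \<circ> inv_into C F \<circ> inv_into U \<phi>)" by simp
    moreover have "open (\<phi> ` (U \<inter> V))"
    proof -
      have "open ((\<phi> \<circ> F) ` ((C \<inter> F -` U) \<inter> (C \<inter> F -` V)))"
        by (rule submanifold_atlas_open_image[OF coset_chart_pullback[OF c(1)] open_F_vimage[OF V(1)]])
      moreover have "F ` ((C \<inter> F -` U) \<inter> (C \<inter> F -` V)) = U \<inter> V"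
      proof (intro set_eqI iffI)
        fix x assume x: "x \<in> U \<inter> V"
        then show "x \<in> F ` ((C \<inter> F -` U) \<inter> (C \<inter> F -` V))"
          using fi[of x] by (intro image_eqI[of _ F "inv_into C F x"]) auto
      qed blast
      ultimately show ?thesis by (metis image_comp)
    qed
    ultimately show "smooth_on (\<phi> ` (U \<inter> V)) (\<psi> \<circ> inv_into U \<phi>)"
      by (rule smooth_on_cong[rotated 2, OF _ _]) (use fi U(2) in auto)
  qed
qed

lemma diffeomorphism_F: "diffeomorphism (top_of_set C) atlas_C GH atlas_GH F"
  unfolding diffeomorphism_def smooth_map_def
proof (intro conjI)
  show "bij_betw F (topspace (top_of_set C)) (topspace GH)" using bij_F topspace_GH by simp
  show "continuous_map (top_of_set C) GH F"
    using homeomorphic_map_F homeomorphic_imp_continuous_map by blast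
  show "continuous_map GH (top_of_set C) (inv_into (topspace (top_of_set C)) F)"
    unfolding continuous_map_def
  proof (intro conjI allI impI)
    show "inv_into (topspace (top_of_set C)) F \<in> topspace GH \<rightarrow> topspace (top_of_set C)"
      using topspace_GH inv_F by auto
    fix W assume W: "openin (top_of_set C) W"
    then have WC: "W \<subseteq> C" using openin_imp_subset by blast
    have "{x \<in> topspace GH. inv_into (topspace (top_of_set C)) F x \<in> W} = F ` W"
      using topspace_GH inv_F WC F_\<rho> by (auto simp: image_iff) (metis, force)
    then show "openin GH {x \<in> topspace GH. inv_into (topspace (top_of_set C)) F x \<in> W}"
      using open_F_image[OF W] by simp
  qed
  show "\<forall>(U, \<phi>)\<in>atlas_C. \<forall>(V, \<psi>)\<in>atlas_GH. smooth_on (\<phi> ` {x\<in>U. F x \<in> V}) (\<psi> \<circ> F \<circ> inv_into U \<phi>)"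
    using coset_transition(1) by fast
  show "\<forall>(U, \<phi>)\<in>atlas_GH. \<forall>(V, \<psi>)\<in>atlas_C. smooth_on (\<phi> ` {x\<in>U. inv_into (topspace (top_of_set C)) F x \<in> V})
      (\<psi> \<circ> inv_into (topspace (top_of_set C)) F \<circ> inv_into U \<phi>)"
    using coset_transition(2) by (simp add: split_beta)
qed

end

section \<open>Quaternionic coordinates\<close>

text \<open>The quaternionic structure \<open>w \<mapsto> J2 (cconj w)\<close> of \<open>W\<close>
  in the coordinates of an adapted basis.\<close>

definition jq :: "complex^4 \<Rightarrow> complex^4" where
  "jq x = (\<chi> \<alpha>. if \<alpha> = 1 then - cnj (x $ 3) else if \<alpha> = 2 then - cnj (x $ 4)
     else if \<alpha> = 3 then cnj (x $ 1) else cnj (x $ 2))"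

lemma jq_nth [simp]:
  "jq x $ 1 = - cnj (x $ 3)" "jq x $ 2 = - cnj (x $ 4)" "jq x $ 3 = cnj (x $ 1)" "jq x $ 4 = cnj (x $ 2)"
  by (simp_all add: jq_def)

lemma vec4_eq_iff: "x = (y :: 'a^4) \<longleftrightarrow> x $ 1 = y $ 1 \<and> x $ 2 = y $ 2 \<and> x $ 3 = y $ 3 \<and> x $ 4 = y $ 4"
  by (simp add: vec_eq_iff forall_4)

locale hyper_hermitian_8 =
  fixes g :: "'v::euclidean_space \<Rightarrow> 'v \<Rightarrow> real" and J1 J2 J3 :: "'v \<Rightarrow> 'v"
  assumes dim8: "DIM('v) = 8" and hh: "hyper_hermitian g J1 J2 J3"
begin

lemma g_linear [simp]:
  "g (x + y) z = g x z + g y z" "g z (x + y) = g z x + g z y"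
  "g (r *\<^sub>R x) z = r * g x z" "g z (r *\<^sub>R x) = r * g z x"
  "g (- x) z = - g x z" "g z (- x) = - g z x"
  "g (x - y) z = g x z - g y z" "g z (x - y) = g z x - g z y" "g 0 z = 0" "g z 0 = 0"
  using hh by (auto simp: hyper_hermitian_def bilinear_ladd bilinear_radd bilinear_lmul bilinear_rmul
      bilinear_lneg bilinear_rneg bilinear_lsub bilinear_rsub bilinear_lzero bilinear_rzero)

lemma g_sym: "g x y = g y x" and g_pos: "x \<noteq> 0 \<Longrightarrow> g x x > 0"
  using hh by (auto simp: hyper_hermitian_def)

lemma linear_J: "linear J1" "linear J2"
  using hh by (auto simp: hyper_hermitian_def)

lemma J_linear [simp]:
  "J1 (x + y) = J1 x + J1 y" "J1 (r *\<^sub>R x) = r *\<^sub>R J1 x" "J1 (- x) = - J1 x" "J1 (x - y) = J1 x - J1 y" "J1 0 = 0"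
  "J2 (x + y) = J2 x + J2 y" "J2 (r *\<^sub>R x) = r *\<^sub>R J2 x" "J2 (- x) = - J2 x" "J2 (x - y) = J2 x - J2 y" "J2 0 = 0"
  using linear_J by (auto simp: linear_add linear_scale linear_neg linear_diff linear_0)

lemma J3_eq: "J3 x = J1 (J2 x)"
  using hh by (simp add: hyper_hermitian_def)

lemma J_J [simp]: "J1 (J1 x) = - x" "J2 (J2 x) = - x" "J2 (J1 x) = - J1 (J2 x)"
  using hh by (simp_all add: hyper_hermitian_def)

lemma g_J [simp]: "g (J1 x) (J1 y) = g x y" "g (J2 x) (J2 y) = g x y"
  using hh by (simp_all add: hyper_hermitian_def)

lemma g_J_left: "g (J1 x) y = - g x (J1 y)" "g (J2 x) y = - g x (J2 y)"
  using g_J(1)[of x "J1 y"] g_J(2)[of x "J2 y"] by simp_all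

lemma g_J_self [simp]: "g x (J1 x) = 0" "g x (J2 x) = 0" "g x (J1 (J2 x)) = 0"
proof -
  show "g x (J1 x) = 0" "g x (J2 x) = 0"
    using g_J_left[of x x] g_sym[of x] by simp_all
  show "g x (J1 (J2 x)) = 0"
    using g_J_left(1)[of x "J2 x"] g_J_left(2)[of "J1 x" x] g_sym[of x "J1 (J2 x)"] by simp
qed

text \<open>The complex extension of \<open>g\<close> at \<open>v - i J1 v\<close> and the conjugate
  of \<open>w - i J1 w\<close>, which explains the factor 2. It is complex-linear in the first
  argument when \<open>i\<close> acts as \<open>J1\<close>.\<close>

definition herm :: "'v \<Rightarrow> 'v \<Rightarrow> complex" where
  "herm v w = Complex (2 * g v w) (2 * g v (J1 w))"

definition cs :: "complex \<Rightarrow> 'v \<Rightarrow> 'v" where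
  "cs c v = Re c *\<^sub>R v + Im c *\<^sub>R J1 v"

lemma herm_linear [simp]:
  "herm (v + w) u = herm v u + herm w u" "herm u (v + w) = herm u v + herm u w"
  "herm (r *\<^sub>R v) u = r * herm v u" "herm u (r *\<^sub>R v) = r * herm u v"
  "herm (- v) u = - herm v u" "herm u (- v) = - herm u v"
  "herm 0 u = 0" "herm u 0 = 0"
  by (simp_all add: herm_def complex_eq_iff algebra_simps)

lemma herm_J1 [simp]: "herm (J1 v) w = \<i> * herm v w" "herm v (J1 w) = - \<i> * herm v w"
  by (simp_all add: herm_def complex_eq_iff g_J_left)

lemma herm_cnj: "cnj (herm v w) = herm w v"
  by (simp add: herm_def complex_eq_iff g_sym[of v w] g_sym[of v "J1 w"] g_J_left)

lemma herm_J2: "herm (J2 v) w = - herm (J2 w) v" "herm v (J2 w) = - cnj (herm (J2 v) w)"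
proof -
  have *: "g (J2 v) (J1 w) = - g (J2 w) (J1 v)"
    using g_J_left(2)[of v "J1 w"] g_J_left(2)[of w "J1 v"] g_J_left(1)[of "J2 w" v] g_sym[of "J1 (J2 w)" v] 
    by (simp add: g_sym)
  then show "herm (J2 v) w = - herm (J2 w) v"
    by (simp add: herm_def complex_eq_iff g_J_left(2)[of v w] g_sym[of v "J2 w"])
  then show "herm v (J2 w) = - cnj (herm (J2 v) w)"
    by (simp add: herm_cnj)
qed

lemma herm_J2_J2 [simp]: "herm (J2 v) (J2 w) = cnj (herm v w)"
  using herm_J2(1)[of v "J2 w"] by (simp add: herm_cnj)

lemma herm_J2_self [simp]: "herm v (J2 v) = 0"
  by (simp add: herm_def complex_eq_iff)

lemma cs_linear:
  "cs (c + d) v = cs c v + cs d v" "cs c (v + w) = cs c v + cs c w" "cs (c * d) v = cs c (cs d v)"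
  "cs (of_real r) v = r *\<^sub>R v" "cs c (r *\<^sub>R v) = r *\<^sub>R cs c v" "cs (r *\<^sub>R c) v = r *\<^sub>R cs c v"
  "cs 0 v = 0" "cs 1 v = v" "cs \<i> v = J1 v" "cs (- c) v = - cs c v" "cs c (- v) = - cs c v"
  by (simp_all add: cs_def algebra_simps)

lemma herm_cs [simp]: "herm (cs c v) w = c * herm v w" "herm v (cs c w) = cnj c * herm v w"
  by (simp_all add: cs_def complex_eq_iff algebra_simps)

lemma J_cs: "J1 (cs c v) = cs (\<i> * c) v" "J2 (cs c v) = cs (cnj c) (J2 v)"
  by (simp_all add: cs_def algebra_simps)

definition bas :: "'v \<times> 'v \<Rightarrow> 4 \<Rightarrow> 'v" where
  "bas p \<alpha> = (if \<alpha> = 1 then fst p else if \<alpha> = 2 then snd p else if \<alpha> = 3 then J2 (fst p) else J2 (snd p))"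

lemma bas_simps [simp]:
  "bas p 1 = fst p" "bas p 2 = snd p" "bas p 3 = J2 (fst p)" "bas p 4 = J2 (snd p)"
  by (simp_all add: bas_def)

definition crd :: "'v \<times> 'v \<Rightarrow> 'v \<Rightarrow> complex^4" where
  "crd p v = (\<chi> \<alpha>. herm v (bas p \<alpha>))"

text \<open>For a frame this is inverse to \<open>crd\<close>. It makes sense for every pair
  \<open>q\<close> and is linear in it, so that frames can vary inside the vector space of all
  pairs.\<close>

definition mk :: "'v \<times> 'v \<Rightarrow> complex^4 \<Rightarrow> 'v" where
  "mk q x = (\<Sum>\<alpha>\<in>UNIV. cs (x $ \<alpha>) (bas q \<alpha>))"

lemma mk_eq: "mk q x = cs (x $ 1) (fst q) + cs (x $ 2) (snd q) + cs (x $ 3) (J2 (fst q)) + cs (x $ 4) (J2 (snd q))"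
  by (simp add: mk_def sum_4)

text \<open>\<open>J2\<close> supplies the other two vectors, so these conditions, six real
  equations in all, make \<open>bas p\<close> unitary.\<close>

definition frame :: "'v \<times> 'v \<Rightarrow> bool" where
  "frame p \<longleftrightarrow> herm (fst p) (fst p) = 1 \<and> herm (snd p) (snd p) = 1 \<and>
     herm (fst p) (snd p) = 0 \<and> herm (fst p) (J2 (snd p)) = 0"

lemma frame_herm:
  assumes "frame p" shows "herm (bas p \<alpha>) (bas p \<beta>) = (if \<alpha> = \<beta> then 1 else 0)"
proof -
  obtain a b where p: "p = (a, b)" by (cases p)
  have 1: "herm a a = 1" "herm b b = 1" "herm a b = 0" "herm a (J2 b) = 0"
    using assms by (auto simp: frame_def p)
  have 2: "herm b a = 0" "herm (J2 b) a = 0"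
    using herm_cnj[of a b] herm_cnj[of a "J2 b"] 1 by auto
  have 3: "herm (J2 a) b = 0" "herm b (J2 a) = 0" "herm (J2 a) a = 0" "herm (J2 b) b = 0"
    using herm_J2(1)[of a b] herm_J2(2)[of b a] 2 herm_J2(1)[of a a] herm_J2(1)[of b b] by auto
  show ?thesis
    using exhaust_4[of \<alpha>] exhaust_4[of \<beta>] 1 2 3 by (auto simp: p)
qed

lemma crd_linear: "linear (crd p)"
  by (rule linearI) (simp_all add: crd_def vec_eq_iff scaleR_conv_of_real[where 'a=complex])

lemma crd_simps [simp]:
  "crd p (v + w) = crd p v + crd p w" "crd p (r *\<^sub>R v) = r *\<^sub>R crd p v" "crd p (- v) = - crd p v"
  "crd p (v - w) = crd p v - crd p w"
  using crd_linear[of p] by (auto simp: linear_add linear_scale linear_neg linear_diff)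

lemma crd_cs: "crd p (cs c v) = c *s crd p v"
  by (simp add: crd_def vec_eq_iff)

lemma crd_J1: "crd p (J1 v) = \<i> *s crd p v"
  by (simp add: crd_def vec_eq_iff)

lemma crd_J2: "crd p (J2 v) = jq (crd p v)"
  by (simp add: vec4_eq_iff crd_def herm_J2(2)[of v])

lemma mk_linear: "linear (mk p)"
  by (rule linearI) (simp_all add: mk_def cs_linear scaleR_sum_right sum.distrib)

lemma mk_add: "mk p (x + y) = mk p x + mk p y" and mk_smult: "mk p (c *s x) = cs c (mk p x)"
  by (simp_all add: mk_eq cs_linear algebra_simps)

lemma mk_jq: "mk q (jq x) = J2 (mk q x)"
  by (simp add: mk_eq J_cs cs_linear algebra_simps)

lemma crd_mk:
  assumes "frame p" shows "crd p (mk p x) = x"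
proof -
  have "herm (mk p x) (bas p \<beta>) = x $ \<beta>" for \<beta>
  proof -
    have "herm (mk p x) w = (\<Sum>\<alpha>\<in>UNIV. x $ \<alpha> * herm (bas p \<alpha>) w)" for w
      by (simp add: mk_eq sum_4)
    then have "herm (mk p x) (bas p \<beta>) = (\<Sum>\<alpha>\<in>UNIV. x $ \<alpha> * (if \<alpha> = \<beta> then 1 else 0))"
      by (simp only: frame_herm[OF assms])
    also have "\<dots> = (\<Sum>\<alpha>\<in>UNIV. if \<alpha> = \<beta> then x $ \<alpha> else 0)"
      by (rule sum.cong) auto
    finally show ?thesis by simp
  qed
  then show ?thesis by (simp add: crd_def vec_eq_iff)
qed

text \<open>Here the dimension enters: \<open>mk p\<close> embeds the real 8-dimensional
  \<open>complex^4\<close> into \<open>V\<close>, hence is onto.\<close>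

lemma mk_crd:
  assumes "frame p" shows "mk p (crd p v) = v"
proof -
  have "inj (mk p)" using crd_mk[OF assms] by (metis injI)
  then have "dim (range (mk p)) = dim (UNIV :: (complex^4) set)"
    using dim_image_eq[OF mk_linear, of p UNIV] by (metis inj_on_subset subset_UNIV)
  then have "dim (range (mk p)) = DIM('v)" by (simp add: dim8)
  then have "span (range (mk p)) = UNIV" using dim_eq_full by blast
  moreover have "span (range (mk p)) = range (mk p)"
    by (meson linear_subspace_image mk_linear span_eq_iff subspace_UNIV)
  ultimately obtain x where "v = mk p x" by (metis UNIV_I imageE)
  then show ?thesis using crd_mk[OF assms] by simp
qed

lemma crd_inj: "frame p \<Longrightarrow> crd p v = crd p w \<longleftrightarrow> v = w"
  by (metis mk_crd)

lemma crd_bas: "frame p \<Longrightarrow> crd p (bas p \<alpha>) = axis \<alpha> 1"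
  by (simp add: crd_def vec_eq_iff axis_def frame_herm)

lemma herm_crd:
  assumes "frame p" shows "herm v w = (\<Sum>\<alpha>\<in>UNIV. crd p v $ \<alpha> * cnj (crd p w $ \<alpha>))"
proof -
  have "herm v w = herm (mk p (crd p v)) w" by (simp add: mk_crd[OF assms])
  also have "\<dots> = (\<Sum>\<alpha>\<in>UNIV. crd p v $ \<alpha> * herm (bas p \<alpha>) w)" by (simp add: mk_eq sum_4)
  finally show ?thesis by (simp add: crd_def herm_cnj)
qed

text \<open>Gram-Schmidt over the quaternions: the quaternionic line of a unit vector has real
  dimension at most 4, and a vector outside it is projected to the orthogonal complement and
  scaled.\<close>

lemma frame_exists: obtains p where "frame p"
proof -
  obtain v0 :: 'v where v0: "v0 \<noteq> 0" using dim8 by (metis DIM_positive nonempty_Basis ex_in_conv nonzero_Basis)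
  have unit: "\<exists>r. herm (r *\<^sub>R v) (r *\<^sub>R v) = 1" if "v \<noteq> 0" for v
    by (rule exI[of _ "1 / sqrt (2 * g v v)"]) (use g_pos[OF that] in \<open>simp add: herm_def complex_eq_iff field_simps\<close>)
  obtain a where a: "herm a a = 1" using unit[OF v0] by blast
  let ?S = "{a, J1 a, J2 a, J1 (J2 a)}"
  have "dim (span ?S) \<le> card ?S" by (simp add: dim_le_card')
  also have "\<dots> \<le> 4" by (simp add: card_insert_le_m1)
  finally have "dim (span ?S) \<noteq> dim (UNIV :: 'v set)" using dim8 by simp
  then have "span ?S \<noteq> UNIV" by metis
  then obtain u where u: "u \<notin> span ?S" by blast
  define w where "w = u - cs (herm u a) a - cs (herm u (J2 a)) (J2 a)"
  have w: "herm w a = 0" "herm w (J2 a) = 0"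
    using a herm_J2(1)[of a a] herm_linear by (simp_all add: w_def diff_conv_add_uminus del: add_uminus_conv_diff)
  have "w \<noteq> 0"
  proof
    assume "w = 0"
    then have "u = cs (herm u a) a + cs (herm u (J2 a)) (J2 a)" by (simp add: w_def algebra_simps)
    also have "\<dots> \<in> span ?S" unfolding cs_def
      by (intro span_add span_scale span_base) auto
    finally show False using u by simp
  qed
  then obtain r where r: "herm (r *\<^sub>R w) (r *\<^sub>R w) = 1" using unit by blast
  have "herm a w = 0" "herm a (J2 w) = 0"
    using herm_cnj[of w a] w herm_J2(2)[of a w] herm_cnj[of w "J2 a"] by auto
  then have "frame (a, r *\<^sub>R w)" unfolding frame_def using a r by simp
  then show ?thesis using that by blast
qed

section \<open>The group \<open>Sp(2)\<close> and adapted bases\<close>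

abbreviation "G \<equiv> Sp2 g J1 J2 J3"

lemma Sp2_commute:
  assumes "a \<in> G"
  shows "a (J1 v) = J1 (a v)" "a (J2 v) = J2 (a v)" "a (J3 v) = J3 (a v)" "herm (a v) (a w) = herm v w"
    "a (cs c v) = cs c (a v)" "bij (blinfun_apply a)" "g (a v) (a w) = g v w"
proof -
  note a = assms[unfolded Sp2_def, simplified]
  show a1: "a (J1 v) = J1 (a v)" "a (J2 v) = J2 (a v)" "a (J3 v) = J3 (a v)" "bij (blinfun_apply a)"
    and ag: "g (a v) (a w) = g v w" for v w
    using a by auto
  show "herm (a v) (a w) = herm v w" "a (cs c v) = cs c (a v)"
    by (simp_all add: herm_def cs_def blinfun.add_right blinfun.scaleR_right ag flip: a1(1))
qed

lemma bas_Sp2: "a \<in> G \<Longrightarrow> bas (a (fst p), a (snd p)) \<alpha> = a (bas p \<alpha>)"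
  using exhaust_4[of \<alpha>] by (auto simp: Sp2_commute)

lemma frame_Sp2: "a \<in> G \<Longrightarrow> frame p \<Longrightarrow> frame (a (fst p), a (snd p))"
  unfolding frame_def by (simp add: Sp2_commute flip: Sp2_commute(2))

lemma crd_Sp2: "a \<in> G \<Longrightarrow> crd (a (fst p), a (snd p)) (a v) = crd p v"
  by (simp add: crd_def bas_Sp2 Sp2_commute)

lemma Sp2_eq_mk: "a \<in> G \<Longrightarrow> frame p \<Longrightarrow> a v = mk (a (fst p), a (snd p)) (crd p v)"
  by (metis crd_Sp2 frame_Sp2 mk_crd)

text \<open>For frames \<open>p\<close> and \<open>q\<close> this is the unique element of Sp(2)
  taking \<open>p\<close> to \<open>q\<close>. For arbitrary \<open>q\<close> it is still
  quaternion-linear, so the pairs \<open>q\<close> parametrise the 16-dimensional space in which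
  Sp(2) lies.\<close>

definition change :: "'v \<times> 'v \<Rightarrow> 'v \<times> 'v \<Rightarrow> 'v \<Rightarrow>\<^sub>L 'v" where
  "change p q = Blinfun (\<lambda>v. mk q (crd p v))"

lemma change_apply: "change p q v = mk q (crd p v)"
proof -
  have "linear (\<lambda>v. mk q (crd p v))"
    using linear_compose[OF crd_linear[of p] mk_linear[of q]] by (simp add: o_def)
  then show ?thesis
    unfolding change_def by (simp add: bounded_linear_Blinfun_apply linear_conv_bounded_linear)
qed

lemma change_frame: "frame p \<Longrightarrow> change p q (fst p) = fst q" "frame p \<Longrightarrow> change p q (snd p) = snd q"
  using crd_bas[of p 1] crd_bas[of p 2] by (simp_all add: change_apply mk_eq axis_def cs_linear)

lemma change_in_Sp2:
  assumes "frame p" "frame q" shows "change p q \<in> G"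
proof -
  have c: "change p q (J1 v) = J1 (change p q v)" "change p q (J2 v) = J2 (change p q v)" for v
    by (simp_all add: change_apply crd_J1 mk_smult cs_linear crd_J2 mk_jq)
  have "herm (change p q v) (change p q w) = herm v w" for v w
    unfolding herm_crd[OF assms(2), of "change p q v"] herm_crd[OF assms(1), of v]
    by (simp add: change_apply crd_mk[OF assms(2)])
  then have "g (change p q v) (change p q w) = g v w" for v w
    by (simp add: herm_def)
  moreover have "bij (blinfun_apply (change p q))"
    by (rule o_bij[of "\<lambda>v. mk p (crd q v)"])
      (auto simp: change_apply fun_eq_iff crd_mk mk_crd assms)
  ultimately show ?thesis using c by (simp add: Sp2_def J3_eq)
qed

lemma Sp2_eq_change: "a \<in> G \<Longrightarrow> frame p \<Longrightarrow> a = change p (a (fst p), a (snd p))"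
  by (rule blinfun_eqI) (metis Sp2_eq_mk change_apply)

text \<open>The adjoint in terms of the frame, hence the inverse on Sp(2). Unlike the inverse, this
  formula is defined and smooth on all operators.\<close>

definition adj :: "'v \<times> 'v \<Rightarrow> ('v \<Rightarrow>\<^sub>L 'v) \<Rightarrow> 'v \<Rightarrow>\<^sub>L 'v" where
  "adj p a = Blinfun (\<lambda>v. mk p (\<chi> \<alpha>. herm v (a (bas p \<alpha>))))"

lemma adj_apply: "adj p a v = mk p (\<chi> \<alpha>. herm v (a (bas p \<alpha>)))"
proof -
  have "linear (\<lambda>v. mk p (\<chi> \<alpha>. herm v (a (bas p \<alpha>))))"
    by (rule linearI) (simp_all add: mk_eq cs_linear algebra_simps scaleR_conv_of_real[symmetric])
  then show ?thesis
    unfolding adj_def by (simp add: bounded_linear_Blinfun_apply linear_conv_bounded_linear)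
qed

lemma adj_left: "a \<in> G \<Longrightarrow> frame p \<Longrightarrow> adj p a (a v) = v"
proof -
  assume a: "a \<in> G" "frame p"
  have "(\<chi> \<alpha>. herm (a v) (a (bas p \<alpha>))) = crd p v" by (simp add: crd_def Sp2_commute[OF a(1)])
  then show ?thesis by (simp add: adj_apply mk_crd[OF a(2)])
qed

lemma adj_right: "a \<in> G \<Longrightarrow> frame p \<Longrightarrow> a (adj p a v) = v"
  using adj_left[of a p] Sp2_commute(6)[of a] by (metis bij_pointE)

lemma Sp2_compose: "a \<in> G \<Longrightarrow> b \<in> G \<Longrightarrow> a o\<^sub>L b \<in> G"
  using bij_comp[of "blinfun_apply b" "blinfun_apply a"] by (auto simp: Sp2_def o_def blinfun_compose.rep_eq)

lemma id_in_Sp2: "id_blinfun \<in> G"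
  by (auto simp: Sp2_def simp flip: id_def)

lemma Sp2_adj: 
  assumes "a \<in> G" "frame p" shows "adj p a \<in> G"
proof -
  have inv: "adj p a = b \<longleftrightarrow> (\<forall>v. b (a v) = v)" for b
    using adj_left[OF assms] adj_right[OF assms] by (metis blinfun_eqI)
  have J: "adj p a (J v) = J (adj p a v)" if "J \<in> {J1, J2, J3}" for J v
    using that adj_left[OF assms, of "J (adj p a v)"] adj_right[OF assms, of v] Sp2_commute[OF assms(1)] by auto
  have "g (adj p a v) (adj p a w) = g v w" for v w
    using Sp2_commute(7)[OF assms(1), of "adj p a v" "adj p a w"] adj_right[OF assms] by simp
  moreover have "bij (blinfun_apply (adj p a))"
    by (rule o_bij[of "blinfun_apply a"]) (auto simp: fun_eq_iff adj_left[OF assms] adj_right[OF assms])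
  ultimately show ?thesis using J by (auto simp: Sp2_def)
qed

text \<open>The vector \<open>v - i J1 v\<close>. It gives a complex-linear isomorphism onto
  \<open>W\<close> from \<open>V\<close> with the complex structure \<open>J1\<close> and turns
  \<open>J2\<close> into \<open>w \<mapsto> J2 (cconj w)\<close>, so that everything about
  \<open>W\<close> can be done in \<open>V\<close>.\<close>

definition hat :: "'v \<Rightarrow> 'v cplx" where "hat v = (v, - J1 v)"

lemma hat_simps: "hat (v + w) = hat v + hat w" "cscale c (hat v) = hat (cs c v)"
  "cmap J2 (cconj (hat v)) = hat (J2 v)" "fst (hat v) = v" "hat v = hat w \<longleftrightarrow> v = w"
  by (auto simp: hat_def cscale_def cs_def cmap_def cconj_def algebra_simps)

lemma W_space_iff: "z \<in> W_space J1 \<longleftrightarrow> z = hat (fst z)"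
  by (cases z) (auto simp: W_space_def hat_def cmap_def cscale_def)

lemma hat_in_W: "hat v \<in> W_space J1"
  by (simp add: W_space_iff hat_simps)

lemma sum_hat: "(\<Sum>\<alpha>\<in>UNIV. cscale (x $ \<alpha>) (hat (bas p \<alpha>))) = hat (mk p x)"
  by (simp add: sum_4 mk_eq hat_simps)

lemma pi_form_hat: "pi_form g J2 (hat v) (hat w) = - herm v (J2 w)"
  by (simp add: pi_form_def hat_def cmap_def cform2_def cform_def herm_def complex_eq_iff g_J_left)

lemma adapted_basis_frame:
  assumes "frame p" shows "adapted_basis g J1 J2 (\<lambda>\<alpha>. hat (bas p \<alpha>))"
  unfolding adapted_basis_def sum_hat pi_form_hat
proof (intro conjI allI ballI)
  show "hat (bas p \<alpha>) \<in> W_space J1" for \<alpha> by (rule hat_in_W)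
  show "\<exists>!x. w = hat (mk p x)" if "w \<in> W_space J1" for w
    using that W_space_iff[of w] hat_simps(5) crd_mk[OF assms] mk_crd[OF assms] by metis
  show "hat (bas p 3) = cmap J2 (cconj (hat (bas p 1)))" "hat (bas p 4) = cmap J2 (cconj (hat (bas p 2)))"
    by (simp_all add: hat_simps)
  show "- herm (mk p x) (J2 (mk p y)) = (x $ 1 * y $ 3 - y $ 1 * x $ 3) + (x $ 2 * y $ 4 - y $ 2 * x $ 4)" for x y
    by (simp add: herm_crd[OF assms] crd_J2 crd_mk[OF assms] sum_4 algebra_simps)
qed

lemma adapted_basis_imp:
  assumes "adapted_basis g J1 J2 e"
  obtains p where "frame p" "e = (\<lambda>\<alpha>. hat (bas p \<alpha>))"
proof -
  note e = assms[unfolded adapted_basis_def]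
  define p where "p = (fst (e 1), fst (e 2))"
  have eh: "e \<alpha> = hat (fst (e \<alpha>))" for \<alpha> using e W_space_iff by blast
  have ep: "e \<alpha> = hat (bas p \<alpha>)" for \<alpha>
  proof -
    have "e 1 = hat (bas p 1)" "e 2 = hat (bas p 2)" using eh by (auto simp: p_def)
    moreover have "e 3 = hat (bas p 3)" "e 4 = hat (bas p 4)"
      using e calculation by (auto simp: hat_simps)
    ultimately show ?thesis using exhaust_4[of \<alpha>] by auto
  qed
  have pf: "- herm (mk p x) (J2 (mk p y)) = (x $ 1 * y $ 3 - y $ 1 * x $ 3) + (x $ 2 * y $ 4 - y $ 2 * x $ 4)" for x y
    using e by (simp add: ep sum_hat pi_form_hat)
  have ax: "mk p (axis \<alpha> 1) = bas p \<alpha>" for \<alpha>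
    using exhaust_4[of \<alpha>] by (auto simp: mk_eq axis_def cs_linear)
  have "frame p"
    unfolding frame_def
    \<comment> \<open>The pairings of \<open>e 1\<close> with \<open>e 3\<close>,
      \<open>e 4\<close>, \<open>e 2\<close> and of \<open>e 2\<close> with \<open>e 4\<close> are,
      up to sign and \<open>J2 (J2 v) = - v\<close>, the four products in
      \<open>frame\<close>.\<close>
    using pf[of "axis 1 1" "axis 3 1"] pf[of "axis 2 1" "axis 4 1"] pf[of "axis 1 1" "axis 4 1"] pf[of "axis 1 1" "axis 2 1"]
    by (simp add: ax) (simp add: axis_def)
  then show ?thesis using that ep by blast
qed

end

section \<open>The quartic and its polarisation\<close>

text \<open>The sum over all 24 ways to distribute the indices over the arguments, which is 24 times
  the polarisation of a monomial. Written out, its symmetries are ring identities.\<close>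

definition perm4 :: "4 \<Rightarrow> 4 \<Rightarrow> 4 \<Rightarrow> 4 \<Rightarrow> complex^4 \<Rightarrow> complex^4 \<Rightarrow> complex^4 \<Rightarrow> complex^4 \<Rightarrow> complex" where
  "perm4 i j k l x y z w =
     x $ i * (y $ j * (z $ k * w $ l + z $ l * w $ k) + y $ k * (z $ j * w $ l + z $ l * w $ j) + y $ l * (z $ j * w $ k + z $ k * w $ j)) +
     x $ j * (y $ i * (z $ k * w $ l + z $ l * w $ k) + y $ k * (z $ i * w $ l + z $ l * w $ i) + y $ l * (z $ i * w $ k + z $ k * w $ i)) +
     x $ k * (y $ j * (z $ i * w $ l + z $ l * w $ i) + y $ i * (z $ j * w $ l + z $ l * w $ j) + y $ l * (z $ j * w $ i + z $ i * w $ j)) +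
     x $ l * (y $ j * (z $ k * w $ i + z $ i * w $ k) + y $ k * (z $ j * w $ i + z $ i * w $ j) + y $ i * (z $ j * w $ k + z $ k * w $ j))"

lemma perm4_sym:
  "perm4 i j k l x y z w = perm4 i j k l y x z w"
  "perm4 i j k l x y z w = perm4 i j k l x z y w"
  "perm4 i j k l x y z w = perm4 i j k l x y w z"
  by (simp_all add: perm4_def algebra_simps)

definition quartic :: "complex^4 \<Rightarrow> complex" where
  "quartic x = - 18 * x $ 1 * x $ 2 * x $ 3 * x $ 4
            + 4 * complex_of_real (sqrt 3) * x $ 1 * (x $ 4) ^ 3
            - 4 * complex_of_real (sqrt 3) * (x $ 2) ^ 3 * x $ 3
            + 3 * (x $ 2)\<^sup>2 * (x $ 4)\<^sup>2 - 9 * (x $ 1)\<^sup>2 * (x $ 3)\<^sup>2"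

definition qpol :: "complex^4 \<Rightarrow> complex^4 \<Rightarrow> complex^4 \<Rightarrow> complex^4 \<Rightarrow> complex" where
  "qpol x y z w = (- 18 * perm4 1 2 3 4 x y z w
     + 4 * complex_of_real (sqrt 3) * perm4 1 4 4 4 x y z w
     - 4 * complex_of_real (sqrt 3) * perm4 2 2 2 3 x y z w
     + 3 * perm4 2 2 4 4 x y z w - 9 * perm4 1 1 3 3 x y z w) / 24"

lemma qpol_sym:
  "qpol x y z w = qpol y x z w" "qpol x y z w = qpol x z y w" "qpol x y z w = qpol x y w z"
proof -
  show "qpol x y z w = qpol y x z w" unfolding qpol_def by (simp only: perm4_sym(1)[of _ _ _ _ x y])
  show "qpol x y z w = qpol x z y w" unfolding qpol_def by (simp only: perm4_sym(2)[of _ _ _ _ x y z])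
  show "qpol x y z w = qpol x y w z" unfolding qpol_def by (simp only: perm4_sym(3)[of _ _ _ _ x y z w])
qed

lemma qpol_diag: "qpol x x x x = quartic x"
proof -
  have "perm4 i j k l x x x x = 24 * (x $ i * x $ j * x $ k * x $ l)" for i j k l
    by (simp add: perm4_def algebra_simps)
  then show ?thesis
    by (simp add: qpol_def quartic_def power2_eq_square power3_eq_cube field_simps)
qed

lemma qpol_add: "qpol (x + x') y z w = qpol x y z w + qpol x' y z w"
  by (simp add: qpol_def perm4_def algebra_simps add_divide_distrib diff_divide_distrib)

lemma qpol_smult: "qpol (c *s x) y z w = c * qpol x y z w"
  by (simp add: qpol_def perm4_def algebra_simps add_divide_distrib diff_divide_distrib)

text \<open>\<open>jq\<close> exchanges the two monomials with factor sqrt 3, whose opposite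
  coefficients absorb the sign, and fixes the other three up to conjugation. This reality condition
  is what lets the quartic come from a real tensor.\<close>

lemma qpol_jq: "qpol (jq x) (jq y) (jq z) (jq w) = cnj (qpol x y z w)"
proof -
  have p: "perm4 1 2 3 4 (jq x) (jq y) (jq z) (jq w) = cnj (perm4 1 2 3 4 x y z w)"
    "perm4 1 4 4 4 (jq x) (jq y) (jq z) (jq w) = - cnj (perm4 2 2 2 3 x y z w)"
    "perm4 2 2 2 3 (jq x) (jq y) (jq z) (jq w) = - cnj (perm4 1 4 4 4 x y z w)"
    "perm4 2 2 4 4 (jq x) (jq y) (jq z) (jq w) = cnj (perm4 2 2 4 4 x y z w)"
    "perm4 1 1 3 3 (jq x) (jq y) (jq z) (jq w) = cnj (perm4 1 1 3 3 x y z w)"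
    by (simp_all add: perm4_def algebra_simps)
  show ?thesis by (simp add: qpol_def p algebra_simps)
qed

section \<open>Tensors and curvature\<close>

lemma linear_Blinfun_apply:
  fixes f :: "'a::euclidean_space \<Rightarrow> 'b::real_normed_vector"
  assumes "linear f" shows "blinfun_apply (Blinfun f) = f"
  using assms by (simp add: bounded_linear_Blinfun_apply linear_conv_bounded_linear)

definition mk_tensor :: "('v \<Rightarrow> 'v \<Rightarrow> 'v \<Rightarrow> 'v \<Rightarrow> real) \<Rightarrow> 'v::euclidean_space tensor4" where
  "mk_tensor F = Blinfun (\<lambda>x. Blinfun (\<lambda>y. Blinfun (\<lambda>z. Blinfun (F x y z))))"

lemma mk_tensor_apply:
  assumes "\<And>y z w. linear (\<lambda>x. F x y z w)" "\<And>x z w. linear (\<lambda>y. F x y z w)"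
    "\<And>x y w. linear (\<lambda>z. F x y z w)" "\<And>x y z. linear (\<lambda>w. F x y z w)"
  shows "mk_tensor F x y z w = F x y z w"
proof -
  have 1: "blinfun_apply (Blinfun (F x y z)) = F x y z" for x y z
    by (rule linear_Blinfun_apply) (rule assms(4))
  have 2: "blinfun_apply (Blinfun (\<lambda>z. Blinfun (F x y z))) = (\<lambda>z. Blinfun (F x y z))" for x y
    by (rule linear_Blinfun_apply, rule linearI; rule blinfun_eqI)
      (simp_all add: 1 blinfun.add_left blinfun.scaleR_left linear_add[OF assms(3)] linear_scale[OF assms(3)])
  have 3: "blinfun_apply (Blinfun (\<lambda>y. Blinfun (\<lambda>z. Blinfun (F x y z)))) = (\<lambda>y. Blinfun (\<lambda>z. Blinfun (F x y z)))" for x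
    by (rule linear_Blinfun_apply, rule linearI; rule blinfun_eqI; rule blinfun_eqI)
      (simp_all add: 1 2 blinfun.add_left blinfun.scaleR_left linear_add[OF assms(2)] linear_scale[OF assms(2)])
  have 4: "blinfun_apply (mk_tensor F) = (\<lambda>x. Blinfun (\<lambda>y. Blinfun (\<lambda>z. Blinfun (F x y z))))"
    unfolding mk_tensor_def
    by (rule linear_Blinfun_apply, rule linearI; rule blinfun_eqI; rule blinfun_eqI; rule blinfun_eqI)
      (simp_all add: 1 2 3 blinfun.add_left blinfun.scaleR_left linear_add[OF assms(1)] linear_scale[OF assms(1)])
  show ?thesis by (simp add: 1 2 3 4)
qed

lemma tensor4_eqI:
  fixes K K' :: "'v::real_normed_vector tensor4"
  shows "(\<And>x y z w. K x y z w = K' x y z w) \<Longrightarrow> K = K'"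
  by (intro blinfun_eqI)

lemmas tensor4_simps = blinfun.add_left blinfun.add_right blinfun.scaleR_left blinfun.scaleR_right
  blinfun.minus_left blinfun.minus_right blinfun.diff_left blinfun.diff_right

definition pull :: "('v \<Rightarrow>\<^sub>L 'v) \<Rightarrow> 'v tensor4 \<Rightarrow> 'v::euclidean_space tensor4" where
  "pull a K = mk_tensor (\<lambda>x y z w. K (a x) (a y) (a z) (a w))"

lemma pull_apply: "pull a K x y z w = K (a x) (a y) (a z) (a w)"
  unfolding pull_def by (rule mk_tensor_apply; rule linearI) (simp_all add: tensor4_simps)

text \<open>The diagonal values at \<open>v + u\<close>, \<open>v + 2u\<close> and
  \<open>v + 3u\<close> form an invertible system for the mixed ones; the same device then separates
  the remaining arguments. As additivity is all that is assumed, multiples are repeated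
  sums.\<close>

lemma polarization4:
  fixes T :: "'v::real_vector \<Rightarrow> 'v \<Rightarrow> 'v \<Rightarrow> 'v \<Rightarrow> complex"
  assumes add: "\<And>x x' y z w. T (x + x') y z w = T x y z w + T x' y z w"
    and sym: "\<And>x y z w. T x y z w = T y x z w" "\<And>x y z w. T x y z w = T x z y w" "\<And>x y z w. T x y z w = T x y w z"
    and diag: "\<And>v. T v v v v = 0"
  shows "T x y z w = 0"
proof -
  have add2: "T x (y + y') z w = T x y z w + T x y' z w" for x y y' z w
    by (metis sym(1) add)
  have add3: "T x y (z + z') w = T x y z w + T x y z' w" for x y z z' w
    by (metis sym(2) add2)
  have add4: "T x y z (w + w') = T x y z w + T x y z w'" for x y z w w'
    by (metis sym(3) add3)
  note adds = add add2 add3 add4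
  have 1: "T v v v u = 0" for v u
  proof -
    let ?a = "T v v v u" and ?b = "T v v u u" and ?c = "T v u u u"
    have sc: "T u v v v = ?a" "T v u v v = ?a" "T v v u v = ?a" "T u v u u = ?c" "T u u v u = ?c" "T u u u v = ?c"
      "T u v u v = ?b" "T u v v u = ?b" "T v u u v = ?b" "T v u v u = ?b" "T u u v v = ?b"
      by (metis sym)+
    have e1: "4 * ?a + 6 * ?b + 4 * ?c = 0"
      using diag[of "v + u"] by (simp add: adds diag[of v] diag[of u] sc add_ac)
    have e2: "8 * ?a + 24 * ?b + 32 * ?c = 0"
      using diag[of "v + (u + u)"] by (simp add: adds diag[of v] diag[of u] sc add_ac)
    have e3: "12 * ?a + 54 * ?b + 108 * ?c = 0"
      using diag[of "v + (u + (u + u))"] by (simp add: adds diag[of v] diag[of u] sc add_ac)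
    have "1152 * ?a = 864 * (4 * ?a + 6 * ?b + 4 * ?c) - 432 * (8 * ?a + 24 * ?b + 32 * ?c) + 96 * (12 * ?a + 54 * ?b + 108 * ?c)"
      by (simp add: algebra_simps)
    then show ?thesis by (simp only: e1 e2 e3) simp
  qed
  have 2: "T v v u w = 0" for v u w
  proof -
    let ?a = "T v v u w" and ?b = "T v u u w"
    have sc: "T v u v w = ?a" "T u v v w = ?a" "T u v u w = ?b" "T u u v w = ?b" by (metis sym)+
    have e1: "3 * ?a + 3 * ?b = 0" using 1[of "v + u" w] by (simp add: adds 1[of v] 1[of u] sc add_ac)
    have e2: "6 * ?a + 12 * ?b = 0" using 1[of "v + (u + u)" w] by (simp add: adds 1[of v] 1[of u] sc add_ac)
    have "6 * ?a = 4 * (3 * ?a + 3 * ?b) - (6 * ?a + 12 * ?b)" by (simp add: algebra_simps)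
    then show ?thesis by (simp only: e1 e2) simp
  qed
  have "T x y z w + T y x z w = 0" using 2[of "x + y" z w] by (simp add: adds 2[of x] 2[of y] add_ac)
  then show ?thesis using sym(1)[of x y z w] by simp
qed

context hyper_hermitian_8
begin

abbreviation "curv \<equiv> curvature_Sp2 J1 J2 J3"

context
  fixes K :: "'v tensor4"
  assumes K: "K \<in> curv"
begin

lemma curv_anti: "K x y z w = - K y x z w" "K x y z w = - K x y w z"
  and curv_bianchi: "K x y z w + K y z x w + K z x y w = 0"
  and curv_J34: "K x y (J1 z) (J1 w) = K x y z w" "K x y (J2 z) (J2 w) = K x y z w"
  using K unfolding curvature_Sp2_def Let_def by blast+

text \<open>Follows from the antisymmetries and the Bianchi identity at the four cyclic rotations of
  the arguments. It carries the invariance under \<open>J1\<close> and \<open>J2\<close> from the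
  last two arguments to the first two.\<close>

lemma curv_pair: "K x y z w = K z w x y"
proof -
  have "2 * K x y z w = 2 * K z w x y"
    using curv_bianchi[of x y z w] curv_bianchi[of y z w x] curv_bianchi[of z w x y] curv_bianchi[of w x y z]
      curv_anti(1)[of z x y w] curv_anti(2)[of z x w y] curv_anti(1)[of w y z x] curv_anti(2)[of y w x z]
      curv_anti(1)[of x z w y] curv_anti(2)[of x y w z] curv_anti(2)[of y z w x] curv_anti(2)[of z w x y]
      curv_anti(2)[of w x y z] curv_anti(1)[of x w y z] curv_anti(1)[of z y w x] curv_anti(1)[of y z x w]
      curv_anti(2)[of z x y w] curv_anti(2)[of y w z x] curv_anti(1)[of w y x z] curv_anti(1)[of x z y w]
      curv_anti(2)[of w y x z] curv_anti(2)[of x z y w] curv_anti(1)[of z w y x] curv_anti(1)[of z w x y] curv_anti(1)[of x y z w]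
      curv_anti(1)[of x y w z] curv_anti(2)[of y z x w] curv_anti(2)[of w x z y] curv_anti(1)[of w x z y] curv_anti(1)[of w x y z]
    by linarith
  then show ?thesis by simp
qed

lemma curv_J12: "K (J1 x) (J1 y) z w = K x y z w" "K (J2 x) (J2 y) z w = K x y z w"
  by (metis curv_pair curv_J34)+

lemma curv_J_move:
  "K (J1 x) y z w = - K x (J1 y) z w"
  "K (J2 x) y z w = - K x (J2 y) z w"
  "K x y (J1 z) w = - K x y z (J1 w)"
  "K x y (J2 z) w = - K x y z (J2 w)"
  using curv_J12(1)[of x "J1 y" z w] curv_J12(2)[of x "J2 y" z w] curv_J34(1)[of x y z "J1 w"] curv_J34(2)[of x y z "J2 w"]
  by (simp_all add: tensor4_simps)

end

text \<open>On curvature tensors, the complex extension of \<open>S\<close> at \<open>hat x\<close>,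
  \<open>hat y\<close>, \<open>hat z\<close>, \<open>hat w\<close>. There it equals \<open>K\<close>
  at \<open>hat x\<close>, \<open>J2 (hat y)\<close>, \<open>hat z\<close>,
  \<open>J2 (hat w)\<close>, and in either pair this doubles the combination
  \<open>J2 y + i J3 y\<close>; hence the factor 4.\<close>

definition curv_form :: "'v tensor4 \<Rightarrow> 'v \<Rightarrow> 'v \<Rightarrow> 'v \<Rightarrow> 'v \<Rightarrow> complex" where
  "curv_form K x y z w = Complex
     (4 * (K x (J2 y) z (J2 w) - K x (J1 (J2 y)) z (J1 (J2 w))))
     (4 * (K x (J2 y) z (J1 (J2 w)) + K x (J1 (J2 y)) z (J2 w)))"

lemma curv_form_cform4:
  assumes "K \<in> curv"
  shows "cform4 (S_tensor J2 J3 K) (hat v) (hat v) (hat v) (hat v) = curv_form K v v v v"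
  by (simp add: cform4_def cform_def S_tensor_def hat_def curv_form_def J3_eq complex_eq_iff
      tensor4_simps curv_J_move[OF assms])

lemma curv_form_add: "curv_form K (x + x') y z w = curv_form K x y z w + curv_form K x' y z w"
  by (simp add: curv_form_def complex_eq_iff tensor4_simps)

text \<open>Within a pair, symmetry results from moving \<open>J2\<close> across the antisymmetric
  arguments. The exchange of the first and third argument is the Bianchi identity, whose third term,
  with \<open>z\<close> and \<open>x\<close> in one pair, cancels in real and imaginary
  part.\<close>

lemma curv_form_sym:
  assumes K: "K \<in> curv"
  shows "curv_form K x y z w = curv_form K y x z w" "curv_form K x y z w = curv_form K x y w z"
    "curv_form K x y z w = curv_form K x z y w"
proof -
  have a: "K x (J2 y) u v = K y (J2 x) u v"
    "K x (J1 (J2 y)) u v = K y (J1 (J2 x)) u v"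
    "K u v x (J2 y) = K u v y (J2 x)"
    "K u v x (J1 (J2 y)) = K u v y (J1 (J2 x))" for x y u v
    using curv_J_move[OF K, of x] curv_J_move[OF K, of "J2 x"] curv_J_move(3,4)[OF K, of u v x] curv_J_move(3,4)[OF K, of u v "J2 x"]
      curv_anti(1)[OF K, of y "J2 x" u v] curv_anti(1)[OF K, of y "J1 (J2 x)" u v] curv_anti(2)[OF K, of u v y "J2 x"]
      curv_anti(2)[OF K, of u v y "J1 (J2 x)"]
    by (simp_all add: tensor4_simps)
  show s12: "curv_form K x y z w = curv_form K y x z w" for x y z w
    by (simp add: curv_form_def a[of x y])
  show "curv_form K x y z w = curv_form K x y w z"
    by (simp add: curv_form_def a(3,4)[where x = z and y = w])
  have b: "K x u z v - K z u x v = - K z x u v" for x u z v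
    using curv_bianchi[OF K, of x u z v] curv_anti(1)[OF K, of u z x v] by simp
  have s13: "curv_form K x y z w = curv_form K z y x w" for x y z w
    using b[of x "J2 y" z "J2 w"] b[of x "J1 (J2 y)" z "J1 (J2 w)"] b[of x "J2 y" z "J1 (J2 w)"] b[of x "J1 (J2 y)" z "J2 w"]
    by (simp add: curv_form_def complex_eq_iff curv_J34[OF K] curv_J_move(3,4)[OF K] tensor4_simps)
  show "curv_form K x y z w = curv_form K x z y w" by (metis s12 s13)
qed

text \<open>Skew-symmetrising in \<open>z\<close> and \<open>w\<close> cancels the two terms with
  \<open>J1\<close> and doubles the others; the 8 is this 2 times the 4 of \<open>curv_form\<close>.
  Read backwards, the formula defines \<open>K_of\<close>.\<close>

lemma curv_eq_form:
  assumes K: "K \<in> curv"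
  shows "K x y z w = Re (curv_form K x (J2 y) z (J2 w) - curv_form K x (J2 y) w (J2 z)) / 8"
  using curv_anti(2)[OF K, of x y w z] curv_anti(2)[OF K, of x "J1 y" w "J1 z"] curv_J_move(3)[OF K, of x "J1 y" z w]
  by (simp add: curv_form_def tensor4_simps)

lemma curv_eqI:
  assumes K: "K \<in> curv" "K' \<in> curv" and "\<And>v. curv_form K v v v v = curv_form K' v v v v"
  shows "K = K'"
proof -
  let ?T = "\<lambda>x y z w. curv_form K x y z w - curv_form K' x y z w"
  have "?T x y z w = 0" for x y z w
  proof (rule polarization4[of ?T])
    show "?T (x + x') y z w = ?T x y z w + ?T x' y z w" for x x' y z w
      by (simp add: curv_form_add)
    show "?T x y z w = ?T y x z w" for x y z w
      using curv_form_sym(1)[OF K(1), of x y z w] curv_form_sym(1)[OF K(2), of x y z w] by simp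
    show "?T x y z w = ?T x z y w" for x y z w
      using curv_form_sym(3)[OF K(1), of x y z w] curv_form_sym(3)[OF K(2), of x y z w] by simp
    show "?T x y z w = ?T x y w z" for x y z w
      using curv_form_sym(2)[OF K(1), of x y z w] curv_form_sym(2)[OF K(2), of x y z w] by simp
  qed (use assms(3) in simp)
  then have "curv_form K = curv_form K'" by (simp add: fun_eq_iff)
  then show ?thesis
    by (intro tensor4_eqI) (simp add: curv_eq_form[OF K(1)] curv_eq_form[OF K(2)])
qed

section \<open>The curvature tensor attached to a frame\<close>

definition tp :: "'v \<times> 'v \<Rightarrow> 'v \<Rightarrow> 'v \<Rightarrow> 'v \<Rightarrow> 'v \<Rightarrow> complex" where
  "tp p x y z w = qpol (crd p x) (crd p y) (crd p z) (crd p w)"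

lemma tp_sym: "tp p x y z w = tp p y x z w" "tp p x y z w = tp p x z y w" "tp p x y z w = tp p x y w z"
  unfolding tp_def by (rule qpol_sym)+

lemma tp_add:
  "tp p (x + x') y z w = tp p x y z w + tp p x' y z w" "tp p x (y + y') z w = tp p x y z w + tp p x y' z w"
  "tp p x y (z + z') w = tp p x y z w + tp p x y z' w" "tp p x y z (w + w') = tp p x y z w + tp p x y z w'"
proof -
  show a: "tp p (x + x') y z w = tp p x y z w + tp p x' y z w" for x x' y z w by (simp add: tp_def qpol_add)
  show b: "tp p x (y + y') z w = tp p x y z w + tp p x y' z w" for x y y' z w by (metis a tp_sym(1))
  show c: "tp p x y (z + z') w = tp p x y z w + tp p x y z' w" for x y z z' w by (metis b tp_sym(2))
  show "tp p x y z (w + w') = tp p x y z w + tp p x y z w'" by (metis c tp_sym(3))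
qed

lemma tp_cs:
  "tp p (cs c x) y z w = c * tp p x y z w" "tp p x (cs c y) z w = c * tp p x y z w"
  "tp p x y (cs c z) w = c * tp p x y z w" "tp p x y z (cs c w) = c * tp p x y z w"
proof -
  show a: "tp p (cs c x) y z w = c * tp p x y z w" for x y z w by (simp add: tp_def qpol_smult crd_cs)
  show b: "tp p x (cs c y) z w = c * tp p x y z w" for x y z w by (metis a tp_sym(1))
  show c: "tp p x y (cs c z) w = c * tp p x y z w" for x y z w by (metis b tp_sym(2))
  show "tp p x y z (cs c w) = c * tp p x y z w" by (metis c tp_sym(3))
qed

lemmas tp_J1 = tp_cs[where c = \<i>, unfolded cs_linear]
lemmas tp_scaleR = tp_cs[where c = "of_real r" for r, unfolded cs_linear]
lemmas tp_minus = tp_cs[where c = "-1", unfolded cs_linear]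

lemma tp_J2: "tp p (J2 x) (J2 y) (J2 z) (J2 w) = cnj (tp p x y z w)"
  by (simp add: tp_def crd_J2 qpol_jq)

definition K_of :: "'v \<times> 'v \<Rightarrow> 'v tensor4" where
  "K_of p = mk_tensor (\<lambda>x y z w. Re (tp p x (J2 y) z (J2 w) - tp p x (J2 y) w (J2 z)) / 8)"

lemma K_of_apply: "K_of p x y z w = Re (tp p x (J2 y) z (J2 w) - tp p x (J2 y) w (J2 z)) / 8"
  unfolding K_of_def
  by (rule mk_tensor_apply; rule linearI) (simp_all add: tp_add tp_scaleR algebra_simps add_divide_distrib diff_divide_distrib)

lemma Re_tp_J2: "Re (tp p (J2 x) y (J2 z) w) = Re (tp p x (J2 y) z (J2 w))"
proof -
  have "tp p (J2 x) y (J2 z) w = tp p (J2 x) (J2 (J2 y)) (J2 z) (J2 (J2 w))"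
    by (simp add: tp_minus)
  also have "\<dots> = cnj (tp p x (J2 y) z (J2 w))" by (rule tp_J2)
  finally show ?thesis by simp
qed

text \<open>Antisymmetry in \<open>x\<close> and \<open>y\<close> and the Bianchi identity combine
  the reality condition \<open>Re_tp_J2\<close> with the symmetry of \<open>tp\<close>; antisymmetry
  in \<open>z\<close> and \<open>w\<close> is built into the formula. Invariance under
  \<open>J1\<close> is complex linearity, that under \<open>J2\<close> again symmetry.\<close>

lemma K_of_curv: "K_of p \<in> curv"
  unfolding curvature_Sp2_def Let_def mem_Collect_eq
proof (intro conjI allI ballI)
  fix x y z w
  have s: "Re (tp p y (J2 x) z (J2 w)) = Re (tp p x (J2 y) w (J2 z))" for x y z w
    using Re_tp_J2[of p x y w z] tp_sym by metis
  show "K_of p x y z w = - K_of p y x z w"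
    using s[of y x z w] s[of y x w z] by (simp only: K_of_apply minus_complex.sel minus_divide_left minus_diff_eq)
  show "K_of p x y z w = - K_of p x y w z"
    by (simp only: K_of_apply minus_complex.sel minus_divide_left minus_diff_eq)
  have 1: "tp p x (J2 y) w (J2 z) = tp p w (J2 y) x (J2 z)" for x y z w by (metis tp_sym)
  have t: "Re (tp p x (J2 y) w (J2 z)) = Re (tp p z (J2 x) y (J2 w))" for x y z w
    using Re_tp_J2[of p x z w y] s[of z x y w] tp_sym by (metis (no_types, lifting))
  show "K_of p x y z w + K_of p y z x w + K_of p z x y w = 0"
    using t[of x y w z] t[of y z w x] t[of z x w y] by (simp add: K_of_apply diff_divide_distrib)
  fix J assume "J \<in> {J1, J2, J3}"
  have j1: "K_of p x y (J1 z) (J1 w) = K_of p x y z w" for z w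
    by (simp add: K_of_apply tp_J1 tp_minus)
  have j2: "K_of p x y (J2 z) (J2 w) = K_of p x y z w" for z w
    by (simp add: K_of_apply tp_minus) (metis tp_sym(3) add.commute)
  show "K_of p x y (J z) (J w) = K_of p x y z w"
    using \<open>J \<in> _\<close> j1 j2 by (auto simp: J3_eq)
qed

lemma curv_form_K_of: "curv_form (K_of p) x y z w = tp p x y z w"
proof -
  have "tp p x y (J2 w) (J2 z) = tp p x y (J2 z) (J2 w)" by (metis tp_sym(3))
  then show ?thesis
    by (simp add: curv_form_def K_of_apply tp_J1 tp_minus complex_eq_iff add_divide_distrib diff_divide_distrib)
qed

lemma tp_Sp2: "a \<in> G \<Longrightarrow> tp (a (fst p), a (snd p)) (a x) (a y) (a z) (a w) = tp p x y z w"
  by (simp add: tp_def crd_Sp2)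

lemma pull_K_of: "a \<in> G \<Longrightarrow> pull a (K_of (a (fst p), a (snd p))) = K_of p"
  by (rule tensor4_eqI) (simp add: pull_apply K_of_apply tp_Sp2 flip: Sp2_commute(2))

text \<open>Adapted bases correspond to frames, and a curvature tensor is determined by its quartic;
  so each frame belongs to exactly one tensor.\<close>

lemma cubic_discriminants_eq: "cubic_discriminants g J1 J2 J3 = K_of ` {p. frame p}"
proof -
  have key: "(\<exists>e. adapted_basis g J1 J2 e \<and>
       (\<forall>x::complex^4. let v = (\<Sum>\<alpha>\<in>UNIV. cscale (x $ \<alpha>) (e \<alpha>)) in
          cform4 (S_tensor J2 J3 K) v v v v = quartic x)) \<longleftrightarrow> (\<exists>p. frame p \<and> K = K_of p)" if K: "K \<in> curv" for K
  proof -
    have "(\<forall>x. cform4 (S_tensor J2 J3 K) (hat (mk p x)) (hat (mk p x)) (hat (mk p x)) (hat (mk p x)) = quartic x) \<longleftrightarrow> K = K_of p"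
      if p: "frame p" for p
    proof -
      have "(\<forall>x. curv_form K (mk p x) (mk p x) (mk p x) (mk p x) = quartic x) \<longleftrightarrow>
          (\<forall>v. curv_form K v v v v = quartic (crd p v))"
        by (metis crd_mk[OF p] mk_crd[OF p])
      also have "\<dots> \<longleftrightarrow> (\<forall>v. curv_form K v v v v = curv_form (K_of p) v v v v)"
        by (simp add: curv_form_K_of tp_def qpol_diag)
      also have "\<dots> \<longleftrightarrow> K = K_of p" using curv_eqI[OF K K_of_curv[of p]] by auto
      finally show ?thesis by (simp add: curv_form_cform4[OF K])
    qed
    note eq = this
    show ?thesis
    proof
      assume "\<exists>e. adapted_basis g J1 J2 e \<and>
       (\<forall>x::complex^4. let v = (\<Sum>\<alpha>\<in>UNIV. cscale (x $ \<alpha>) (e \<alpha>)) in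
          cform4 (S_tensor J2 J3 K) v v v v = quartic x)"
      then obtain e where e: "adapted_basis g J1 J2 e" "\<forall>x::complex^4. let v = (\<Sum>\<alpha>\<in>UNIV. cscale (x $ \<alpha>) (e \<alpha>)) in
          cform4 (S_tensor J2 J3 K) v v v v = quartic x" by blast
      from adapted_basis_imp[OF e(1)] obtain p where p: "frame p" "e = (\<lambda>\<alpha>. hat (bas p \<alpha>))" .
      show "\<exists>p. frame p \<and> K = K_of p"
        using e(2) eq[OF p(1)] p(1) by (intro exI[of _ p]) (simp add: p(2) sum_hat Let_def)
    next
      assume "\<exists>p. frame p \<and> K = K_of p"
      then obtain p where p: "frame p" "K = K_of p" by blast
      show "\<exists>e. adapted_basis g J1 J2 e \<and>
       (\<forall>x::complex^4. let v = (\<Sum>\<alpha>\<in>UNIV. cscale (x $ \<alpha>) (e \<alpha>)) in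
          cform4 (S_tensor J2 J3 K) v v v v = quartic x)"
        using eq[OF p(1)] adapted_basis_frame[OF p(1)] p(2)
        by (intro exI[of _ "\<lambda>\<alpha>. hat (bas p \<alpha>)"]) (simp add: sum_hat Let_def)
    qed
  qed
  have "cubic_discriminants g J1 J2 J3 = {K \<in> curv. \<exists>p. frame p \<and> K = K_of p}"
    unfolding cubic_discriminants_def quartic_def[symmetric] using key by blast
  then show ?thesis using K_of_curv by auto
qed

end

section \<open>The third symmetric power of the standard representation\<close>

definition r3 :: complex where "r3 = complex_of_real (sqrt 3)"

lemma r3 [simp]: "r3 * r3 = 3" "r3 * (r3 * z) = 3 * z" "cnj r3 = r3" "r3 \<noteq> 0"
proof -
  show "r3 * r3 = 3" unfolding r3_def by (simp flip: of_real_mult)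
  then show "r3 * (r3 * z) = 3 * z" by (simp flip: mult.assoc)
qed (simp_all add: r3_def)

definition su2 :: "complex \<Rightarrow> complex \<Rightarrow> complex^2^2" where
  "su2 a b = vector [vector [a, b], vector [- cnj b, cnj a]]"

lemma su2_nth [simp]:
  "su2 a b $ 1 $ 1 = a" "su2 a b $ 1 $ 2 = b" "su2 a b $ 2 $ 1 = - cnj b" "su2 a b $ 2 $ 2 = cnj a"
  by (simp_all add: su2_def)

lemma su2_in_SU2:
  assumes "a * cnj a + b * cnj b = 1" shows "su2 a b \<in> SU2"
  using assms by (simp add: SU2_def vec_eq_iff forall_2 matrix_matrix_mult_def sum_2 mat_def det_2 algebra_simps)

lemma SU2_E:
  assumes "u \<in> SU2"
  obtains a b where "u = su2 a b" "a * cnj a + b * cnj b = 1"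
proof -
  define a b c d where "a = u $ 1 $ 1" and "b = u $ 1 $ 2" and "c = u $ 2 $ 1" and "d = u $ 2 $ 2"
  have m: "cnj a * a + cnj c * c = 1" "cnj a * b + cnj c * d = 0" "cnj b * a + cnj d * c = 0" "cnj b * b + cnj d * d = 1"
    and det: "a * d - b * c = 1"
    using assms by (simp_all add: SU2_def vec_eq_iff forall_2 matrix_matrix_mult_def sum_2 mat_def det_2 a_def b_def c_def d_def)
  have "d = d * (cnj a * a + cnj c * c) - c * (cnj a * b + cnj c * d)" using m by simp
  also have "\<dots> = cnj a * (a * d - b * c)" by (simp add: algebra_simps)
  finally have d: "d = cnj a" using det by simp
  have "c = c * (cnj b * b + cnj d * d) - d * (cnj b * a + cnj d * c)" using m by simp
  also have "\<dots> = - cnj b * (a * d - b * c)" by (simp add: algebra_simps)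
  finally have c: "c = - cnj b" using det by simp
  have "u = su2 a b"
    using c d by (simp add: vec_eq_iff forall_2 a_def b_def c_def d_def)
  moreover have "a * cnj a + b * cnj b = 1" using det c d by simp
  ultimately show ?thesis using that by blast
qed

lemma SU2_mult:
  assumes "u \<in> SU2" "v \<in> SU2" shows "u ** v \<in> SU2"
proof -
  obtain a b where u: "u = su2 a b" "a * cnj a + b * cnj b = 1" using SU2_E[OF assms(1)] .
  obtain c d where v: "v = su2 c d" "c * cnj c + d * cnj d = 1" using SU2_E[OF assms(2)] .
  have "u ** v = su2 (a * c - b * cnj d) (a * d + b * cnj c)"
    by (simp add: u v vec_eq_iff forall_2 matrix_matrix_mult_def sum_2)
  moreover have "(a * c - b * cnj d) * cnj (a * c - b * cnj d) + (a * d + b * cnj c) * cnj (a * d + b * cnj c) =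
      (a * cnj a + b * cnj b) * (c * cnj c + d * cnj d)"
    by (simp add: algebra_simps)
  ultimately show ?thesis using u v by (simp add: su2_in_SU2)
qed

text \<open>The action of \<open>GL(2)\<close> on binary cubics, in the coordinates of the basis
  \<open>s\<^sup>3, \<surd>3 s\<^sup>2t, t\<^sup>3, -\<surd>3 st\<^sup>2\<close>. In these coordinates the quartic is one third of the discriminant.\<close>

definition rep :: "complex^2^2 \<Rightarrow> complex^4 \<Rightarrow> complex^4" where
  "rep u x = (let a = u $ 1 $ 1; b = u $ 1 $ 2; c = u $ 2 $ 1; d = u $ 2 $ 2 in
     \<chi> \<alpha>. if \<alpha> = 1 then a^3 * x $ 1 + r3 * a\<^sup>2 * b * x $ 2 - r3 * a * b\<^sup>2 * x $ 4 + b^3 * x $ 3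
       else if \<alpha> = 2 then r3 * a\<^sup>2 * c * x $ 1 + (a\<^sup>2 * d + 2 * a * b * c) * x $ 2
          - (2 * a * b * d + b\<^sup>2 * c) * x $ 4 + r3 * b\<^sup>2 * d * x $ 3
       else if \<alpha> = 3 then c^3 * x $ 1 + r3 * c\<^sup>2 * d * x $ 2 - r3 * c * d\<^sup>2 * x $ 4 + d^3 * x $ 3
       else - (r3 * a * c\<^sup>2 * x $ 1) - (2 * a * c * d + b * c\<^sup>2) * x $ 2
          + (a * d\<^sup>2 + 2 * b * c * d) * x $ 4 - r3 * b * d\<^sup>2 * x $ 3)"

lemma rep_nth:
  "rep u x $ 1 = (u$1$1)^3 * x $ 1 + r3 * (u$1$1)\<^sup>2 * u$1$2 * x $ 2 - r3 * u$1$1 * (u$1$2)\<^sup>2 * x $ 4 + (u$1$2)^3 * x $ 3"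
  "rep u x $ 2 = r3 * (u$1$1)\<^sup>2 * u$2$1 * x $ 1 + ((u$1$1)\<^sup>2 * u$2$2 + 2 * u$1$1 * u$1$2 * u$2$1) * x $ 2
          - (2 * u$1$1 * u$1$2 * u$2$2 + (u$1$2)\<^sup>2 * u$2$1) * x $ 4 + r3 * (u$1$2)\<^sup>2 * u$2$2 * x $ 3"
  "rep u x $ 3 = (u$2$1)^3 * x $ 1 + r3 * (u$2$1)\<^sup>2 * u$2$2 * x $ 2 - r3 * u$2$1 * (u$2$2)\<^sup>2 * x $ 4 + (u$2$2)^3 * x $ 3"
  "rep u x $ 4 = - (r3 * u$1$1 * (u$2$1)\<^sup>2 * x $ 1) - (2 * u$1$1 * u$2$1 * u$2$2 + u$1$2 * (u$2$1)\<^sup>2) * x $ 2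
          + (u$1$1 * (u$2$2)\<^sup>2 + 2 * u$1$2 * u$2$1 * u$2$2) * x $ 4 - r3 * u$1$2 * (u$2$2)\<^sup>2 * x $ 3"
  by (simp_all add: rep_def Let_def)

lemma rep_add: "rep u (x + y) = rep u x + rep u y"
  by (simp add: vec4_eq_iff rep_nth algebra_simps)

lemma rep_smult: "rep u (c *s x) = c *s rep u x"
  by (simp add: vec4_eq_iff rep_nth algebra_simps)

lemma rep_jq: "jq (rep (su2 a b) x) = rep (su2 a b) (jq x)"
  by (simp add: vec4_eq_iff rep_nth algebra_simps power2_eq_square power3_eq_cube)

definition omega :: "complex^4 \<Rightarrow> complex^4 \<Rightarrow> complex" where
  "omega x y = x $ 1 * y $ 3 - x $ 3 * y $ 1 + x $ 2 * y $ 4 - x $ 4 * y $ 2"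

lemma omega_rep: "omega (rep u x) (rep u y) = (det u)^3 * omega x y"
proof -
  define a b c d where "a = u $ 1 $ 1" and "b = u $ 1 $ 2" and "c = u $ 2 $ 1" and "d = u $ 2 $ 2"
  show ?thesis
    unfolding omega_def rep_nth det_2 a_def[symmetric] b_def[symmetric] c_def[symmetric] d_def[symmetric]
    by (simp add: algebra_simps power2_eq_square power3_eq_cube)
qed

text \<open>Up to a constant factor, the discriminant of a binary cubic is the discriminant of its Hessian,
  which is a quadratic covariant.\<close>

lemma quartic_rep: "quartic (rep u x) = (det u)^6 * quartic x"
proof -
  define a b c d where "a = u $ 1 $ 1" and "b = u $ 1 $ 2" and "c = u $ 2 $ 1" and "d = u $ 2 $ 2"
  \<comment> \<open>For a cubic with coefficients \<open>A\<close>, \<open>B\<close>,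
    \<open>C\<close>, \<open>D\<close> these are one third of \<open>B^2 - 3AC\<close>,
    \<open>BC - 9AD\<close> and \<open>C^2 - 3BD\<close>, the coefficients of the Hessian. Here
    \<open>B = r3 * x $ 2\<close> and \<open>C = - r3 * x $ 4\<close>.\<close>
  define h0 where "h0 x = (x $ 2)\<^sup>2 + r3 * x $ 1 * x $ 4" for x :: "complex^4"
  define h1 where "h1 x = - (x $ 2 * x $ 4 + 3 * x $ 1 * x $ 3)" for x :: "complex^4"
  define h2 where "h2 x = (x $ 4)\<^sup>2 - r3 * x $ 2 * x $ 3" for x :: "complex^4"
  have q: "quartic x = 4 * h0 x * h2 x - (h1 x)\<^sup>2" for x
    unfolding quartic_def r3_def[symmetric] h0_def h1_def h2_def
    by (simp add: algebra_simps power2_eq_square power3_eq_cube)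
  note abcd = a_def[symmetric] b_def[symmetric] c_def[symmetric] d_def[symmetric]
  define \<delta> where "\<delta> = a * d - b * c"
  have 0: "h0 (rep u x) = \<delta>\<^sup>2 * (a\<^sup>2 * h0 x + a * b * h1 x + b\<^sup>2 * h2 x)"
    unfolding h0_def h1_def h2_def rep_nth abcd \<delta>_def
    by (simp add: algebra_simps power2_eq_square power3_eq_cube)
  have 1: "h1 (rep u x) = \<delta>\<^sup>2 * (2 * a * c * h0 x + (a * d + b * c) * h1 x + 2 * b * d * h2 x)"
    unfolding h0_def h1_def h2_def rep_nth abcd \<delta>_def
    by (simp add: algebra_simps power2_eq_square power3_eq_cube)
  have 2: "h2 (rep u x) = \<delta>\<^sup>2 * (c\<^sup>2 * h0 x + c * d * h1 x + d\<^sup>2 * h2 x)"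
    unfolding h0_def h1_def h2_def rep_nth abcd \<delta>_def
    by (simp add: algebra_simps power2_eq_square power3_eq_cube)
  have "quartic (rep u x) = \<delta>^6 * quartic x"
    unfolding q 0 1 2 \<delta>_def by algebra
  then show ?thesis by (simp add: det_2 \<delta>_def abcd)
qed

text \<open>The factors \<open>r3\<close> and \<open>- r3\<close> turn \<open>S3_form\<close> into
  \<open>omega\<close> and \<open>S3_quat\<close> into \<open>jq\<close>.\<close>

definition crd3 :: "tens3 \<Rightarrow> complex^4" where
  "crd3 t = (\<chi> \<alpha>. if \<alpha> = 1 then t 1 1 1 else if \<alpha> = 2 then r3 * t 1 1 2
     else if \<alpha> = 3 then t 2 2 2 else - (r3 * t 1 2 2))"

lemma crd3_nth [simp]:
  "crd3 t $ 1 = t 1 1 1" "crd3 t $ 2 = r3 * t 1 1 2" "crd3 t $ 3 = t 2 2 2" "crd3 t $ 4 = - (r3 * t 1 2 2)"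
  by (simp_all add: crd3_def)

definition ten :: "complex^4 \<Rightarrow> tens3" where
  "ten x i j k = (if i = 1 then (if j = 1 then (if k = 1 then x $ 1 else r3 / 3 * x $ 2) else (if k = 1 then r3 / 3 * x $ 2 else - (r3 / 3 * x $ 4)))
     else (if j = 1 then (if k = 1 then r3 / 3 * x $ 2 else - (r3 / 3 * x $ 4)) else (if k = 1 then - (r3 / 3 * x $ 4) else x $ 3)))"

lemma crd3_ten: "crd3 (ten x) = x"
  by (simp add: vec4_eq_iff ten_def)

lemma ten_S3: "ten x \<in> S3"
  by (auto simp: S3_def ten_def)

lemma S3_components:
  assumes "t \<in> S3"
  shows "t 1 2 1 = t 1 1 2" "t 2 1 1 = t 1 1 2" "t 2 1 2 = t 1 2 2" "t 2 2 1 = t 1 2 2"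
proof -
  have s: "t i j k = t j i k" "t i j k = t i k j" for i j k using assms by (auto simp: S3_def)
  show "t 1 2 1 = t 1 1 2" "t 2 1 1 = t 1 1 2" "t 2 1 2 = t 1 2 2" "t 2 2 1 = t 1 2 2"
    using s by metis+
qed

lemma ten_crd3: "t \<in> S3 \<Longrightarrow> ten (crd3 t) = t"
proof (intro ext)
  fix i j k assume "t \<in> S3"
  then show "ten (crd3 t) i j k = t i j k"
    using exhaust_2[of i] exhaust_2[of j] exhaust_2[of k] S3_components[of t] by (auto simp: ten_def)
qed

lemma ten_add: "ten (x + y) = (\<lambda>i j k. ten x i j k + ten y i j k)"
  by (intro ext) (simp add: ten_def algebra_simps add_divide_distrib)

lemma ten_smult: "ten (c *s x) = (\<lambda>i j k. c * ten x i j k)"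
  by (intro ext) (simp add: ten_def)

lemma S3_act_S3: "t \<in> S3 \<Longrightarrow> S3_act u t \<in> S3"
  unfolding S3_def mem_Collect_eq
proof (intro allI conjI)
  fix i j k assume "\<forall>i j k. t i j k = t j i k \<and> t i j k = t i k j"
  then have "t \<in> S3" by (simp add: S3_def)
  note s = S3_components[OF this]
  show "S3_act u t i j k = S3_act u t j i k" "S3_act u t i j k = S3_act u t i k j"
    by (simp_all add: S3_act_def sum_2 s algebra_simps)
qed

lemma crd3_act: "t \<in> S3 \<Longrightarrow> crd3 (S3_act u t) = rep u (crd3 t)"
  using S3_components[of t]
  by (simp add: vec4_eq_iff S3_act_def sum_2 rep_nth power2_eq_square power3_eq_cube algebra_simps)

lemma S3_act_mult: "S3_act u (S3_act v t) = S3_act (u ** v) t"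
  by (intro ext) (simp add: S3_act_def matrix_matrix_mult_def sum_2 algebra_simps)

text \<open>Multiplicativity is evident for the action on tensors and is carried over through the
  coordinates.\<close>

lemma rep_mult: "rep u (rep v x) = rep (u ** v) x"
proof -
  have "rep u (rep v x) = crd3 (S3_act u (S3_act v (ten x)))"
    by (simp add: crd3_act S3_act_S3 ten_S3 crd3_ten)
  also have "\<dots> = rep (u ** v) x"
    by (simp add: S3_act_mult crd3_act S3_act_S3 ten_S3 crd3_ten)
  finally show ?thesis .
qed

lemma rep_mat_1: "rep (mat 1) x = x"
  by (simp add: vec4_eq_iff rep_nth mat_def)

lemma S3_form_ten: "S3_form (ten x) (ten y) = omega x y"
  by (simp add: S3_form_def sum_2 vol2_def ten_def omega_def algebra_simps)

lemma S3_quat_ten: "S3_quat (ten x) = ten (jq x)"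
proof (intro ext)
  fix i j k :: 2
  show "S3_quat (ten x) i j k = ten (jq x) i j k"
    using exhaust_2[of i] exhaust_2[of j] exhaust_2[of k]
    by (auto simp: S3_quat_def sum_2 vol2_def ten_def)
qed

section \<open>The stabiliser of a cubic discriminant\<close>

lemma norm_cube_eq_1: "cmod z ^ 3 = 1 \<Longrightarrow> cmod z = 1"
  using power_eq_imp_eq_base[of "cmod z" 3 1] by simp

lemma cube_root_unit:
  assumes "cmod c = 1" obtains b where "b ^ 3 * c = 1" "b * cnj b = 1"
proof -
  obtain r t where rt: "c = rcis r t" by (metis rcis_cmod_Arg)
  define b where "b = cis (- Arg c / 3)"
  have "b ^ 3 = cis (- Arg c)" by (simp add: b_def power3_eq_cube cis_mult)
  moreover have "c = cis (Arg c)" using assms by (metis cis_Arg norm_zero sgn_div_norm inverse_1 scaleR_one zero_neq_one)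
  ultimately have "b ^ 3 * c = 1" by (metis cis_mult add.left_inverse cis_zero)
  moreover have "b * cnj b = 1" by (simp add: b_def cis_cnj cis_mult)
  ultimately show ?thesis using that by blast
qed

text \<open>A root on the projective line, scaled to unit length: \<open>z = a / b\<close>, and
  \<open>c0 = 0\<close> gives the root at infinity.\<close>

lemma binary_cubic_root:
  fixes c0 c1 c2 c3 :: complex
  obtains a b where "a * cnj a + b * cnj b = 1" "a^3 * c0 + a\<^sup>2 * b * c1 + a * b\<^sup>2 * c2 + b^3 * c3 = 0"
proof (cases "c0 = 0")
  case True
  then show ?thesis using that[of 1 0] by simp
next
  case False
  have "\<not> constant (poly [:c3, c2, c1, c0:])"
    using False by (subst constant_degree) simp
  then obtain z where "poly [:c3, c2, c1, c0:] z = 0"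
    using fundamental_theorem_of_algebra by blast
  then have z: "z^3 * c0 + z\<^sup>2 * c1 + z * c2 + c3 = 0"
    by (simp add: algebra_simps power2_eq_square power3_eq_cube)
  define n where "n = complex_of_real (1 / sqrt (1 + (cmod z)\<^sup>2))"
  have pos: "1 + (cmod z)\<^sup>2 > 0" by (simp add: add_pos_nonneg)
  have n: "n * n * complex_of_real (1 + (cmod z)\<^sup>2) = 1" "cnj n = n"
  proof -
    have "1 / sqrt (1 + (cmod z)\<^sup>2) * (1 / sqrt (1 + (cmod z)\<^sup>2)) * (1 + (cmod z)\<^sup>2) = 1"
      using pos by (simp add: real_sqrt_mult_self)
    then show "n * n * complex_of_real (1 + (cmod z)\<^sup>2) = 1"
      unfolding n_def of_real_mult[symmetric] by simp
  qed (simp add: n_def)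
  show ?thesis
  proof (rule that[of "n * z" n])
    have "n * z * cnj (n * z) + n * cnj n = n * n * complex_of_real (1 + (cmod z)\<^sup>2)"
      by (simp add: n(2) algebra_simps complex_norm_square[symmetric])
    then show "n * z * cnj (n * z) + n * cnj n = 1" using n(1) by simp
    have "(n * z)^3 * c0 + (n * z)\<^sup>2 * n * c1 + n * z * n\<^sup>2 * c2 + n^3 * c3 = n^3 * (z^3 * c0 + z\<^sup>2 * c1 + z * c2 + c3)"
      by (simp add: algebra_simps power2_eq_square power3_eq_cube)
    then show "(n * z)^3 * c0 + (n * z)\<^sup>2 * n * c1 + n * z * n\<^sup>2 * c2 + n^3 * c3 = 0" using z by simp
  qed
qed

lemma qpol_axis1: "qpol (axis 1 1) (axis 1 1) (axis 1 1) z = 0"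
  by (simp add: qpol_def perm4_def axis_def)

text \<open>A critical point of the quartic is a cube, here one of a linear form without \<open>s\<close>-term.\<close>

lemma qpol_critical:
  assumes "y $ 1 = 0" "\<And>z. qpol y y y z = 0"
  shows "y $ 2 = 0" "y $ 4 = 0"
proof -
  \<comment> \<open>Where \<open>y $ 1 = 0\<close>, the derivatives along the axes 3 and 1 reduce in
    turn to multiples of the cubes of \<open>y $ 2\<close> and \<open>y $ 4\<close>.\<close>
  show 2: "y $ 2 = 0"
    using assms(2)[of "axis 3 1"] assms(1) by (simp add: qpol_def perm4_def axis_def)
  show "y $ 4 = 0"
    using assms(2)[of "axis 1 1"] assms(1) 2 by (simp add: qpol_def perm4_def axis_def)
qed

context hyper_hermitian_8
begin

definition ir :: "'v \<times> 'v \<Rightarrow> ('v \<Rightarrow>\<^sub>L 'v) set" where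
  "ir p = {a \<in> G. \<exists>u\<in>SU2. \<forall>v. crd p (a v) = rep u (crd p v)}"

lemma herm_omega: "frame p \<Longrightarrow> herm v w = omega (crd p v) (jq (crd p w))"
  by (simp add: herm_crd omega_def sum_4)

text \<open>As \<open>det u = 1\<close>, the map \<open>rep u\<close> preserves
  \<open>omega\<close>, and it commutes with \<open>jq\<close>; so it takes the basis of
  \<open>p\<close> to that of another frame.\<close>

lemma lift_SU2:
  assumes p: "frame p" and u: "u \<in> SU2"
  obtains a where "a \<in> ir p" "\<And>v. crd p (a v) = rep u (crd p v)"
proof -
  obtain b c where bc: "u = su2 b c" using SU2_E[OF u] by metis
  have det: "det u = 1" using u by (simp add: SU2_def)
  define q where "q = (mk p (rep u (axis 1 1)), mk p (rep u (axis 2 1)))"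
  have crq: "crd p (fst q) = rep u (axis 1 1)" "crd p (snd q) = rep u (axis 2 1)"
    by (simp_all add: q_def crd_mk[OF p])
  have j: "jq (rep u x) = rep u (jq x)" for x unfolding bc by (rule rep_jq)
  have "frame q"
    unfolding frame_def herm_omega[OF p] crd_J2 crq j omega_rep det
    by (simp add: omega_def axis_def)
  then have "change p q \<in> G" by (rule change_in_Sp2[OF p])
  moreover have ap: "crd p (change p q v) = rep u (crd p v)" for v
  proof -
    let ?x = "crd p v"
    have ax: "?x = ?x $ 1 *s axis 1 1 + ?x $ 2 *s axis 2 1 + ?x $ 3 *s jq (axis 1 1) + ?x $ 4 *s jq (axis 2 1)"
      by (simp add: vec4_eq_iff axis_def)
    have "crd p (change p q v) = ?x $ 1 *s rep u (axis 1 1) + ?x $ 2 *s rep u (axis 2 1)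
        + ?x $ 3 *s jq (rep u (axis 1 1)) + ?x $ 4 *s jq (rep u (axis 2 1))"
      by (simp add: change_apply mk_eq crd_cs crd_J2 crq)
    also have "\<dots> = rep u ?x"
      by (subst (5) ax) (simp add: rep_add rep_smult bc rep_jq)
    finally show ?thesis .
  qed
  ultimately show ?thesis using that[of "change p q"] u by (auto simp: ir_def)
qed

section \<open>Identifications of the symmetric cube with W\<close>

lemma S3_identification_frame:
  assumes p: "frame p" shows "S3_identification g J1 J2 (\<lambda>t. hat (mk p (crd3 t)))"
  unfolding S3_identification_def
proof (intro conjI allI ballI)
  show "bij_betw (\<lambda>t. hat (mk p (crd3 t))) S3 (W_space J1)"
  proof (rule bij_betwI[of _ _ _ "\<lambda>z. ten (crd p (fst z))"])
    show "(\<lambda>t. hat (mk p (crd3 t))) \<in> S3 \<rightarrow> W_space J1" by (simp add: hat_in_W)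
    show "(\<lambda>z. ten (crd p (fst z))) \<in> W_space J1 \<rightarrow> S3" by (simp add: ten_S3)
    show "ten (crd p (fst (hat (mk p (crd3 t))))) = t" if "t \<in> S3" for t
      using that by (simp add: hat_simps crd_mk[OF p] ten_crd3)
    show "hat (mk p (crd3 (ten (crd p (fst z))))) = z" if "z \<in> W_space J1" for z
      using that W_space_iff[of z] by (simp add: crd3_ten mk_crd[OF p])
  qed
  fix s t assume st: "s \<in> S3" "t \<in> S3"
  have "crd3 (\<lambda>i j k. s i j k + t i j k) = crd3 s + crd3 t"
    by (simp add: vec4_eq_iff algebra_simps)
  then show "hat (mk p (crd3 (\<lambda>i j k. s i j k + t i j k))) = hat (mk p (crd3 s)) + hat (mk p (crd3 t))"
    by (simp add: mk_add hat_simps)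
  have "S3_form s t = omega (crd3 s) (crd3 t)" using S3_form_ten[of "crd3 s" "crd3 t"] st by (simp add: ten_crd3)
  then show "pi_form g J2 (hat (mk p (crd3 s))) (hat (mk p (crd3 t))) = S3_form s t"
    by (simp add: pi_form_hat herm_omega[OF p] crd_J2 crd_mk[OF p] omega_def algebra_simps)
next
  fix c t assume t: "t \<in> S3"
  have "crd3 (\<lambda>i j k. c * t i j k) = c *s crd3 t"
    by (simp add: vec4_eq_iff)
  then show "hat (mk p (crd3 (\<lambda>i j k. c * t i j k))) = cscale c (hat (mk p (crd3 t)))"
    by (simp add: mk_smult hat_simps)
next
  fix t assume t: "t \<in> S3"
  have "S3_quat t = ten (jq (crd3 t))" using S3_quat_ten[of "crd3 t"] t by (simp add: ten_crd3)
  then show "cmap J2 (cconj (hat (mk p (crd3 t)))) = hat (mk p (crd3 (S3_quat t)))"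
    by (simp add: hat_simps crd3_ten mk_jq)
qed

text \<open>The images of the first two coordinate vectors form the frame: compatibility with the
  quaternionic structures yields the rest of the basis, compatibility with the 2-forms its
  orthonormality.\<close>

lemma S3_identification_imp:
  assumes "S3_identification g J1 J2 \<Phi>"
  obtains p where "frame p" "\<And>t. t \<in> S3 \<Longrightarrow> \<Phi> t = hat (mk p (crd3 t))"
proof -
  have bij: "bij_betw \<Phi> S3 (W_space J1)"
    and add: "\<And>s t. s \<in> S3 \<Longrightarrow> t \<in> S3 \<Longrightarrow> \<Phi> (\<lambda>i j k. s i j k + t i j k) = \<Phi> s + \<Phi> t"
    and smult: "\<And>c t. t \<in> S3 \<Longrightarrow> \<Phi> (\<lambda>i j k. c * t i j k) = cscale c (\<Phi> t)"
    and form: "\<And>s t. s \<in> S3 \<Longrightarrow> t \<in> S3 \<Longrightarrow> pi_form g J2 (\<Phi> s) (\<Phi> t) = S3_form s t"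
    and quat: "\<And>t. t \<in> S3 \<Longrightarrow> cmap J2 (cconj (\<Phi> t)) = \<Phi> (S3_quat t)"
    using assms unfolding S3_identification_def by blast+
  define f where "f x = fst (\<Phi> (ten x))" for x
  have hf: "\<Phi> (ten x) = hat (f x)" for x
    using bij ten_S3[of x] W_space_iff unfolding f_def bij_betw_def by blast
  have f_add: "f (x + y) = f x + f y" for x y
    using add[OF ten_S3 ten_S3, of x y] by (simp add: f_def ten_add)
  have f_smult: "f (c *s x) = cs c (f x)" for c x
    using smult[OF ten_S3, of c x] by (simp add: hat_simps hf flip: ten_smult)
  have f_jq: "f (jq x) = J2 (f x)" for x
    using quat[OF ten_S3, of x] by (simp add: S3_quat_ten hf hat_simps)
  define p where "p = (f (axis 1 1), f (axis 2 1))"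
  have fm: "f x = mk p x" for x
  proof -
    have "x = x $ 1 *s axis 1 1 + x $ 2 *s axis 2 1 + x $ 3 *s jq (axis 1 1) + x $ 4 *s jq (axis 2 1)"
      by (simp add: vec4_eq_iff axis_def)
    then have "f x = f (x $ 1 *s axis 1 1 + x $ 2 *s axis 2 1 + x $ 3 *s jq (axis 1 1) + x $ 4 *s jq (axis 2 1))"
      by simp
    then show ?thesis by (simp only: f_add f_smult f_jq mk_eq p_def fst_conv snd_conv)
  qed
  have om: "- herm (f x) (J2 (f y)) = omega x y" for x y
    using form[OF ten_S3 ten_S3, of x y] by (simp add: hf pi_form_hat S3_form_ten)
  have hm: "herm (f x) (f y) = omega x (jq y)" for x y
    using om[of x "jq y"] by (simp add: f_jq)
  have "frame p"
    unfolding frame_def p_def fst_conv snd_conv hm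
    by (simp add: hm f_jq[symmetric]) (simp add: omega_def axis_def)
  moreover have "\<Phi> t = hat (mk p (crd3 t))" if "t \<in> S3" for t
    using hf[of "crd3 t"] fm[of "crd3 t"] ten_crd3[OF that] by simp
  ultimately show ?thesis using that by blast
qed

lemma ir_eq:
  assumes p: "frame p" and \<Phi>: "\<And>t. t \<in> S3 \<Longrightarrow> \<Phi> t = hat (mk p (crd3 t))"
  shows "{a \<in> G. \<exists>u\<in>SU2. \<forall>t\<in>S3. cmap a (\<Phi> t) = \<Phi> (S3_act u t)} = ir p"
proof -
  have "(\<forall>t\<in>S3. cmap a (\<Phi> t) = \<Phi> (S3_act u t)) \<longleftrightarrow> (\<forall>v. crd p (a v) = rep u (crd p v))" if a: "a \<in> G" for a u
  proof -
    have "cmap a (\<Phi> t) = \<Phi> (S3_act u t) \<longleftrightarrow> a (mk p (crd3 t)) = mk p (rep u (crd3 t))" if t: "t \<in> S3" for t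
    proof -
      have "cmap a (hat v) = hat (a v)" for v
        by (simp add: cmap_def hat_def blinfun.minus_right Sp2_commute[OF a])
      then show ?thesis using t by (simp add: \<Phi> S3_act_S3 crd3_act hat_simps)
    qed
    then have "(\<forall>t\<in>S3. cmap a (\<Phi> t) = \<Phi> (S3_act u t)) \<longleftrightarrow> (\<forall>x. a (mk p x) = mk p (rep u x))"
      by (metis crd3_ten ten_S3)
    also have "\<dots> \<longleftrightarrow> (\<forall>v. crd p (a v) = rep u (crd p v))"
      by (metis crd_mk[OF p] mk_crd[OF p])
    finally show ?thesis .
  qed
  then show ?thesis unfolding ir_def by blast
qed

lemma Sp1_ir_iff: "Sp1_ir g J1 J2 J3 H \<longleftrightarrow> (\<exists>p. frame p \<and> H = ir p)"
proof
  assume "Sp1_ir g J1 J2 J3 H"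
  then obtain \<Phi> where \<Phi>: "S3_identification g J1 J2 \<Phi>"
    "H = {a \<in> G. \<exists>u\<in>SU2. \<forall>t\<in>S3. cmap a (\<Phi> t) = \<Phi> (S3_act u t)}"
    unfolding Sp1_ir_def by blast
  obtain p where "frame p" "\<And>t. t \<in> S3 \<Longrightarrow> \<Phi> t = hat (mk p (crd3 t))"
    using S3_identification_imp[OF \<Phi>(1)] by metis
  then show "\<exists>p. frame p \<and> H = ir p" using ir_eq[of p \<Phi>] \<Phi>(2) by (intro exI[of _ p]) simp
next
  assume "\<exists>p. frame p \<and> H = ir p"
  then obtain p where p: "frame p" "H = ir p" by blast
  show "Sp1_ir g J1 J2 J3 H"
    unfolding Sp1_ir_def
    using S3_identification_frame[OF p(1)] ir_eq[OF p(1), of "\<lambda>t. hat (mk p (crd3 t))"] p(2)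
    by (intro exI[of _ "\<lambda>t. hat (mk p (crd3 t))"]) simp
qed

section \<open>The stabiliser of the tensor of a frame\<close>

abbreviation move :: "('v \<Rightarrow>\<^sub>L 'v) \<Rightarrow> 'v \<times> 'v \<Rightarrow> 'v \<times> 'v" where
  "move a p \<equiv> (a (fst p), a (snd p))"

lemma ir_stabilises:
  assumes p: "frame p" and a: "a \<in> ir p" shows "K_of (move a p) = K_of p"
proof -
  obtain u where u: "u \<in> SU2" "\<And>v. crd p (a v) = rep u (crd p v)" and aG: "a \<in> G"
    using a by (auto simp: ir_def)
  have "curv_form (K_of (move a p)) v v v v = curv_form (K_of p) v v v v" for v
  proof -
    obtain w where v: "v = a w" using Sp2_commute(6)[OF aG] by (metis bij_pointE)
    show ?thesis
      using u(1) by (simp add: curv_form_K_of tp_def qpol_diag v crd_Sp2[OF aG] u(2) quartic_rep SU2_def)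
  qed
  then show ?thesis by (intro curv_eqI K_of_curv)
qed

lemma stabiliser_tp:
  assumes "K_of (move a p) = K_of p" "a \<in> G"
  shows "tp p (a x) (a y) (a z) (a w) = tp p x y z w"
  using tp_Sp2[OF assms(2), of p x y z w] curv_form_K_of assms(1) by metis

lemma ir_compose:
  assumes "a \<in> ir p" "b \<in> ir p" shows "a o\<^sub>L b \<in> ir p"
proof -
  obtain u v where "u \<in> SU2" "\<And>x. crd p (a x) = rep u (crd p x)" "v \<in> SU2" "\<And>x. crd p (b x) = rep v (crd p x)"
    using assms by (auto simp: ir_def)
  then show ?thesis using assms Sp2_compose SU2_mult[of u v]
    by (auto simp: ir_def rep_mult intro!: bexI[of _ "u ** v"])
qed

lemma ir_adj:
  assumes p: "frame p" and "a \<in> ir p" shows "adj p a \<in> ir p"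
proof -
  obtain u where u: "u \<in> SU2" "\<And>x. crd p (a x) = rep u (crd p x)" and a: "a \<in> G"
    using assms by (auto simp: ir_def)
  obtain b c where bc: "u = su2 b c" "b * cnj b + c * cnj c = 1" using SU2_E[OF u(1)] .
  let ?v = "su2 (cnj b) (- c)"
  have "?v ** u = mat 1"
    using bc(2) by (simp add: bc(1) vec_eq_iff forall_2 matrix_matrix_mult_def sum_2 mat_def algebra_simps)
  then have "crd p (adj p a x) = rep ?v (crd p x)" for x
    using u(2)[of "adj p a x"] by (simp add: adj_right[OF a p] rep_mult rep_mat_1)
  moreover have "?v \<in> SU2" using bc(2) by (intro su2_in_SU2) (simp add: algebra_simps)
  ultimately show ?thesis using Sp2_adj[OF a p] by (auto simp: ir_def)
qed

text \<open>The points on which the gradient of the quartic vanishes are the cubes. So a stabiliser element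
  maps \<open>s\<^sup>3\<close> to a cube, and after a rotation by \<open>SU(2)\<close> it fixes \<open>s\<^sup>3\<close>. Then it is diagonal, and
  comparing coefficients it is a rotation, too.\<close>

lemma stabiliser_subset_ir:
  assumes p: "frame p" and a: "a \<in> G" "K_of (move a p) = K_of p"
  shows "a \<in> ir p"
proof -
  have crp: "crd p (fst p) = axis 1 1" "crd p (snd p) = axis 2 1"
    using crd_bas[OF p, of 1] crd_bas[OF p, of 2] by simp_all
  let ?y = "crd p (a (fst p))"
  \<comment> \<open>Chosen so that the rotation by \<open>su2 \<alpha> \<beta>\<close> annihilates
    the first coordinate of the image of \<open>fst p\<close>.\<close>
  obtain \<alpha> \<beta> where ab: "\<alpha> * cnj \<alpha> + \<beta> * cnj \<beta> = 1"
    "\<alpha>^3 * ?y $ 1 + \<alpha>\<^sup>2 * \<beta> * (r3 * ?y $ 2) + \<alpha> * \<beta>\<^sup>2 * (- (r3 * ?y $ 4)) + \<beta>^3 * ?y $ 3 = 0"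
    by (rule binary_cubic_root)
  obtain h where h: "h \<in> ir p" "\<And>v. crd p (h v) = rep (su2 \<alpha> \<beta>) (crd p v)"
    using lift_SU2[OF p su2_in_SU2[OF ab(1)]] by blast
  have hG: "h \<in> G" using h(1) by (simp add: ir_def)
  define b where "b = h o\<^sub>L a"
  have b: "b \<in> G" unfolding b_def by (rule Sp2_compose[OF hG a(1)])
  have tb: "tp p (b x) (b y) (b z) (b w) = tp p x y z w" for x y z w
    using stabiliser_tp[OF a(2,1)] stabiliser_tp[OF ir_stabilises[OF p h(1)] hG] by (simp add: b_def)
  let ?x = "crd p (b (fst p))"
  have x1: "?x $ 1 = 0" using ab(2) by (simp add: b_def h(2) rep_nth algebra_simps)
  \<comment> \<open>The gradient vanishes at \<open>axis 1 1\<close> and \<open>b\<close> preserves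
    the quartic, so it vanishes at \<open>?x\<close>; surjectivity of \<open>b\<close> reaches every
    direction \<open>z\<close>.\<close>
  have "qpol ?x ?x ?x z = 0" for z
  proof -
    obtain w where "mk p z = b w" using Sp2_commute(6)[OF b] by (metis bij_pointE)
    then have "z = crd p (b w)" using crd_mk[OF p] by metis
    then show ?thesis
      using tb[of "fst p" "fst p" "fst p" w] by (simp add: tp_def crp qpol_axis1)
  qed
  then have x24: "?x $ 2 = 0" "?x $ 4 = 0" using qpol_critical[of ?x] x1 by blast+
  have "herm (b (fst p)) (b (fst p)) = 1" using p Sp2_commute(4)[OF b] by (simp add: frame_def)
  then have "?x $ 3 * cnj (?x $ 3) = 1" using x1 x24 by (simp add: herm_crd[OF p] sum_4)
  then have "cmod (?x $ 3) ^ 2 = 1"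
    by (metis complex_norm_square of_real_eq_1_iff of_real_power)
  then have "cmod (?x $ 3) = 1" by (simp add: power2_eq_1_iff) (use norm_ge_zero[of "?x $ 3"] in linarith)
  \<comment> \<open>\<open>?x\<close> is the cube \<open>t^3\<close> times a number of modulus 1;
    the rotation \<open>su2 0 c\<close> takes it to \<open>s^3\<close>.\<close>
  then obtain c where c: "c ^ 3 * ?x $ 3 = 1" "c * cnj c = 1" by (rule cube_root_unit)
  obtain k where k: "k \<in> ir p" "\<And>v. crd p (k v) = rep (su2 0 c) (crd p v)"
    using lift_SU2[OF p su2_in_SU2[of 0 c]] c(2) by auto
  have kG: "k \<in> G" using k(1) by (simp add: ir_def)
  define d where "d = k o\<^sub>L b"
  have d: "d \<in> G" unfolding d_def by (rule Sp2_compose[OF kG b])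
  have td: "tp p (d x) (d y) (d z) (d w) = tp p x y z w" for x y z w
    using tb stabiliser_tp[OF ir_stabilises[OF p k(1)] kG] by (simp add: d_def)
  have d1: "crd p (d (fst p)) = axis 1 1"
    using x1 x24 c(1) by (simp add: d_def k(2) vec4_eq_iff rep_nth axis_def)
  then have dp: "d (fst p) = fst p" using crp(1) crd_inj[OF p] by metis
  let ?m = "crd p (d (snd p))"
  \<comment> \<open>\<open>d\<close> is unitary and fixes \<open>fst p\<close> and
    \<open>J2 (fst p)\<close>, so \<open>d (snd p)\<close> is orthogonal to both.\<close>
  have m13: "?m $ 1 = 0" "?m $ 3 = 0"
  proof -
    have "?m $ 1 = herm (d (snd p)) (d (fst p))" by (simp add: crd_def dp)
    also have "\<dots> = 0" using frame_herm[OF p, of 2 1] by (simp add: Sp2_commute(4)[OF d])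
    finally show "?m $ 1 = 0" .
    have "?m $ 3 = herm (d (snd p)) (d (J2 (fst p)))" by (simp add: crd_def dp Sp2_commute(2)[OF d])
    also have "\<dots> = 0" using frame_herm[OF p, of 2 3] by (simp add: Sp2_commute(4)[OF d])
    finally show "?m $ 3 = 0" .
  qed
  have cJ: "crd p (d (J2 v)) = jq (crd p (d v))" for v by (simp add: Sp2_commute(2)[OF d] crd_J2)
  \<comment> \<open>The quartic has entry zero at the axes 1, 3, 2, 2, and \<open>d\<close> turns it
    into a multiple of \<open>?m $ 2 * ?m $ 4\<close>. The entry at 1, 4, 4, 4 then makes
    \<open>?m $ 2\<close> a cube root of unity.\<close>
  have "tp p (d (fst p)) (d (J2 (fst p))) (d (snd p)) (d (snd p)) = tp p (fst p) (J2 (fst p)) (snd p) (snd p)"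
    by (rule td)
  then have prod0: "?m $ 2 * ?m $ 4 = 0"
    using m13 by (simp add: tp_def cJ d1 crd_J2 crp) (simp add: qpol_def perm4_def axis_def)
  have "tp p (d (fst p)) (d (J2 (snd p))) (d (J2 (snd p))) (d (J2 (snd p))) = tp p (fst p) (J2 (snd p)) (J2 (snd p)) (J2 (snd p))"
    by (rule td)
  then have mc3: "cnj (?m $ 2) ^ 3 = 1"
    using m13 by (simp add: tp_def cJ d1 crd_J2 crp)
      (simp add: qpol_def perm4_def axis_def power3_eq_cube r3_def[symmetric] mult.assoc)
  then have mu3: "(?m $ 2) ^ 3 = 1" by (metis complex_cnj_cancel_iff complex_cnj_one complex_cnj_power)
  then have m4: "?m $ 4 = 0" using prod0 by auto
  have mu: "?m $ 2 * cnj (?m $ 2) = 1"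
    using mu3 norm_cube_eq_1[of "?m $ 2"] by (metis complex_norm_square norm_one norm_power of_real_1 one_power2)
  \<comment> \<open>A cube root of unity \<open>\<mu>\<close> on the second axis is the action of
    \<open>su2 \<mu> 0\<close>, which fixes \<open>s^3\<close>.\<close>
  have dr: "crd p (d v) = rep (su2 (?m $ 2) 0) (crd p v)" for v
  proof -
    have "(?m $ 2)\<^sup>2 * cnj (?m $ 2) = ?m $ 2 * (?m $ 2 * cnj (?m $ 2))"
      "?m $ 2 * (cnj (?m $ 2))\<^sup>2 = (?m $ 2 * cnj (?m $ 2)) * cnj (?m $ 2)"
      by (simp_all only: power2_eq_square mult_ac)
    then have s: "(?m $ 2)\<^sup>2 * cnj (?m $ 2) = ?m $ 2" "?m $ 2 * (cnj (?m $ 2))\<^sup>2 = cnj (?m $ 2)" by (simp_all only: mu mult_1_left mult_1_right)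
    have "d v = mk (move d p) (crd p v)" by (rule Sp2_eq_mk[OF d p])
    then show ?thesis
      using m13 m4 s mu3 mc3 by (simp add: mk_eq crd_cs crd_J2 d1 vec4_eq_iff rep_nth axis_def mult.commute)
  qed
  have "su2 (?m $ 2) 0 \<in> SU2" by (rule su2_in_SU2) (simp add: mu)
  then have "d \<in> ir p" unfolding ir_def
    by (intro CollectI conjI d bexI[of _ "su2 (?m $ 2) 0"] allI dr)
  moreover have "a = adj p h o\<^sub>L (adj p k o\<^sub>L d)"
    by (rule blinfun_eqI) (simp add: d_def b_def adj_left[OF kG p] adj_left[OF hG p])
  ultimately show ?thesis using ir_compose ir_adj[OF p] h(1) k(1) by metis
qed

lemma stabiliser_eq_ir: "frame p \<Longrightarrow> ir p = {a \<in> G. K_of (move a p) = K_of p}"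
proof (intro set_eqI iffI)
  fix a assume p: "frame p"
  show "a \<in> {a \<in> G. K_of (move a p) = K_of p}" if a: "a \<in> ir p"
    using ir_stabilises[OF p a] a unfolding ir_def by simp
  show "a \<in> ir p" if "a \<in> {a \<in> G. K_of (move a p) = K_of p}"
    using stabiliser_subset_ir[OF p, of a] that by simp
qed

text \<open>Pulling back along the inverse gives a left action; with \<open>adj\<close> in its place
  the map is smooth on all operators.\<close>

definition orbit_map :: "'v \<times> 'v \<Rightarrow> ('v \<Rightarrow>\<^sub>L 'v) \<Rightarrow> 'v tensor4" where
  "orbit_map p a = pull (adj p a) (K_of p)"

lemma orbit_map_eq:
  assumes "frame p" "a \<in> G" shows "orbit_map p a = K_of (move a p)"
proof -
  have "K_of p = pull a (K_of (move a p))" by (rule pull_K_of[OF assms(2), symmetric])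
  then show ?thesis
    unfolding orbit_map_def by (intro tensor4_eqI) (simp add: pull_apply adj_right[OF assms(2,1)])
qed

lemma cubic_discriminants_orbit:
  assumes "frame p" shows "cubic_discriminants g J1 J2 J3 = orbit_map p ` G"
proof -
  have "{q. frame q} = (\<lambda>a. move a p) ` G"
  proof (intro set_eqI iffI)
    fix q assume "q \<in> {q. frame q}"
    then show "q \<in> (\<lambda>a. move a p) ` G"
      using change_in_Sp2[OF assms, of q] change_frame[OF assms, of q] by (auto intro!: image_eqI[of _ _ "change p q"])
  qed (use frame_Sp2 assms in auto)
  then show ?thesis
    unfolding cubic_discriminants_eq by (simp add: image_image orbit_map_eq[OF assms] cong: image_cong_simp)
qed

text \<open>Both sides say that the quotient \<open>adj p a o\<^sub>L b\<close> lies in the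
  stabiliser.\<close>

lemma orbit_map_fibres:
  assumes p: "frame p" and a: "a \<in> G" and b: "b \<in> G"
  shows "left_coset (ir p) a = left_coset (ir p) b \<longleftrightarrow> orbit_map p a = orbit_map p b"
proof -
  define c where "c = adj p a o\<^sub>L b"
  have c: "c \<in> G" "b = a o\<^sub>L c"
    using Sp2_compose[OF Sp2_adj[OF a p] b] by (auto simp: c_def adj_right[OF a p] intro!: blinfun_eqI)
  have "orbit_map p a = orbit_map p b \<longleftrightarrow> K_of (move a p) = K_of (move a (move c p))"
    by (simp add: orbit_map_eq[OF p a] orbit_map_eq[OF p b]) (simp add: c(2))
  also have "\<dots> \<longleftrightarrow> K_of p = K_of (move c p)"
  proof
    assume "K_of (move a p) = K_of (move a (move c p))"
    then show "K_of p = K_of (move c p)" by (metis pull_K_of[OF a])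
  next
    have inv: "K_of (move a q) = pull (adj p a) (K_of q)" for q
    proof -
      have "K_of q = pull a (K_of (move a q))" by (rule pull_K_of[OF a, symmetric])
      then show ?thesis by (intro tensor4_eqI) (simp add: pull_apply adj_right[OF a p])
    qed
    assume "K_of p = K_of (move c p)"
    then show "K_of (move a p) = K_of (move a (move c p))" by (simp only: inv)
  qed
  also have "\<dots> \<longleftrightarrow> c \<in> ir p" 
    by (simp only: stabiliser_eq_ir[OF p] mem_Collect_eq c(1) simp_thms eq_commute[of "K_of p"])
  also have "\<dots> \<longleftrightarrow> left_coset (ir p) a = left_coset (ir p) b"
  proof
    have id: "id_blinfun \<in> ir p"
      using stabiliser_eq_ir[OF p] id_in_Sp2 by simp
    {
      assume ch: "c \<in> ir p"
      have 1: "a o\<^sub>L h = b o\<^sub>L (adj p c o\<^sub>L h)" for h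
        by (rule blinfun_eqI) (simp add: c(2) adj_right[OF c(1) p])
      have 2: "b o\<^sub>L h = a o\<^sub>L (c o\<^sub>L h)" for h
        by (rule blinfun_eqI) (simp add: c(2))
      show "left_coset (ir p) a = left_coset (ir p) b"
        unfolding left_coset_def
      proof (intro subset_antisym image_subsetI)
        fix h assume h: "h \<in> ir p"
        show "a o\<^sub>L h \<in> (\<lambda>h. b o\<^sub>L h) ` ir p"
          by (subst 1) (intro imageI ir_compose ir_adj p ch h)
        show "b o\<^sub>L h \<in> (\<lambda>h. a o\<^sub>L h) ` ir p"
          by (subst 2) (intro imageI ir_compose ch h)
      qed
    }
    assume "left_coset (ir p) a = left_coset (ir p) b"
    then have "b o\<^sub>L id_blinfun \<in> left_coset (ir p) a" using id unfolding left_coset_def by blast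
    then obtain h where h: "h \<in> ir p" "b o\<^sub>L id_blinfun = a o\<^sub>L h" unfolding left_coset_def by blast
    have "c = h"
    proof (rule blinfun_eqI)
      fix v
      have "b v = a (h v)" using h(2) by (metis blinfun_apply_blinfun_compose blinfun_apply_id_blinfun)
      then show "c v = h v" by (simp add: c_def adj_left[OF a p])
    qed
    then show "c \<in> ir p" using h by simp
  qed
  finally show ?thesis by blast
qed

end

section \<open>Slices\<close>

lemma smooth_on_pull:
  fixes c :: "'a::real_normed_vector \<Rightarrow> 'v::euclidean_space \<Rightarrow>\<^sub>L 'v" and K :: "'a \<Rightarrow> 'v tensor4"
  assumes "open U" "smooth_on U c" "smooth_on U K"
  shows "smooth_on U (\<lambda>t. pull (c t) (K t))"
proof (intro smooth_on_blinfun assms(1))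
  fix x y z w
  show "smooth_on U (\<lambda>t. pull (c t) (K t) x y z w)"
    unfolding pull_apply by (intro smooth_on_blinfun_apply smooth_on_const assms)
qed

lemma pull_continuous: "continuous_on S (\<lambda>a. pull a K)"
proof -
  have "smooth_on UNIV (\<lambda>a. pull a K)" by (intro smooth_on_pull smooth_on_id smooth_on_const open_UNIV)
  then show ?thesis using smooth_on_continuous continuous_on_subset by blast
qed

lemma pull_compose: "pull b (pull a K) = pull (a o\<^sub>L b) K"
  by (rule tensor4_eqI) (simp add: pull_apply)

lemma tensor4_has_derivative:
  fixes K :: "'v::real_normed_vector tensor4"
  assumes "bounded_linear A" "bounded_linear B" "bounded_linear C" "bounded_linear E"
  shows "((\<lambda>q. K (A q) (B q) (C q) (E q)) has_derivative
    (\<lambda>h. K (A h) (B q) (C q) (E q) + K (A q) (B h) (C q) (E q)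
       + K (A q) (B q) (C h) (E q) + K (A q) (B q) (C q) (E h))) (at q)"
proof -
  note d = bounded_linear_imp_has_derivative
  have 1: "((\<lambda>q. blinfun_apply K (A q)) has_derivative (\<lambda>h. blinfun_apply K (A h))) (at q)"
    by (rule bounded_linear.has_derivative[OF blinfun.bounded_linear_right d[OF assms(1)]])
  show ?thesis
    by (rule has_derivative_eq_rhs[OF bounded_bilinear.FDERIV[OF bounded_bilinear_blinfun_apply
          bounded_bilinear.FDERIV[OF bounded_bilinear_blinfun_apply
          bounded_bilinear.FDERIV[OF bounded_bilinear_blinfun_apply 1 d[OF assms(2)]] d[OF assms(3)]] d[OF assms(4)]]])
      (simp add: fun_eq_iff blinfun.add_left add_ac)
qed

lemma Re_Im_r3: "Re r3 = sqrt 3" "Im r3 = 0"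
  by (simp_all add: r3_def)

lemma critical_Re:
  assumes "(f has_field_derivative D) (at 0)" "\<And>t::real. Re (f (complex_of_real t)) \<le> Re (f 0)"
  shows "Re D = 0"
proof -
  have "((\<lambda>t. f (complex_of_real t)) has_vector_derivative D) (at 0)"
    using has_vector_derivative_real_field[of f D 0] assms(1) by simp
  then have "((\<lambda>t. Re (f (complex_of_real t))) has_real_derivative Re D) (at 0)"
    by (rule has_field_derivative_Re)
  then show ?thesis
    by (rule DERIV_local_max[of _ _ _ 1]) (use assms(2) in auto)
qed

text \<open>The conclusions say that the trace form is orthogonal to the Lie algebra of \<open>SU(2)\<close>.\<close>

lemma rotation_critical:
  assumes "\<And>u. u \<in> SU2 \<Longrightarrow> Re (rep u y $ 1) + Re (rep u w $ 2) \<le> Re (y $ 1) + Re (w $ 2)"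
  shows "3 * Im (y $ 1) + Im (w $ 2) = 0" "r3 * (cnj (w $ 1) - y $ 2) + 2 * w $ 4 = 0"
proof -
  \<comment> \<open>The diagonal one-parameter group of SU(2), continued to complex \<open>z\<close>
    so that the rules for complex derivatives apply; for real \<open>z\<close> it stays in
    SU(2).\<close>
  define f where "f z = exp (\<i> * z) ^ 3 * y $ 1 + (exp (\<i> * z))\<^sup>2 * exp (- (\<i> * z)) * w $ 2" for z
  have "Re (f (complex_of_real t)) \<le> Re (f 0)" for t
  proof -
    let ?u = "su2 (exp (\<i> * complex_of_real t)) 0"
    have c: "cnj (exp (\<i> * complex_of_real t)) = exp (- (\<i> * complex_of_real t))"
      by (simp add: exp_cnj)
    have "?u \<in> SU2" by (rule su2_in_SU2) (simp add: c exp_minus_inverse)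
    from assms[OF this] show ?thesis by (simp add: f_def rep_nth c)
  qed
  moreover have "(f has_field_derivative (3 * \<i> * y $ 1 + \<i> * w $ 2)) (at 0)"
    unfolding f_def by (auto intro!: derivative_eq_intros)
  ultimately have "Re (3 * \<i> * y $ 1 + \<i> * w $ 2) = 0" by (intro critical_Re)
  then show "3 * Im (y $ 1) + Im (w $ 2) = 0" by simp
  \<comment> \<open>Rotations with off-diagonal entry \<open>\<zeta> * sin t\<close>; taking 1 and
    \<open>\<i>\<close> for \<open>\<zeta>\<close> gives the real and the imaginary part.\<close>
  have *: "Re (\<zeta> * (r3 * y $ 2 - r3 * cnj (w $ 1) - 2 * w $ 4)) = 0" if \<zeta>: "\<zeta> * cnj \<zeta> = 1" for \<zeta>
  proof -
    define f where "f z = rep (vector [vector [cos z, \<zeta> * sin z], vector [- (cnj \<zeta> * sin z), cos z]]) y $ 1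
      + rep (vector [vector [cos z, \<zeta> * sin z], vector [- (cnj \<zeta> * sin z), cos z]]) w $ 2" for z
    have "Re (f (complex_of_real t)) \<le> Re (f 0)" for t
    proof -
      let ?u = "su2 (cos (complex_of_real t)) (\<zeta> * sin (complex_of_real t))"
      have c: "cnj (cos (complex_of_real t)) = cos (complex_of_real t)" "cnj (sin (complex_of_real t)) = sin (complex_of_real t)"
        by (simp_all add: cos_of_real sin_of_real)
      have "\<zeta> * s * (cnj \<zeta> * s) = (\<zeta> * cnj \<zeta>) * (s * s)" for s by (simp only: mult_ac)
      then have "?u \<in> SU2" by (intro su2_in_SU2) (simp add: c \<zeta> flip: power2_eq_square)
      from assms[OF this] show ?thesis by (simp add: f_def su2_def c rep_nth)
    qed
    moreover have "(f has_field_derivative (r3 * \<zeta> * y $ 2 - r3 * cnj \<zeta> * w $ 1 - 2 * \<zeta> * w $ 4)) (at 0)"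
      unfolding f_def rep_nth by (auto intro!: derivative_eq_intros)
    ultimately have "Re (r3 * \<zeta> * y $ 2 - r3 * cnj \<zeta> * w $ 1 - 2 * \<zeta> * w $ 4) = 0" by (intro critical_Re)
    then show ?thesis by (simp add: algebra_simps Re_Im_r3)
  qed
  have "Re (r3 * y $ 2 - r3 * cnj (w $ 1) - 2 * w $ 4) = 0" "Im (r3 * y $ 2 - r3 * cnj (w $ 1) - 2 * w $ 4) = 0"
    using *[of 1] *[of \<i>] by simp_all
  then have "r3 * y $ 2 - r3 * cnj (w $ 1) - 2 * w $ 4 = 0" by (simp add: complex_eq_iff)
  then show "r3 * (cnj (w $ 1) - y $ 2) + 2 * w $ 4 = 0" by (simp add: algebra_simps)
qed

lemma qpol_axes:
  "qpol y (axis 1 1) (axis 1 1) (axis 3 1) = - (3/2) * y $ 3"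
  "qpol (axis 1 1) y (axis 1 1) (axis 3 1) = - (3/2) * y $ 3"
  "qpol (axis 1 1) (axis 1 1) y (axis 3 1) = - (3/2) * y $ 3"
  "qpol (axis 1 1) (axis 1 1) (axis 1 1) y = 0"
  "qpol y (axis 1 1) (axis 2 1) (axis 3 1) = - (3/4) * y $ 4"
  "qpol (axis 1 1) y (axis 2 1) (axis 3 1) = - (3/4) * y $ 4"
  "qpol (axis 1 1) (axis 1 1) (axis 2 1) y = 0"
  "qpol y (axis 2 1) (axis 2 1) (axis 4 1) = y $ 4 / 2"
  "qpol (axis 2 1) y (axis 2 1) (axis 4 1) = y $ 4 / 2"
  "qpol (axis 2 1) (axis 2 1) y (axis 4 1) = y $ 4 / 2"
  "qpol (axis 2 1) (axis 2 1) (axis 2 1) y = - r3 * y $ 3"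
  "qpol y (axis 4 1) (axis 4 1) (axis 4 1) = r3 * y $ 1"
  "qpol (axis 1 1) y (axis 4 1) (axis 4 1) = r3 * y $ 4"
  "qpol (axis 1 1) (axis 4 1) y (axis 4 1) = r3 * y $ 4"
  "qpol (axis 1 1) (axis 4 1) (axis 4 1) y = r3 * y $ 4"
  by (simp_all add: qpol_def perm4_def axis_def r3_def[symmetric])

context hyper_hermitian_8
begin

lemma bounded_linear_J2: "bounded_linear J2"
  using linear_J(2) by (simp add: linear_conv_bounded_linear)

lemma bounded_bilinear_herm: "bounded_bilinear herm"
  unfolding bilinear_conv_bounded_bilinear[symmetric] bilinear_def
  by (auto intro!: linearI simp: scaleR_conv_of_real)

lemma bounded_linear_crd_nth: "bounded_linear (\<lambda>v. crd p v $ \<alpha>)"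
  using bounded_linear_compose[OF bounded_linear_vec_nth, of "crd p"] crd_linear[of p]
  by (simp add: linear_conv_bounded_linear)

text \<open>Writes the polarised quartic through the bounded multilinear map \<open>K_of p\<close>,
  from which its smoothness and its derivative are read off.\<close>

lemma tp_tensor:
  "tp p x y z w = complex_of_real (4 * (K_of p x (J2 y) z (J2 w) - K_of p x (J1 (J2 y)) z (J1 (J2 w)))) +
    \<i> * complex_of_real (4 * (K_of p x (J2 y) z (J1 (J2 w)) + K_of p x (J1 (J2 y)) z (J2 w)))"
  unfolding curv_form_K_of[symmetric] curv_form_def by (simp add: complex_eq_iff)

lemma bounded_linear_J_comp:
  assumes "bounded_linear A" shows "bounded_linear (\<lambda>q. J2 (A q))" "bounded_linear (\<lambda>q. J1 (J2 (A q)))"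
proof -
  show *: "bounded_linear (\<lambda>q. J2 (A q))" by (rule bounded_linear_compose[OF bounded_linear_J2 assms])
  have "bounded_linear J1" using linear_J(1) by (simp add: linear_conv_bounded_linear)
  from bounded_linear_compose[OF this *] show "bounded_linear (\<lambda>q. J1 (J2 (A q)))" .
qed

lemma tp_has_derivative:
  assumes "bounded_linear A" "bounded_linear B" "bounded_linear C" "bounded_linear E"
  shows "((\<lambda>q. tp p (A q) (B q) (C q) (E q)) has_derivative
    (\<lambda>h. tp p (A h) (B q) (C q) (E q) + tp p (A q) (B h) (C q) (E q)
       + tp p (A q) (B q) (C h) (E q) + tp p (A q) (B q) (C q) (E h))) (at q)"
proof -
  note J = bounded_linear_J_comp
  note d = tensor4_has_derivative[where K = "K_of p" and q = q, OF assms(1) J(1)[OF assms(2)] assms(3) J(1)[OF assms(4)]]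
    tensor4_has_derivative[where K = "K_of p" and q = q, OF assms(1) J(2)[OF assms(2)] assms(3) J(2)[OF assms(4)]]
    tensor4_has_derivative[where K = "K_of p" and q = q, OF assms(1) J(1)[OF assms(2)] assms(3) J(2)[OF assms(4)]]
    tensor4_has_derivative[where K = "K_of p" and q = q, OF assms(1) J(2)[OF assms(2)] assms(3) J(1)[OF assms(4)]]
  show ?thesis
    unfolding tp_tensor
    by (rule has_derivative_eq_rhs[OF has_derivative_add[OF
        has_derivative_of_real[OF has_derivative_mult_right[OF has_derivative_diff[OF d(1,2)]]]
        has_derivative_mult_right[OF has_derivative_of_real[OF has_derivative_mult_right[OF has_derivative_add[OF d(3,4)]]]]]])
      (simp add: fun_eq_iff complex_eq_iff algebra_simps)
qed

lemma tp_smooth: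
  assumes "bounded_linear A" "bounded_linear B" "bounded_linear C" "bounded_linear E"
  shows "smooth_on UNIV (\<lambda>q. tp p (A q) (B q) (C q) (E q))"
  unfolding tp_tensor
  by (intro smooth_on_add smooth_on_diff smooth_on_mult smooth_on_const open_UNIV
      smooth_on_linear_compose[OF _ bounded_linear_of_real] smooth_on_blinfun_apply
      smooth_on_bounded_linear assms bounded_linear_J_comp)

lemma adj_smooth: "smooth_on UNIV (adj p)"
proof (rule smooth_on_blinfun[OF open_UNIV])
  fix v
  have lin: "bounded_linear (\<lambda>w. cs (herm v w) b)" for b
    unfolding linear_conv_bounded_linear[symmetric]
    by (rule linearI) (simp_all add: cs_linear flip: scaleR_conv_of_real)
  have "smooth_on UNIV (\<lambda>a. \<Sum>\<alpha>\<in>UNIV. cs (herm v (blinfun_apply a (bas p \<alpha>))) (bas p \<alpha>))"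
    by (intro smooth_on_sum smooth_on_linear_compose[OF _ lin] open_UNIV smooth_on_blinfun_apply smooth_on_id smooth_on_const)
  then show "smooth_on UNIV (\<lambda>a. adj p a v)" by (simp add: adj_apply mk_def)
qed

lemma change_smooth: "smooth_on UNIV (change p)"
proof (rule smooth_on_blinfun[OF open_UNIV])
  fix v
  have "linear (\<lambda>q. mk q (crd p v))"
    by (rule linearI) (simp_all add: mk_eq cs_linear algebra_simps)
  then show "smooth_on UNIV (\<lambda>q. change p q v)"
    unfolding change_apply by (intro smooth_on_bounded_linear open_UNIV) (simp add: linear_conv_bounded_linear)
qed

lemma orbit_map_smooth: "smooth_on UNIV (orbit_map p)"
  unfolding orbit_map_def by (intro smooth_on_pull adj_smooth smooth_on_const open_UNIV)

text \<open>Up to multinomial factors the coefficients of \<open>x1^3 x3\<close>,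
  \<open>x1^2 x2 x3\<close>, \<open>x2^3 x4\<close> and the imaginary part of that of
  \<open>x1 x4^3\<close>: three complex and one real number, all zero for \<open>K_of p\<close>.
  They are chosen to make the derivative in \<open>slice_map_derivative\<close> injective.\<close>

definition coefs :: "'v \<times> 'v \<Rightarrow> 'v tensor4 \<Rightarrow> complex \<times> complex \<times> complex \<times> real" where
  "coefs p K = (curv_form K (fst p) (fst p) (fst p) (J2 (fst p)), curv_form K (fst p) (fst p) (snd p) (J2 (fst p)),
     curv_form K (snd p) (snd p) (snd p) (J2 (snd p)), Im (curv_form K (fst p) (J2 (snd p)) (J2 (snd p)) (J2 (snd p))))"

text \<open>On frames the first four components are constant and the coefficients in the last one are
  those of the transformed quartic; the middle ones fix the choice within a coset.\<close>

definition slice_map :: "'v \<times> 'v \<Rightarrow> 'v \<times> 'v \<Rightarrow>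
    (real \<times> real \<times> complex \<times> complex) \<times> (real \<times> complex) \<times> (complex \<times> complex \<times> complex \<times> real)" where
  "slice_map p q =
     ((Re (herm (fst q) (fst q)), Re (herm (snd q) (snd q)), herm (fst q) (snd q), herm (fst q) (J2 (snd q))),
      (3 * Im (crd p (fst q) $ 1) + Im (crd p (snd q) $ 2), r3 * (cnj (crd p (snd q) $ 1) - crd p (fst q) $ 2) + 2 * crd p (snd q) $ 4),
      (tp p (fst q) (fst q) (fst q) (J2 (fst q)), tp p (fst q) (fst q) (snd q) (J2 (fst q)),
       tp p (snd q) (snd q) (snd q) (J2 (snd q)), Im (tp p (fst q) (J2 (snd q)) (J2 (snd q)) (J2 (snd q)))))"

lemma frame_iff_slice_map: "frame q \<longleftrightarrow> fst (slice_map p q) = (1, 1, 0, 0)"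
  by (auto simp: frame_def slice_map_def herm_def complex_eq_iff)

text \<open>The fixed quartic in the moving pair \<open>q\<close> has the same coefficients as the
  pulled-back tensor in the fixed frame, so on the orbit they depend on the tensor alone.\<close>

lemma coefs_pull: "snd (snd (slice_map p q)) = coefs p (pull (change p q) (K_of p))" if p: "frame p"
proof -
  let ?c = "change p q"
  have c: "?c (J1 v) = J1 (?c v)" "?c (J2 v) = J2 (?c v)" for v
    by (simp_all add: change_apply crd_J1 mk_smult cs_linear crd_J2 mk_jq)
  have "curv_form (pull ?c (K_of p)) x y z w = tp p (?c x) (?c y) (?c z) (?c w)" for x y z w
    unfolding curv_form_K_of[symmetric] by (simp add: curv_form_def pull_apply c)
  then show ?thesis by (simp add: slice_map_def coefs_def c change_frame[OF p])
qed

lemma slice_map_smooth: "smooth_on UNIV (slice_map p)"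
proof -
  note bl = bounded_linear_fst bounded_linear_snd bounded_linear_J_comp(1)
  note her = bounded_bilinear.smooth_on_bilinear[OF bounded_bilinear_herm]
  show ?thesis
    unfolding slice_map_def
    by (intro smooth_on_Pair smooth_on_add smooth_on_diff smooth_on_mult smooth_on_const open_UNIV tp_smooth her
        smooth_on_linear_compose[OF _ bounded_linear_Re] smooth_on_linear_compose[OF _ bounded_linear_Im]
        smooth_on_linear_compose[OF _ bounded_linear_cnj] smooth_on_linear_compose[OF _ bounded_linear_crd_nth]
        smooth_on_bounded_linear bl)
qed

lemma slice_map_derivative:
  assumes p: "frame p"
  obtains D where "(slice_map p has_derivative D) (at p)" "inj D"
proof -
  note bl = bounded_linear_fst bounded_linear_snd bounded_linear_J_comp(1)[OF bounded_linear_fst] bounded_linear_J_comp(1)[OF bounded_linear_snd]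
  note d = bounded_linear_imp_has_derivative
  note H = bounded_bilinear.FDERIV[OF bounded_bilinear_herm d d, where s = UNIV and x = p]
  note tpd = tp_has_derivative[where q = p and p = p]
  let ?D = "\<lambda>h. ((Re (herm (fst p) (fst h) + herm (fst h) (fst p)), Re (herm (snd p) (snd h) + herm (snd h) (snd p)),
        herm (fst p) (snd h) + herm (fst h) (snd p), herm (fst p) (J2 (snd h)) + herm (fst h) (J2 (snd p))),
      (3 * Im (crd p (fst h) $ 1) + Im (crd p (snd h) $ 2),
       r3 * (cnj (crd p (snd h) $ 1) - crd p (fst h) $ 2) + 2 * crd p (snd h) $ 4),
      (tp p (fst h) (fst p) (fst p) (J2 (fst p)) + tp p (fst p) (fst h) (fst p) (J2 (fst p)) + tp p (fst p) (fst p) (fst h) (J2 (fst p))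
         + tp p (fst p) (fst p) (fst p) (J2 (fst h)),
       tp p (fst h) (fst p) (snd p) (J2 (fst p)) + tp p (fst p) (fst h) (snd p) (J2 (fst p)) + tp p (fst p) (fst p) (snd h) (J2 (fst p))
         + tp p (fst p) (fst p) (snd p) (J2 (fst h)),
       tp p (snd h) (snd p) (snd p) (J2 (snd p)) + tp p (snd p) (snd h) (snd p) (J2 (snd p)) + tp p (snd p) (snd p) (snd h) (J2 (snd p))
         + tp p (snd p) (snd p) (snd p) (J2 (snd h)),
       Im (tp p (fst h) (J2 (snd p)) (J2 (snd p)) (J2 (snd p)) + tp p (fst p) (J2 (snd h)) (J2 (snd p)) (J2 (snd p))
         + tp p (fst p) (J2 (snd p)) (J2 (snd h)) (J2 (snd p)) + tp p (fst p) (J2 (snd p)) (J2 (snd p)) (J2 (snd h)))))"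
  have crd_fs: "bounded_linear (\<lambda>q::'v \<times> 'v. crd p (fst q) $ \<alpha>)" "bounded_linear (\<lambda>q::'v \<times> 'v. crd p (snd q) $ \<alpha>)" for \<alpha>
    by (rule bounded_linear_compose[OF bounded_linear_crd_nth bounded_linear_fst],
        rule bounded_linear_compose[OF bounded_linear_crd_nth bounded_linear_snd])
  have D: "(slice_map p has_derivative ?D) (at p)"
    unfolding slice_map_def
    by (intro has_derivative_Pair bounded_linear.has_derivative[OF bounded_linear_Re] bounded_linear.has_derivative[OF bounded_linear_Im]
        H bl tpd has_derivative_add has_derivative_diff has_derivative_mult_right bounded_linear.has_derivative[OF bounded_linear_cnj]
        d[OF crd_fs(1)] d[OF crd_fs(2)])
  have "h = 0" if h: "?D h = 0" for h
  proof -
    define y w where "y = crd p (fst h)" and "w = crd p (snd h)"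
    have crp: "crd p (fst p) = axis 1 1" "crd p (snd p) = axis 2 1" "jq (axis 1 1) = axis 3 1" "jq (axis 2 1) = axis 4 1"
      using crd_bas[OF p, of 1] crd_bas[OF p, of 2] by (simp_all add: vec4_eq_iff axis_def)
    have hy: "herm (fst p) v = cnj (crd p v $ 1)" "herm v (fst p) = crd p v $ 1" "herm (snd p) v = cnj (crd p v $ 2)"
      "herm v (snd p) = crd p v $ 2" "herm v (J2 (snd p)) = crd p v $ 4" for v
      by (simp_all add: crd_def herm_cnj)
    \<comment> \<open>In this order: the linearised frame conditions, the trace conditions, the
      coefficients.\<close>
    have e: "Re (y $ 1) = 0" "Re (w $ 2) = 0" "cnj (w $ 1) + y $ 2 = 0" "y $ 4 - w $ 3 = 0"
      "3 * Im (y $ 1) + Im (w $ 2) = 0" "r3 * (cnj (w $ 1) - y $ 2) + 2 * w $ 4 = 0"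
      "y $ 3 = 0" "- (w $ 3) = y $ 4" "3 * w $ 4 = r3 * (2 * cnj (w $ 1))" "Im (y $ 1) = 3 * Im (w $ 2)"
      using h unfolding y_def w_def
      by (simp_all add: zero_prod_def hy tp_def crd_J2 crp qpol_axes algebra_simps Re_Im_r3)
    \<comment> \<open>Along SU(2) the equations \<open>e(3)\<close> and \<open>e(9)\<close> hold,
      with \<open>w $ 4\<close> a positive multiple of \<open>cnj (w $ 1)\<close>. The trace
      condition \<open>e(6)\<close> makes the multiple negative, so both vanish.\<close>
    have w1: "w $ 1 = 0"
    proof -
      have y2: "y $ 2 = - cnj (w $ 1)" using e(3) by (simp add: add_eq_0_iff2)
      have "2 * (r3 * cnj (w $ 1)) + 2 * w $ 4 = 0" using e(6) by (simp add: y2 algebra_simps)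
      then have "w $ 4 = - (r3 * cnj (w $ 1))" by (simp add: add_eq_0_iff)
      then have "r3 * cnj (w $ 1) = 0" using e(9) by simp
      then show ?thesis by simp
    qed
    have 2: "y $ 2 = 0" "w $ 4 = 0" using e(3,9) w1 by simp_all
    have y4: "y $ 4 = w $ 3" using e(4) by simp
    have "- (w $ 3) = w $ 3" using e(8) unfolding y4 .
    then have "w $ 3 = 0" by (simp add: complex_eq_iff)
    then have 4: "y $ 4 = 0" "w $ 3 = 0" using y4 by simp_all
    \<comment> \<open>Likewise \<open>e(10)\<close> is the diagonal direction of SU(2), with weights
      3 and 1, and \<open>e(5)\<close> is orthogonality to it.\<close>
    have 1: "y $ 1 = 0" "w $ 2 = 0" using e(1,2,5,10) by (auto simp: complex_eq_iff)
    have "y = 0" "w = 0" using w1 2 4 1 e(7) by (simp_all add: vec4_eq_iff)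
    then have "fst h = 0" "snd h = 0"
      using crd_inj[OF p, of _ 0] linear_0[OF crd_linear, of p] unfolding y_def w_def by metis+
    then show ?thesis by (simp add: prod_eq_iff)
  qed
  then have "inj ?D" using linear_injective_0[OF has_derivative_linear[OF D]] by blast
  then show ?thesis using that D by blast
qed

section \<open>Compactness and coset representatives of largest trace\<close>

lemma herm_self_crd: "frame p \<Longrightarrow> herm v v = complex_of_real (\<Sum>\<alpha>\<in>UNIV. (cmod (crd p v $ \<alpha>))\<^sup>2)"
  by (simp add: herm_crd complex_norm_square[symmetric])

lemma compact_frames: "compact {q. frame q}"
proof -
  obtain p where p: "frame p" by (rule frame_exists)
  let ?B = "mk p ` cball 0 1"
  have "compact ?B"
    using linear_continuous_on[of "mk p"] mk_linear[of p]
    by (intro compact_continuous_image) (auto simp: linear_conv_bounded_linear)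
  then have cB: "compact (?B \<times> ?B)" by (intro compact_Times)
  have unit: "v \<in> ?B" if "herm v v = 1" for v
  proof -
    have "(\<Sum>\<alpha>\<in>UNIV. (cmod (crd p v $ \<alpha>))\<^sup>2) = 1"
      using that herm_self_crd[OF p, of v] by (metis of_real_eq_1_iff)
    then have "norm (crd p v) \<le> 1" by (simp add: norm_vec_def L2_set_def)
    then show ?thesis using mk_crd[OF p, of v] by (intro image_eqI[of _ _ "crd p v"]) auto
  qed
  have sub: "{q. frame q} \<subseteq> ?B \<times> ?B"
    using unit by (auto simp: frame_def)
  have "continuous_on UNIV (\<lambda>q. fst (slice_map p q))"
    using smooth_on_continuous[OF slice_map_smooth] by (rule continuous_on_fst)
  then have "closed ((\<lambda>q. fst (slice_map p q)) -` {(1, 1, 0, 0)})"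
    by (intro closed_vimage) auto
  moreover have "(\<lambda>q. fst (slice_map p q)) -` {(1, 1, 0, 0)} = {q. frame q}"
    by (auto simp: frame_iff_slice_map[of _ p])
  ultimately show ?thesis using cB sub by (metis closed_Int_compact inf.absorb1 Int_commute)
qed

lemma Sp2_eq_image: "frame p \<Longrightarrow> G = change p ` {q. frame q}"
  using change_in_Sp2 Sp2_eq_change frame_Sp2 by blast

lemma compact_Sp2: "compact G"
proof -
  obtain p where p: "frame p" by (rule frame_exists)
  have "continuous_on {q. frame q} (change p)"
    using smooth_on_continuous[OF change_smooth] continuous_on_subset by blast
  then show ?thesis
    unfolding Sp2_eq_image[OF p] using compact_frames by (rule compact_continuous_image)
qed

lemma in_ir_iff:
  assumes "frame p" "a \<in> G" shows "a \<in> ir p \<longleftrightarrow> orbit_map p a = K_of p"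
  by (simp only: stabiliser_eq_ir[OF assms(1)] mem_Collect_eq assms(2) simp_thms orbit_map_eq[OF assms])

lemma compact_ir: "frame p \<Longrightarrow> compact (ir p)"
proof -
  assume p: "frame p"
  have "closed (orbit_map p -` {K_of p})"
    using smooth_on_continuous[OF orbit_map_smooth] by (intro closed_vimage) auto
  moreover have "ir p = G \<inter> orbit_map p -` {K_of p}"
    using in_ir_iff[OF p] by (auto simp: ir_def)
  ultimately show ?thesis using compact_Sp2 by (simp add: compact_Int_closed)
qed

lemma adj_adj: "frame p \<Longrightarrow> a \<in> G \<Longrightarrow> adj p (adj p a) = a"
proof (rule blinfun_eqI)
  fix v assume p: "frame p" and a: "a \<in> G"
  show "adj p (adj p a) v = a v"
    using adj_left[OF Sp2_adj[OF a p] p, of "a v"] adj_left[OF a p, of v] by simp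
qed

lemma pull_ir:
  assumes p: "frame p" and c: "c \<in> G" shows "pull c (K_of p) = K_of p \<longleftrightarrow> c \<in> ir p"
proof -
  have "pull c (K_of p) = orbit_map p (adj p c)" by (simp add: orbit_map_def adj_adj[OF p c])
  then have "pull c (K_of p) = K_of p \<longleftrightarrow> adj p c \<in> ir p"
    using in_ir_iff[OF p Sp2_adj[OF c p]] by simp
  also have "\<dots> \<longleftrightarrow> c \<in> ir p" using ir_adj[OF p, of c] ir_adj[OF p, of "adj p c"] adj_adj[OF p c] by auto
  finally show ?thesis .
qed

text \<open>For an operator commuting with \<open>J1\<close> and \<open>J2\<close>, the diagonal
  entries 3 and 4 are the conjugates of the entries 1 and 2, so this is half the real part of the
  complex trace.\<close>

definition half_trace :: "'v \<times> 'v \<Rightarrow> ('v \<Rightarrow>\<^sub>L 'v) \<Rightarrow> real" where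
  "half_trace p c = Re (crd p (c (fst p)) $ 1) + Re (crd p (c (snd p)) $ 2)"

lemma half_trace_continuous: "continuous_on S (\<lambda>c. half_trace p (h o\<^sub>L c))" "continuous_on S (\<lambda>c. half_trace p (c o\<^sub>L h))"
  "continuous_on S (half_trace p)"
proof -
  have "bounded_linear (\<lambda>c. Re (crd p (blinfun_apply c v) $ \<alpha>))" for v \<alpha>
    by (rule bounded_linear_compose[OF bounded_linear_compose[OF bounded_linear_Re bounded_linear_crd_nth] blinfun.bounded_linear_left])
  then have *: "continuous_on S (half_trace p)" for S
    unfolding half_trace_def by (intro continuous_on_add linear_continuous_on)
  have "continuous_on S (\<lambda>c. h o\<^sub>L c)" "continuous_on S (\<lambda>c. c o\<^sub>L h)"
    by (auto intro!: linear_continuous_on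
        bounded_bilinear.bounded_linear_right[OF bounded_bilinear_blinfun_compose]
        bounded_bilinear.bounded_linear_left[OF bounded_bilinear_blinfun_compose])
  then show "continuous_on S (\<lambda>c. half_trace p (h o\<^sub>L c))" "continuous_on S (\<lambda>c. half_trace p (c o\<^sub>L h))"
    by (auto intro!: continuous_on_compose2[OF *[of UNIV]])
  show "continuous_on S (half_trace p)" by (rule *)
qed

text \<open>All maximisers are kept and none is selected: closed conditions then give a compact set.
  The competitors \<open>h o\<^sub>L c\<close> are those with the same pulled-back tensor
  \<open>pull c (K_of p)\<close>.\<close>

definition maximal :: "'v \<times> 'v \<Rightarrow> ('v \<Rightarrow>\<^sub>L 'v) set" where
  "maximal p = {c \<in> G. \<forall>h\<in>ir p. half_trace p (h o\<^sub>L c) \<le> half_trace p c}"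

lemma compact_maximal: "compact (maximal p)"
proof -
  have "closed {c. half_trace p (h o\<^sub>L c) \<le> half_trace p c}" for h
    by (intro closed_Collect_le half_trace_continuous)
  then have "closed (\<Inter>h\<in>ir p. {c. half_trace p (h o\<^sub>L c) \<le> half_trace p c})" by auto
  moreover have "maximal p = G \<inter> (\<Inter>h\<in>ir p. {c. half_trace p (h o\<^sub>L c) \<le> half_trace p c})"
    by (auto simp: maximal_def)
  ultimately show ?thesis using compact_Sp2 by (simp add: compact_Int_closed)
qed

lemma ex_maximal:
  assumes p: "frame p" and c: "c \<in> G"
  obtains c' where "c' \<in> maximal p" "pull c' (K_of p) = pull c (K_of p)"
proof -
  have "pull id_blinfun (K_of p) = K_of p" by (rule tensor4_eqI) (simp add: pull_apply)
  then have "id_blinfun \<in> ir p" using pull_ir[OF p id_in_Sp2] by simp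
  then have ne: "ir p \<noteq> {}" by blast
  obtain h where h: "h \<in> ir p" "\<forall>k\<in>ir p. half_trace p (k o\<^sub>L c) \<le> half_trace p (h o\<^sub>L c)"
    using continuous_attains_sup[OF compact_ir[OF p] ne half_trace_continuous(2)[of "ir p" p c]] by blast
  have hG: "h \<in> G" using h(1) by (simp add: ir_def)
  show ?thesis
  proof (rule that[of "h o\<^sub>L c"])
    have "half_trace p (k o\<^sub>L (h o\<^sub>L c)) \<le> half_trace p (h o\<^sub>L c)" if "k \<in> ir p" for k
    proof -
      have "k o\<^sub>L (h o\<^sub>L c) = (k o\<^sub>L h) o\<^sub>L c" by (rule blinfun_eqI) simp
      then show ?thesis using h(2) ir_compose[OF that h(1)] by simp
    qed
    then show "h o\<^sub>L c \<in> maximal p" using Sp2_compose[OF hG c] by (simp add: maximal_def)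
    have "pull (h o\<^sub>L c) (K_of p) = pull c (pull h (K_of p))" by (rule pull_compose[symmetric])
    then show "pull (h o\<^sub>L c) (K_of p) = pull c (K_of p)"
      using pull_ir[OF p hG] h(1) by simp
  qed
qed

lemma maximal_slice:
  assumes p: "frame p" and c: "c \<in> maximal p"
  shows "slice_map p (move c p) = ((1, 1, 0, 0), (0, 0), coefs p (pull c (K_of p)))"
proof -
  have cG: "c \<in> G" using c by (simp add: maximal_def)
  let ?y = "crd p (c (fst p))" and ?w = "crd p (c (snd p))"
  have "Re (rep u ?y $ 1) + Re (rep u ?w $ 2) \<le> Re (?y $ 1) + Re (?w $ 2)" if u: "u \<in> SU2" for u
  proof -
    obtain h where h: "h \<in> ir p" "\<And>v. crd p (h v) = rep u (crd p v)" using lift_SU2[OF p u] by metis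
    then have "half_trace p (h o\<^sub>L c) \<le> half_trace p c" using c by (simp add: maximal_def)
    then show ?thesis by (simp add: half_trace_def h(2))
  qed
  from rotation_critical[OF this]
  have "fst (snd (slice_map p (move c p))) = (0, 0)" by (simp add: slice_map_def)
  moreover have "fst (slice_map p (move c p)) = (1, 1, 0, 0)"
    using frame_Sp2[OF cG p] frame_iff_slice_map by blast
  moreover have "snd (snd (slice_map p (move c p))) = coefs p (pull c (K_of p))"
    using coefs_pull[OF p] Sp2_eq_change[OF cG p] by simp
  ultimately show ?thesis by (metis prod.collapse)
qed

text \<open>A stabiliser element competes with the identity, whose half trace 2 is the largest
  possible value, as coordinates of unit vectors have real part at most 1. Equality forces both
  diagonal entries to be 1.\<close>

lemma maximal_stabiliser:
  assumes p: "frame p" and c: "c \<in> maximal p" "pull c (K_of p) = K_of p"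
  shows "move c p = p"
proof -
  have cG: "c \<in> G" using c by (simp add: maximal_def)
  have crp: "crd p (fst p) = axis 1 1" "crd p (snd p) = axis 2 1"
    using crd_bas[OF p, of 1] crd_bas[OF p, of 2] by simp_all
  have "adj p c \<in> ir p" using ir_adj[OF p] pull_ir[OF p cG] c(2) by blast
  then have "half_trace p (adj p c o\<^sub>L c) \<le> half_trace p c" using c(1) by (simp add: maximal_def)
  then have tr: "2 \<le> half_trace p c"
    by (simp add: half_trace_def adj_left[OF cG p] crp axis_def)
  have unit: "crd p v = axis \<alpha> 1" if "herm v v = 1" "1 \<le> Re (crd p v $ \<alpha>)" for v \<alpha>
  proof -
    have s1: "(\<Sum>\<beta>\<in>UNIV. (cmod (crd p v $ \<beta>))\<^sup>2) = 1"
      using that(1) herm_self_crd[OF p, of v] by (metis of_real_eq_1_iff)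
    have "1 \<le> (cmod (crd p v $ \<alpha>))\<^sup>2"
      using that(2) complex_Re_le_cmod[of "crd p v $ \<alpha>"] by (smt (verit) one_le_power)
    moreover have "(\<Sum>\<beta>\<in>UNIV. (cmod (crd p v $ \<beta>))\<^sup>2) = (cmod (crd p v $ \<alpha>))\<^sup>2 + (\<Sum>\<beta>\<in>UNIV-{\<alpha>}. (cmod (crd p v $ \<beta>))\<^sup>2)"
      by (simp add: sum.remove)
    moreover have "0 \<le> (\<Sum>\<beta>\<in>UNIV-{\<alpha>}. (cmod (crd p v $ \<beta>))\<^sup>2)" by (simp add: sum_nonneg)
    ultimately have 1: "(\<Sum>\<beta>\<in>UNIV-{\<alpha>}. (cmod (crd p v $ \<beta>))\<^sup>2) = 0" "(cmod (crd p v $ \<alpha>))\<^sup>2 = 1" using s1 by linarith+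
    then have 2: "crd p v $ \<beta> = 0" if "\<beta> \<noteq> \<alpha>" for \<beta>
      using that by (simp add: sum_nonneg_eq_0_iff)
    have "(Re (crd p v $ \<alpha>))\<^sup>2 + (Im (crd p v $ \<alpha>))\<^sup>2 = 1" using 1(2) by (simp add: cmod_power2)
    moreover have "1 \<le> (Re (crd p v $ \<alpha>))\<^sup>2" using that(2) by (simp add: one_le_power)
    moreover have "Re (crd p v $ \<alpha>) \<le> 1"
      using complex_Re_le_cmod[of "crd p v $ \<alpha>"] 1(2) norm_ge_zero[of "crd p v $ \<alpha>"]
      by (auto simp: power2_eq_1_iff)
    ultimately have "Im (crd p v $ \<alpha>) = 0" "Re (crd p v $ \<alpha>) = 1"
      using that(2) zero_le_power2[of "Im (crd p v $ \<alpha>)"] by (auto simp: power2_eq_1_iff)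
    then show ?thesis using 2 by (auto simp: vec_eq_iff axis_def complex_eq_iff)
  qed
  have le1: "Re (crd p v $ \<alpha>) \<le> 1" if "herm v v = 1" for v \<alpha>
  proof (rule ccontr)
    assume *: "\<not> ?thesis"
    then have "crd p v = axis \<alpha> 1" using unit[OF that, of \<alpha>] by simp
    with * show False by (simp add: axis_def)
  qed
  have h1: "herm (c (fst p)) (c (fst p)) = 1" "herm (c (snd p)) (c (snd p)) = 1"
    using p by (simp_all add: Sp2_commute(4)[OF cG] frame_def)
  have "1 \<le> Re (crd p (c (fst p)) $ 1)" "1 \<le> Re (crd p (c (snd p)) $ 2)"
    using tr le1[OF h1(1), of 1] le1[OF h1(2), of 2] unfolding half_trace_def by linarith+
  then have "crd p (c (fst p)) = axis 1 1" "crd p (c (snd p)) = axis 2 1"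
    using unit h1 by blast+
  then show ?thesis using crp crd_inj[OF p] by (metis prod.collapse)
qed

lemma coefs_smooth: "smooth_on UNIV (coefs p)"
proof -
  have "bounded_linear (\<lambda>K::'v tensor4. K x y z w)" for x y z w
    by (intro bounded_linear_compose[OF blinfun.bounded_linear_left] blinfun.bounded_linear_left)
  note t = smooth_on_bounded_linear[OF open_UNIV this]
  have cf: "smooth_on UNIV (\<lambda>K. curv_form K x y z w)" for x y z w
  proof -
    have "curv_form K x y z w = complex_of_real (4 * (K x (J2 y) z (J2 w) - K x (J1 (J2 y)) z (J1 (J2 w)))) +
        \<i> * complex_of_real (4 * (K x (J2 y) z (J1 (J2 w)) + K x (J1 (J2 y)) z (J2 w)))" for K
      by (simp add: curv_form_def complex_eq_iff)
    then show ?thesis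
      by (simp only:) (intro smooth_on_add smooth_on_diff smooth_on_mult smooth_on_const open_UNIV
          smooth_on_linear_compose[OF _ bounded_linear_of_real] t)
  qed
  show ?thesis
    unfolding coefs_def
    by (intro smooth_on_Pair cf open_UNIV smooth_on_linear_compose[OF _ bounded_linear_Im])
qed

lemma base_slice:
  assumes p: "frame p"
  shows "\<exists>U N s. K_of p \<in> U \<and> is_slice G (orbit_map p) U (coefs p) N s"
proof -
  obtain D where D: "(slice_map p has_derivative D) (at p)" "inj D" by (rule slice_map_derivative[OF p])
  \<comment> \<open>The target has 6 + 3 + 7 real dimensions: frame conditions, trace conditions,
    coefficients.\<close>
  have dims: "DIM('v \<times> 'v) = CARD(16)"
    "DIM((real \<times> real \<times> complex \<times> complex) \<times> (real \<times> complex) \<times> (complex \<times> complex \<times> complex \<times> real)) = CARD(16)"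
    using dim8 by simp_all
  obtain Q T f where Q: "open Q" "p \<in> Q" "open T" "slice_map p p \<in> T" "smooth_on T f"
    "\<And>q. q \<in> Q \<Longrightarrow> slice_map p q \<in> T \<and> f (slice_map p q) = q"
    "\<And>y. y \<in> T \<Longrightarrow> f y \<in> Q \<and> slice_map p (f y) = y"
    by (rule smooth_inverse_function[OF slice_map_smooth D dims]) (rule that; assumption)
  \<comment> \<open>The maximal elements that leave the domain of the local inverse. Their tensors
    form a compact set, which by \<open>maximal_stabiliser\<close> misses \<open>K_of p\<close>; its
    complement is the neighbourhood \<open>U1\<close>.\<close>
  define bad where "bad = maximal p \<inter> (\<lambda>c. move c p) -` (- Q)"
  have "continuous_on UNIV (\<lambda>c. move c p)"
    by (intro continuous_on_Pair linear_continuous_on blinfun.bounded_linear_left)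
  then have "closed ((\<lambda>c. move c p) -` (- Q))"
    using Q(1) by (intro closed_vimage) auto
  then have "compact bad" unfolding bad_def using compact_maximal by (simp add: compact_Int_closed)
  then have "compact ((\<lambda>c. pull c (K_of p)) ` bad)" by (intro compact_continuous_image pull_continuous)
  then have U1: "open (- ((\<lambda>c. pull c (K_of p)) ` bad))" by (simp add: compact_imp_closed open_Compl)
  define U1 where "U1 = - ((\<lambda>c. pull c (K_of p)) ` bad)"
  have K0: "K_of p \<in> U1"
    unfolding U1_def bad_def using maximal_stabiliser[OF p] Q(2) by (auto simp: image_iff)
  \<comment> \<open>Prescribes the values of a frame and zero trace conditions, and leaves the seven
    coefficients free.\<close>
  define emb :: "complex \<times> complex \<times> complex \<times> real \<Rightarrow> _"
    where "emb z = ((1::real, 1::real, 0::complex, 0::complex), (0::real, 0::complex), z)" for z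
  have emb_smooth: "smooth_on S emb" if "open S" for S
    unfolding emb_def by (intro smooth_on_Pair smooth_on_const smooth_on_id that)
  define N0 where "N0 = emb -` T"
  have N0: "open N0" unfolding N0_def
    using Q(3) smooth_on_continuous[OF emb_smooth[OF open_UNIV]] by (rule open_vimage)
  define c where "c z = change p (f (emb z))" for z
  have fe: "smooth_on N0 (\<lambda>z. f (emb z))"
    by (rule smooth_on_compose[OF N0 Q(3) emb_smooth[OF N0] _ Q(5)]) (auto simp: N0_def)
  have c_smooth: "smooth_on N0 c"
    unfolding c_def by (rule smooth_on_compose[OF N0 open_UNIV fe _ change_smooth]) simp
  have fr: "frame (f (emb z))" "coefs p (pull (c z) (K_of p)) = z" if "z \<in> N0" for z
  proof -
    have "slice_map p (f (emb z)) = emb z" using Q(7) that by (simp add: N0_def)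
    then show "frame (f (emb z))" "coefs p (pull (c z) (K_of p)) = z"
      using frame_iff_slice_map[of "f (emb z)" p] coefs_pull[OF p, of "f (emb z)"] by (simp_all add: emb_def c_def)
  qed
  have cG: "c z \<in> G" if "z \<in> N0" for z
    unfolding c_def by (rule change_in_Sp2[OF p fr(1)[OF that]])
  have Kz: "continuous_on N0 (\<lambda>z. pull (c z) (K_of p))"
    by (intro smooth_on_continuous smooth_on_pull N0 c_smooth smooth_on_const)
  define N where "N = N0 \<inter> (\<lambda>z. pull (c z) (K_of p)) -` U1"
  have N: "open N" unfolding N_def using continuous_open_preimage[OF Kz N0] U1 by (simp add: U1_def)
  define U where "U = U1 \<inter> coefs p -` N0"
  have U: "open U" unfolding U_def U1_def
    by (intro open_Int U1 open_vimage[OF N0 smooth_on_continuous[OF coefs_smooth]])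
  \<comment> \<open>The orbit map pulls back along the inverse, so the section consists of the
    inverses of \<open>c z\<close>.\<close>
  define s where "s z = adj p (c z)" for z
  have sN: "s z \<in> G" "orbit_map p (s z) = pull (c z) (K_of p)" if "z \<in> N0" for z
    using Sp2_adj[OF cG[OF that] p] adj_adj[OF p cG[OF that]] by (simp_all add: s_def orbit_map_def)
  have key: "coefs p K \<in> N0 \<and> pull (c (coefs p K)) (K_of p) = K" if K: "K \<in> orbit_map p ` G" "K \<in> U1" for K
  proof -
    obtain a where a: "a \<in> G" "K = pull (adj p a) (K_of p)" using K(1) by (auto simp: orbit_map_def)
    \<comment> \<open>A maximal representative over \<open>U1\<close> lies in \<open>Q\<close>,
      where \<open>f\<close> recovers it from the coefficients alone.\<close>
    obtain d where d: "d \<in> maximal p" "pull d (K_of p) = K"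
      using ex_maximal[OF p Sp2_adj[OF a(1) p]] a(2) by metis
    have dG: "d \<in> G" using d(1) by (simp add: maximal_def)
    have "d \<notin> bad" using K(2) d(2) unfolding U1_def by blast
    then have dQ: "move d p \<in> Q" using d(1) unfolding bad_def by blast
    have sl: "slice_map p (move d p) = emb (coefs p K)"
      using maximal_slice[OF p d(1)] d(2) by (simp add: emb_def)
    have "emb (coefs p K) \<in> T" "f (emb (coefs p K)) = move d p" using Q(6)[OF dQ] sl by auto
    then have "coefs p K \<in> N0" "c (coefs p K) = d"
      using Sp2_eq_change[OF dG p] by (simp_all add: N0_def c_def)
    then show ?thesis using d(2) by simp
  qed
  have K0C: "K_of p \<in> orbit_map p ` G"
    using cubic_discriminants_orbit[OF p] cubic_discriminants_eq p by auto
  have "is_slice G (orbit_map p) U (coefs p) N s"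
    unfolding is_slice_def
  proof (intro conjI ballI)
    show "smooth_on U (coefs p)" by (rule smooth_on_mono[OF coefs_smooth]) simp
    have "smooth_on N0 s" unfolding s_def
      by (rule smooth_on_compose[OF N0 open_UNIV c_smooth _ adj_smooth]) simp
    then show "smooth_on N s" by (rule smooth_on_mono) (simp add: N_def)
    show "z \<in> N \<Longrightarrow> s z \<in> G" for z using sN by (simp add: N_def)
    show "z \<in> N \<Longrightarrow> orbit_map p (s z) \<in> U" for z using sN fr by (simp add: N_def U_def)
    show "z \<in> N \<Longrightarrow> coefs p (orbit_map p (s z)) = z" for z using sN fr by (simp add: N_def)
    show "K \<in> orbit_map p ` G \<inter> U \<Longrightarrow> coefs p K \<in> N" for K using key[of K] by (auto simp: N_def U_def)
    show "K \<in> orbit_map p ` G \<inter> U \<Longrightarrow> orbit_map p (s (coefs p K)) = K" for K using key[of K] sN(2) by (auto simp: U_def)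
  qed (use U N in auto)
  moreover have "K_of p \<in> U" using K0 key[OF K0C K0] by (simp add: U_def)
  ultimately show ?thesis by blast
qed

lemma pull_orbit_map:
  assumes p: "frame p" and a: "a \<in> G" and b: "b \<in> G"
  shows "pull a (orbit_map p (a o\<^sub>L b)) = orbit_map p b"
proof -
  note ab = Sp2_compose[OF a b]
  have "adj p (a o\<^sub>L b) o\<^sub>L a = adj p b"
  proof (rule blinfun_eqI)
    fix v
    show "(adj p (a o\<^sub>L b) o\<^sub>L a) v = adj p b v"
      using adj_left[OF ab p, of "adj p b v"] by (simp add: adj_right[OF b p])
  qed
  then show ?thesis unfolding orbit_map_def pull_compose by simp
qed

text \<open>The slice at the base tensor is translated by \<open>a\<close>, and a linear isomorphism
  replaces its coordinate space by \<open>real^7\<close>.\<close>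

lemma ex_slice:
  assumes p: "frame p" and K: "K \<in> orbit_map p ` G"
  shows "\<exists>U (L :: 'v tensor4 \<Rightarrow> real^7) N s. K \<in> U \<and> is_slice G (orbit_map p) U L N s"
proof -
  obtain U N s where K0: "K_of p \<in> U" and sl: "is_slice G (orbit_map p) U (coefs p) N s"
    using base_slice[OF p] by metis
  note sl = is_sliceD[OF sl]
  obtain a where a: "a \<in> G" "K = orbit_map p a" using K by blast
  obtain i :: "complex \<times> complex \<times> complex \<times> real \<Rightarrow> real^7" and k where ik:
    "bounded_linear i" "bounded_linear k" "\<And>x. k (i x) = x" "\<And>y. i (k y) = y"
    by (rule ex_iso_cart[where 'a = "complex \<times> complex \<times> complex \<times> real" and 'n = 7]) auto
  have pa: "pull a (orbit_map p (a o\<^sub>L b)) = orbit_map p b" if "b \<in> G" for b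
    by (rule pull_orbit_map[OF p a(1) that])
  have inj: "K1 = K2" if "pull a K1 = pull a K2" for K1 K2
  proof -
    have "pull (adj p a) (pull a K') = K'" for K'
      by (rule tensor4_eqI) (simp add: pull_apply adj_right[OF a(1) p])
    with that show ?thesis by metis
  qed
  have dec: "\<exists>b. b \<in> G \<and> K' = orbit_map p (a o\<^sub>L b)" if K': "K' \<in> orbit_map p ` G" for K'
  proof -
    obtain d where d: "d \<in> G" "K' = orbit_map p d" using K' by blast
    have "a o\<^sub>L (adj p a o\<^sub>L d) = d" by (rule blinfun_eqI) (simp add: adj_right[OF a(1) p])
    then show ?thesis using d Sp2_compose[OF Sp2_adj[OF a(1) p] d(1)] by (intro exI[of _ "adj p a o\<^sub>L d"]) simp
  qed
  have id: "a o\<^sub>L id_blinfun = a" "id_blinfun \<in> G"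
    by (auto intro: blinfun_eqI id_in_Sp2)
  have pull_s: "smooth_on UNIV (pull a)"
    by (intro smooth_on_pull smooth_on_const smooth_on_id open_UNIV)
  have pc: "continuous_on UNIV (pull a)" using smooth_on_continuous[OF pull_s] .
  have Ua: "open (pull a -` U)" by (rule open_vimage[OF sl(1) pc])
  have Nk: "open (k -` N)" using ik(2) sl(3) by (auto intro!: open_vimage simp: linear_continuous_on)
  have "is_slice G (orbit_map p) (pull a -` U) (\<lambda>K. i (coefs p (pull a K))) (k -` N) (\<lambda>z. a o\<^sub>L s (k z))"
    unfolding is_slice_def
  proof (intro conjI ballI Ua Nk)
    show "smooth_on (pull a -` U) (\<lambda>K. i (coefs p (pull a K)))"
      by (rule smooth_on_linear_compose[OF Ua ik(1)],
          rule smooth_on_compose[OF Ua open_UNIV smooth_on_mono[OF pull_s] _ coefs_smooth]) auto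
    have "smooth_on (k -` N) (\<lambda>z. s (k z))"
      by (rule smooth_on_compose[OF Nk sl(3) _ _ sl(4)]) (auto intro: smooth_on_bounded_linear Nk ik)
    then show "smooth_on (k -` N) (\<lambda>z. a o\<^sub>L s (k z))"
      by (rule smooth_on_linear_compose[OF Nk bounded_bilinear.bounded_linear_right[OF bounded_bilinear_blinfun_compose]])
    fix z assume "z \<in> k -` N"
    then have z: "k z \<in> N" by simp
    show "a o\<^sub>L s (k z) \<in> G" by (rule Sp2_compose[OF a(1) sl(5)[OF z]])
    show "orbit_map p (a o\<^sub>L s (k z)) \<in> pull a -` U" using pa[OF sl(5)[OF z]] sl(6)[OF z] by simp
    show "i (coefs p (pull a (orbit_map p (a o\<^sub>L s (k z))))) = z"
      using pa[OF sl(5)[OF z]] sl(7)[OF z] ik(4) by simp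
  next
    fix K' assume "K' \<in> orbit_map p ` G \<inter> pull a -` U"
    then obtain b where b: "b \<in> G" "K' = orbit_map p (a o\<^sub>L b)" and KU: "pull a K' \<in> U" using dec by blast
    have "pull a K' \<in> orbit_map p ` G \<inter> U" using pa[OF b(1)] b KU by auto
    note m = sl(8)[OF this]
    show "i (coefs p (pull a K')) \<in> k -` N" using m ik(3) by simp
    show "orbit_map p (a o\<^sub>L s (k (i (coefs p (pull a K'))))) = K'"
      unfolding ik(3) by (rule inj) (rule trans[OF pa[OF conjunct2[OF conjunct2[OF m]]] conjunct1[OF conjunct2[OF m]]])
  qed
  moreover have "K \<in> pull a -` U"
  proof -
    have "pull a (orbit_map p (a o\<^sub>L id_blinfun)) = orbit_map p id_blinfun" by (rule pa[OF id(2)])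
    moreover have "orbit_map p id_blinfun = K_of p" using orbit_map_eq[OF p id(2)] by simp
    ultimately show ?thesis using K0 a(2) by (simp add: id(1))
  qed
  ultimately show ?thesis by blast
qed

end

theorem proposition3p10:
  fixes g :: "'v::euclidean_space \<Rightarrow> 'v \<Rightarrow> real" and J1 J2 J3 :: "'v \<Rightarrow> 'v"
  assumes "DIM('v) = 8"
    and "hyper_hermitian g J1 J2 J3"
  shows "let C = cubic_discriminants g J1 J2 J3;
             atlas_C = (submanifold_atlas C :: ('v tensor4, real^7) chart set);
             G = Sp2 g J1 J2 J3
         in smooth_manifold (top_of_set C) atlas_C \<and>
            (\<exists>H. Sp1_ir g J1 J2 J3 H) \<and>
            (\<forall>H. Sp1_ir g J1 J2 J3 H \<longrightarrow>
               (let atlas_GH = (coset_atlas G H :: (('v \<Rightarrow>\<^sub>L 'v) set, real^7) chart set)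
                in smooth_manifold (coset_topology G H) atlas_GH \<and>
                   (\<exists>f. diffeomorphism (top_of_set C) atlas_C (coset_topology G H) atlas_GH f)))"
proof -
  interpret hyper_hermitian_8 g J1 J2 J3
    using assms by unfold_locales
  have so: "sliced_orbit TYPE(real^7) G (ir p) (orbit_map p)" if p: "frame p" for p
    by unfold_locales (use orbit_map_smooth orbit_map_fibres[OF p] ex_slice[OF p] in auto)
  obtain p where p: "frame p" by (rule frame_exists)
  note Cp = cubic_discriminants_orbit
  have "smooth_manifold (top_of_set (cubic_discriminants g J1 J2 J3))
      (submanifold_atlas (cubic_discriminants g J1 J2 J3) :: ('v tensor4, real^7) chart set)"
    unfolding Cp[OF p] by (rule sliced_orbit.smooth_manifold_C[OF so[OF p]])
  moreover have "Sp1_ir g J1 J2 J3 (ir p)" using p Sp1_ir_iff by blast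
  moreover have "smooth_manifold (coset_topology G H) (coset_atlas G H :: (('v \<Rightarrow>\<^sub>L 'v) set, real^7) chart set) \<and>
      (\<exists>f. diffeomorphism (top_of_set (cubic_discriminants g J1 J2 J3))
        (submanifold_atlas (cubic_discriminants g J1 J2 J3) :: ('v tensor4, real^7) chart set)
        (coset_topology G H) (coset_atlas G H :: (('v \<Rightarrow>\<^sub>L 'v) set, real^7) chart set) f)"
    if H: "Sp1_ir g J1 J2 J3 H" for H
  proof -
    \<comment> \<open>Another member of the conjugacy class is \<open>ir q\<close> for another frame
      \<open>q\<close>, and the same set is also the orbit of the tensor of
      \<open>q\<close>.\<close>
    obtain q where q: "frame q" "H = ir q" using H Sp1_ir_iff by blast
    show ?thesis
      unfolding Cp[OF q(1)] q(2)
      using sliced_orbit.smooth_manifold_GH[OF so[OF q(1)]] sliced_orbit.diffeomorphism_F[OF so[OF q(1)]] by blast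
  qed
  ultimately show ?thesis unfolding Let_def by blast
qed

end
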